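(* Let $\mathfrak{C}$ be a class of finite groups closed under subgroups, quotients, finite direct products and extensions. Every pro-$\mathfrak{C}$-group $G$ has a free simplicial pro-$\mathfrak{C}$-resolution.
   Context: A simplicial pro-$\mathfrak{C}$-group is a simplicial object in the category of pro-$\mathfrak{C}$-groups (with continuous homomorphisms), with face maps $d_i$ and degeneracies $s_i$. Its homotopy groups $\pi_n$ are the homology groups of the Moore complex $NX_n=\bigcap_{i=0}^{n-1}\ker(d_i:X_n\to X_{n-1})$ with differential $d_n|_{NX_n}$. A free simplicial pro-$\mathfrak{C}$-resolution of a pro-$\mathfrak{C}$-group $G$ is a simplicial pro-$\mathfrak{C}$-group $X$ with $\pi_n(X)=0$ for $n>0$ and $\pi_0(X)=G$, which has a CW-basis, i.e.: (a) for each $n$, $X_n$ is the free pro-$\mathfrak{C}$-group on a (pointed) profinite space $\mathcal{F}_n\subset X_n$ (the base point, if any, being the identity); (b) the $\mathcal{F}_n$ are stable under degeneracies: if $\sigma\in\mathcal{F}_n$ then $s_i(\sigma)\in\mathcal{F}_{n+1}$ for $0\le i\le n$; and $\mathcal{F}_{n+1}=\bigcup_{i=0}^{n}s_i(\mathcal{F}_n)\uplus Y_{n+1}$ where $Y_{n+1}$ is a closed subspace of $X_{n+1}$ (the union is disjoint, up to the common base point). *)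

theory Defs
  imports "HOL-Analysis.Analysis" "HOL-Algebra.Coset"
begin

section \<open>Classes of finite groups\<close>

text \<open>
  Every finite group has an isomorphic copy with carrier in \<^typ>\<open>nat\<close>, so an
  isomorphism-closed class of finite groups is given by a set \<open>C\<close> of finite groups over
  \<^typ>\<open>nat\<close>; a group over an arbitrary type belongs to the class iff it is isomorphic to a
  member of \<open>C\<close>.
\<close>

definition of_class :: "nat monoid set \<Rightarrow> 'a monoid \<Rightarrow> bool" where
  "of_class C G \<longleftrightarrow> group G \<and> (\<exists>K\<in>C. K \<cong> G)"

definition class_of_finite_groups :: "nat monoid set \<Rightarrow> bool" where
  "class_of_finite_groups C \<longleftrightarrow> (\<forall>K\<in>C. group K \<and> finite (carrier K))"

definition subgroup_closed :: "nat monoid set \<Rightarrow> bool" where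
  "subgroup_closed C \<longleftrightarrow> (\<forall>K\<in>C. \<forall>H. subgroup H K \<longrightarrow> of_class C (K\<lparr>carrier := H\<rparr>))"

definition quotient_closed :: "nat monoid set \<Rightarrow> bool" where
  "quotient_closed C \<longleftrightarrow> (\<forall>K\<in>C. \<forall>N. N \<lhd> K \<longrightarrow> of_class C (K Mod N))"

definition product_closed :: "nat monoid set \<Rightarrow> bool" where
  "product_closed C \<longleftrightarrow> (\<forall>K\<in>C. \<forall>L\<in>C. of_class C (K \<times>\<times> L))"

definition extension_closed :: "nat monoid set \<Rightarrow> bool" where
  "extension_closed C \<longleftrightarrow>
     (\<forall>(E :: nat monoid) N. group E \<and> N \<lhd> E \<and> of_class C (E\<lparr>carrier := N\<rparr>) \<and> of_class C (E Mod N)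
        \<longrightarrow> of_class C E)"


section \<open>Profinite spaces and pro-\<open>C\<close>-groups\<close>

definition totally_disconnected_space :: "'a topology \<Rightarrow> bool" where
  "totally_disconnected_space T \<longleftrightarrow> (\<forall>S. connectedin T S \<longrightarrow> (\<exists>a. S \<subseteq> {a}))"

definition profinite_space :: "'a topology \<Rightarrow> bool" where
  "profinite_space T \<longleftrightarrow> compact_space T \<and> Hausdorff_space T \<and> totally_disconnected_space T"

definition topological_group_on :: "'a monoid \<Rightarrow> 'a topology \<Rightarrow> bool" where
  "topological_group_on G T \<longleftrightarrow>
     group G \<and> topspace T = carrier G \<and>
     continuous_map (prod_topology T T) T (\<lambda>(x, y). x \<otimes>\<^bsub>G\<^esub> y) \<and>
     continuous_map T T (\<lambda>x. inv\<^bsub>G\<^esub> x)"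

definition pro_C_group :: "nat monoid set \<Rightarrow> 'a monoid \<Rightarrow> 'a topology \<Rightarrow> bool" where
  "pro_C_group C G T \<longleftrightarrow>
     topological_group_on G T \<and> profinite_space T \<and>
     (\<forall>N. N \<lhd> G \<and> openin T N \<longrightarrow> of_class C (G Mod N))"

definition continuous_hom ::
  "'a monoid \<Rightarrow> 'a topology \<Rightarrow> 'b monoid \<Rightarrow> 'b topology \<Rightarrow> ('a \<Rightarrow> 'b) set" where
  "continuous_hom G T H S = {f \<in> hom G H. continuous_map T S f}"


section \<open>Free pro-\<open>C\<close>-groups\<close>

text \<open>
  The subspace \<open>F\<close> of \<open>G\<close> is pointed by the identity if it contains it, and unpointed otherwise.
\<close>

definition extends_uniquely ::
  "'a monoid \<Rightarrow> 'a topology \<Rightarrow> 'a set \<Rightarrow> 'b monoid \<Rightarrow> 'b topology \<Rightarrow> bool" where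
  "extends_uniquely G T F H S \<longleftrightarrow>
     (\<forall>f. continuous_map (subtopology T F) S f \<and> (\<one>\<^bsub>G\<^esub> \<in> F \<longrightarrow> f \<one>\<^bsub>G\<^esub> = \<one>\<^bsub>H\<^esub>) \<longrightarrow>
        (\<exists>!g. g \<in> extensional (carrier G) \<and> g \<in> continuous_hom G T H S \<and> (\<forall>x\<in>F. g x = f x)))"

text \<open>
  A formula cannot quantify over types, so the test groups \<open>H\<close> have elements of the same type as
  \<open>G\<close>. If that type is infinite, the universal property for all pro-\<open>C\<close>-groups of all types
  follows: see \<open>free_pro_C_group_extends_uniquely\<close> below.
\<close>

definition free_pro_C_group :: "nat monoid set \<Rightarrow> 'a monoid \<Rightarrow> 'a topology \<Rightarrow> 'a set \<Rightarrow> bool" where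
  "free_pro_C_group C G T F \<longleftrightarrow>
     pro_C_group C G T \<and> F \<subseteq> carrier G \<and> profinite_space (subtopology T F) \<and>
     (\<forall>(H :: 'a monoid) S. pro_C_group C H S \<longrightarrow> extends_uniquely G T F H S)"


lemma openin_forall_compact:
  assumes K: "compactin T K" and f: "continuous_map (prod_topology S T) R f" and V: "openin R V"
  shows "openin S {x \<in> topspace S. \<forall>k\<in>K. f (x, k) \<in> V}"
proof -
  let ?P = "prod_topology S (subtopology T K)"
  have KT: "K \<subseteq> topspace T" using K by (simp add: compactin_subset_topspace)
  have f': "continuous_map ?P R f"
    using continuous_map_from_subtopology[OF f, of "topspace S \<times> K"]
    by (simp add: subtopology_Times)
  let ?W = "{z \<in> topspace ?P. f z \<in> topspace R - V}"
  have "closedin ?P ?W"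
    using closedin_continuous_map_preimage[OF f'] V by blast
  then have "closedin S (fst ` ?W)"
    using Abstract_Topological_Spaces.closed_map_fst[OF compact_space_subtopology[OF K], of S]
    unfolding closed_map_def by blast
  moreover have "fst ` ?W = topspace S - {x \<in> topspace S. \<forall>k\<in>K. f (x, k) \<in> V}"
  proof -
    have "f (x, k) \<in> topspace R" if "x \<in> topspace S" "k \<in> K" for x k
      using continuous_map_image_subset_topspace[OF f] that KT by auto
    then show ?thesis using KT by (force simp: image_iff)
  qed
  ultimately have "openin S (topspace S - (topspace S - {x \<in> topspace S. \<forall>k\<in>K. f (x, k) \<in> V}))"
    using openin_diff[OF openin_topspace] by metis
  then show ?thesis
    by (simp add: Diff_Diff_Int Int_absorb1)
qed

lemma profinite_clopen_nbhd:
  assumes T: "profinite_space T" and U: "openin T U" "x \<in> U"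
  obtains V where "openin T V" "closedin T V" "x \<in> V" "V \<subseteq> U"
proof -
  have x: "x \<in> topspace T" using U openin_subset by blast
  have "separated_between T {x} (topspace T - U)"
  proof (rule cut_wire_fence_theorem_gen)
    show "compact_space T" "Hausdorff_space T \<or> regular_space T \<or> normal_space T"
      using T by (auto simp: profinite_space_def)
    show "compactin T {x}" using x by simp
    show "closedin T (topspace T - U)" using U by blast
    fix C assume "connectedin T C"
    then obtain a where "C \<subseteq> {a}" using T unfolding profinite_space_def totally_disconnected_space_def by blast
    then show "disjnt C {x} \<or> disjnt C (topspace T - U)"
      using U by (auto simp: disjnt_iff)
  qed
  then obtain V W where "openin T V" "openin T W" "V \<union> W = topspace T" "disjnt V W" "x \<in> V" "topspace T - U \<subseteq> W"
    unfolding separated_between_def by auto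
  moreover have "V = topspace T - W"
    using calculation by (auto simp: disjnt_iff)
  moreover have "closedin T (topspace T - W)"
    using \<open>openin T W\<close> by blast
  moreover have "V \<subseteq> U"
    using calculation by (auto simp: disjnt_iff)
  ultimately show thesis
    using that[of V] by simp
qed

lemma profinite_group_open_normal:
  fixes G (structure)
  assumes G: "topological_group_on G T" and T: "profinite_space T"
    and U: "openin T U" "\<one>\<^bsub>G\<^esub> \<in> U"
  obtains N where "N \<lhd> G" "openin T N" "N \<subseteq> U"
proof -
  interpret group G using G by (simp add: topological_group_on_def)
  have top: "topspace T = carrier G"
    and mul: "continuous_map (prod_topology T T) T (\<lambda>(x, y). x \<otimes>\<^bsub>G\<^esub> y)"
    and inv: "continuous_map T T (\<lambda>x. inv\<^bsub>G\<^esub> x)"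
    using G by (auto simp: topological_group_on_def)
  have cp: "compactin T K" if "closedin T K" for K
    using that T by (auto simp: profinite_space_def closedin_compact_space)
  obtain V where V: "openin T V" "closedin T V" "\<one>\<^bsub>G\<^esub> \<in> V" "V \<subseteq> U"
    using profinite_clopen_nbhd[OF T U] .
  have VG: "V \<subseteq> carrier G" using V(1) openin_subset top by blast
  let ?A = "{x \<in> topspace T. \<forall>k\<in>V. (\<lambda>(x, y). x \<otimes>\<^bsub>G\<^esub> y) (x, k) \<in> V}"
  define H where "H = ?A \<inter> {x \<in> topspace T. inv\<^bsub>G\<^esub> x \<in> ?A}"
  have "openin T ?A"
    by (rule openin_forall_compact[OF cp mul]) (use V in auto)
  then have oH: "openin T H"
    unfolding H_def by (intro openin_Int openin_continuous_map_preimage[OF inv])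
  have Hiff: "x \<in> H \<longleftrightarrow> x \<in> carrier G \<and> (\<forall>k\<in>V. x \<otimes> k \<in> V) \<and> (\<forall>k\<in>V. inv x \<otimes> k \<in> V)" for x
    by (auto simp: H_def top)
  have H1: "\<one> \<in> H" using VG by (auto simp: Hiff)
  have Hinv: "inv x \<in> H" if "x \<in> H" for x using that by (auto simp: Hiff)
  have Hm: "x \<otimes> y \<in> H" if xy: "x \<in> H" "y \<in> H" for x y
  proof -
    have "x \<in> carrier G" "y \<in> carrier G" using xy by (auto simp: Hiff)
    then show ?thesis
      using xy VG unfolding Hiff by (auto simp: inv_mult_group m_assoc subset_iff)
  qed
  have HU: "H \<subseteq> U"
  proof
    fix x assume "x \<in> H"
    then have "x \<otimes> \<one> \<in> V" "x \<in> carrier G" using V by (auto simp: Hiff)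
    then show "x \<in> U" using V by auto
  qed
  have HG: "H \<subseteq> carrier G" by (auto simp: Hiff)
  define N where "N = {n \<in> topspace T. \<forall>x\<in>topspace T. (\<lambda>(n, x). x \<otimes> n \<otimes> inv x) (n, x) \<in> H}"
  have conj: "continuous_map (prod_topology T T) T (\<lambda>(n, x). x \<otimes> n \<otimes> inv x)"
  proof -
    have m: "continuous_map (prod_topology T T) T (\<lambda>z. f z \<otimes> g z)"
      if "continuous_map (prod_topology T T) T f" "continuous_map (prod_topology T T) T g" for f g
      using continuous_map_compose[OF _ mul, of "prod_topology T T" "\<lambda>z. (f z, g z)"] that
      by (simp add: continuous_map_paired o_def)
    have i: "continuous_map (prod_topology T T) T (\<lambda>z. inv (snd z))"
      using continuous_map_compose[OF continuous_map_snd inv] by (simp add: o_def)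
    have "continuous_map (prod_topology T T) T (\<lambda>z. (snd z \<otimes> fst z) \<otimes> inv (snd z))"
      by (intro m i continuous_map_fst continuous_map_snd)
    then show ?thesis by (simp add: case_prod_unfold)
  qed
  have "openin T N"
    unfolding N_def by (rule openin_forall_compact[OF cp conj oH]) auto
  moreover have Niff: "n \<in> N \<longleftrightarrow> n \<in> carrier G \<and> (\<forall>x\<in>carrier G. x \<otimes> n \<otimes> inv x \<in> H)" for n
    by (auto simp: N_def top)
  have NH: "N \<subseteq> H"
  proof
    fix n assume "n \<in> N"
    then have n: "n \<in> carrier G" "\<forall>x\<in>carrier G. x \<otimes> n \<otimes> inv x \<in> H" using Niff by blast+
    then have "\<one> \<otimes> n \<otimes> inv \<one> \<in> H" by blast
    then show "n \<in> H" using n(1) by simp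
  qed
  moreover have "N \<lhd> G"
  proof -
    have "subgroup N G"
    proof (rule subgroupI)
      show "N \<subseteq> carrier G" by (auto simp: Niff)
      show "N \<noteq> {}" 
      proof -
        have "\<one> \<in> N" using H1 by (simp add: Niff)
        then show ?thesis by blast
      qed
    next
      fix a assume a: "a \<in> N"
      have "x \<otimes> inv a \<otimes> inv x \<in> H" if x: "x \<in> carrier G" for x
      proof -
        have "inv (x \<otimes> a \<otimes> inv x) \<in> H" using a x Hinv by (auto simp: Niff)
        then show ?thesis using a x by (simp add: Niff inv_mult_group m_assoc)
      qed
      then show "inv a \<in> N" using a by (auto simp: Niff)
    next
      fix a b assume ab: "a \<in> N" "b \<in> N"
      have "x \<otimes> (a \<otimes> b) \<otimes> inv x \<in> H" if x: "x \<in> carrier G" for x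
      proof -
        have abG: "a \<in> carrier G" "b \<in> carrier G" using ab by (auto simp: Niff)
        have "(x \<otimes> a \<otimes> inv x) \<otimes> (x \<otimes> b \<otimes> inv x) \<in> H" using ab x Hm by (auto simp: Niff)
        moreover have "(x \<otimes> a \<otimes> inv x) \<otimes> (x \<otimes> b \<otimes> inv x) = x \<otimes> (a \<otimes> b) \<otimes> inv x"
        proof -
          have "inv x \<otimes> (x \<otimes> (b \<otimes> inv x)) = b \<otimes> inv x"
            using abG x by (simp flip: m_assoc)
          then show ?thesis using abG x by (simp add: m_assoc)
        qed
        ultimately show ?thesis by simp
      qed
      then show "a \<otimes> b \<in> N" using ab by (auto simp: Niff)
    qed
    moreover have "y \<otimes> n \<otimes> inv y \<in> N" if y: "y \<in> carrier G" and n: "n \<in> N" for y n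
    proof -
      have nG: "n \<in> carrier G" using n by (auto simp: Niff)
      have "x \<otimes> (y \<otimes> n \<otimes> inv y) \<otimes> inv x \<in> H" if x: "x \<in> carrier G" for x
      proof -
        have "(x \<otimes> y) \<otimes> n \<otimes> inv (x \<otimes> y) \<in> H" using x y n by (auto simp: Niff)
        then show ?thesis using x y nG by (simp add: inv_mult_group m_assoc)
      qed
      then show ?thesis using y nG by (auto simp: Niff)
    qed
    ultimately show ?thesis by (simp add: normal_inv_iff)
  qed
  ultimately show thesis using that[of N] HU by (meson order_trans)
qed

lemma group_copy:
  fixes K :: "'b monoid" and e :: "'b \<Rightarrow> 'a"
  assumes "group K" "inj e"
  obtains L :: "'a monoid" where "group L" "e \<in> iso K L" "carrier L = e ` carrier K"
proof
  interpret K: group K by fact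
  define L :: "'a monoid" where "L = \<lparr>carrier = e ` carrier K,
    mult = (\<lambda>a b. e (inv_into UNIV e a \<otimes>\<^bsub>K\<^esub> inv_into UNIV e b)), one = e \<one>\<^bsub>K\<^esub>\<rparr>"
  have [simp]: "inv_into UNIV e (e x) = x" for x using assms by simp
  show "group L"
  proof (rule groupI)
    fix x assume "x \<in> carrier L"
    then obtain k where k: "x = e k" "k \<in> carrier K" by (auto simp: L_def)
    then show "\<exists>y\<in>carrier L. y \<otimes>\<^bsub>L\<^esub> x = \<one>\<^bsub>L\<^esub>"
      by (intro bexI[of _ "e (inv\<^bsub>K\<^esub> k)"]) (auto simp: L_def)
  qed (auto simp: L_def K.m_assoc)
  show "e \<in> iso K L"
    using assms(2) by (auto simp: iso_def hom_def L_def bij_betw_def intro: inj_on_subset)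
  show "carrier L = e ` carrier K" by (simp add: L_def)
qed

lemma open_normal_quotient_copy:
  fixes H :: "'b monoid"
  assumes inf: "infinite (UNIV :: 'a set)"
    and C: "class_of_finite_groups C" "quotient_closed C"
    and H: "pro_C_group C H S" and N: "N \<lhd> H" "openin S N"
  obtains K :: "'a monoid" and q where
    "pro_C_group C K (discrete_topology (carrier K))"
    "q \<in> continuous_hom H S K (discrete_topology (carrier K))"
    "q ` carrier H = carrier K"
    "\<And>x y. x \<in> carrier H \<Longrightarrow> y \<in> carrier H \<Longrightarrow> q x = q y \<longleftrightarrow> x \<otimes>\<^bsub>H\<^esub> inv\<^bsub>H\<^esub> y \<in> N"
proof -
  interpret N: normal N H by fact
  have top: "topspace S = carrier H"
    and mul: "continuous_map (prod_topology S S) S (\<lambda>(x, y). x \<otimes>\<^bsub>H\<^esub> y)"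
    using H by (auto simp: pro_C_group_def topological_group_on_def)
  obtain K0 where K0: "K0 \<in> C" "K0 \<cong> H Mod N"
    using H N unfolding pro_C_group_def of_class_def by blast
  interpret K0: group K0 using C(1) K0 by (simp add: class_of_finite_groups_def)
  have finK0: "finite (carrier K0)" using C(1) K0 by (simp add: class_of_finite_groups_def)
  obtain \<theta> where \<theta>: "\<theta> \<in> iso (H Mod N) K0"
    using K0.iso_sym[OF K0(2)] by (auto simp: is_iso_def)
  obtain e :: "nat \<Rightarrow> 'a" where e: "inj e"
    using inf infinite_countable_subset by blast
  obtain K :: "'a monoid" where K: "group K" "e \<in> iso K0 K" "carrier K = e ` carrier K0"
    using group_copy[OF K0.group_axioms e] .
  interpret K: group K by fact
  define q where "q x = e (\<theta> (N #>\<^bsub>H\<^esub> x))" for x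
  have \<pi>: "(\<lambda>x. N #>\<^bsub>H\<^esub> x) \<in> hom H (H Mod N)" by (rule N.r_coset_hom_Mod)
  have qhom: "q \<in> hom H K"
    using \<pi> \<theta> K(2) unfolding q_def by (auto simp: iso_def hom_def Pi_iff)
  interpret q: group_hom H K q
    by (intro group_hom.intro group_hom_axioms.intro N.is_group K.is_group qhom)
  have surj: "q ` carrier H = carrier K"
  proof -
    have "\<theta> ` carrier (H Mod N) = carrier K0" using \<theta> by (simp add: iso_def bij_betw_def)
    moreover have "carrier (H Mod N) = (\<lambda>x. N #>\<^bsub>H\<^esub> x) ` carrier H"
      by (auto simp: FactGroup_def RCOSETS_def)
    ultimately have "e ` \<theta> ` (\<lambda>x. N #>\<^bsub>H\<^esub> x) ` carrier H = carrier K" using K(3) by simp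
    then show ?thesis by (simp add: q_def image_image)
  qed
  have ker: "q z = \<one>\<^bsub>K\<^esub> \<longleftrightarrow> z \<in> N" if z: "z \<in> carrier H" for z
  proof -
    have "q z = q \<one>\<^bsub>H\<^esub> \<longleftrightarrow> N #>\<^bsub>H\<^esub> z = N #>\<^bsub>H\<^esub> \<one>\<^bsub>H\<^esub>"
    proof -
      have "inj_on \<theta> (carrier (H Mod N))" using \<theta> by (simp add: iso_def bij_betw_def)
      moreover have "N #>\<^bsub>H\<^esub> z \<in> carrier (H Mod N)" "N #>\<^bsub>H\<^esub> \<one>\<^bsub>H\<^esub> \<in> carrier (H Mod N)"
        using z by (auto simp: FactGroup_def RCOSETS_def)
      ultimately show ?thesis
        unfolding q_def using e by (auto simp: inj_eq inj_on_eq_iff)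
    qed
    also have "N #>\<^bsub>H\<^esub> \<one>\<^bsub>H\<^esub> = N" by (simp add: N.coset_mult_one N.subset)
    also have "N #>\<^bsub>H\<^esub> z = N \<longleftrightarrow> z \<in> N"
      using z N.coset_join1 N.coset_join2 N.subgroup_axioms by blast
    finally show ?thesis by simp
  qed
  have keq: "q x = q y \<longleftrightarrow> x \<otimes>\<^bsub>H\<^esub> inv\<^bsub>H\<^esub> y \<in> N" if xy: "x \<in> carrier H" "y \<in> carrier H" for x y
  proof -
    have "q x = q y \<longleftrightarrow> q x \<otimes>\<^bsub>K\<^esub> inv\<^bsub>K\<^esub> q y = \<one>\<^bsub>K\<^esub>"
      using xy by (metis K.inv_equality K.inv_inv K.inv_closed K.r_inv q.hom_closed)
    also have "q x \<otimes>\<^bsub>K\<^esub> inv\<^bsub>K\<^esub> q y = q (x \<otimes>\<^bsub>H\<^esub> inv\<^bsub>H\<^esub> y)" using xy by simp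
    also have "q (x \<otimes>\<^bsub>H\<^esub> inv\<^bsub>H\<^esub> y) = \<one>\<^bsub>K\<^esub> \<longleftrightarrow> x \<otimes>\<^bsub>H\<^esub> inv\<^bsub>H\<^esub> y \<in> N"
      by (rule ker) (simp add: xy)
    finally show ?thesis .
  qed
  have cont: "continuous_map S (discrete_topology (carrier K)) q"
    unfolding continuous_map_def
  proof (intro conjI allI impI)
    show "q \<in> topspace S \<rightarrow> topspace (discrete_topology (carrier K))" using top by auto
    fix U assume "openin (discrete_topology (carrier K)) U"
    show "openin S {x \<in> topspace S. q x \<in> U}"
    proof (subst openin_subopen, intro ballI)
      fix x assume x: "x \<in> {x \<in> topspace S. q x \<in> U}"
      have tr: "continuous_map S S (\<lambda>y. y \<otimes>\<^bsub>H\<^esub> inv\<^bsub>H\<^esub> x)"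
        using continuous_map_compose[OF _ mul, of S "\<lambda>y. (y, inv\<^bsub>H\<^esub> x)"] x top
        by (simp add: continuous_map_paired o_def)
      let ?V = "{y \<in> topspace S. y \<otimes>\<^bsub>H\<^esub> inv\<^bsub>H\<^esub> x \<in> N}"
      have "openin S ?V" by (rule openin_continuous_map_preimage[OF tr N(2)])
      moreover have "x \<in> ?V" using x top by simp
      moreover have "?V \<subseteq> {x \<in> topspace S. q x \<in> U}" using x top keq by force
      ultimately show "\<exists>V. openin S V \<and> x \<in> V \<and> V \<subseteq> {x \<in> topspace S. q x \<in> U}" by blast
    qed
  qed
  have "of_class C (K Mod M)" if M: "M \<lhd> K" for M
  proof -
    interpret M: normal M K by fact
    define p where "p x = M #>\<^bsub>K\<^esub> e x" for x
    have ph: "p \<in> hom K0 (K Mod M)"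
      using M.r_coset_hom_Mod K(2) unfolding p_def by (auto simp: iso_def hom_def Pi_iff)
    interpret p: group_hom K0 "K Mod M" p
      by (intro group_hom.intro group_hom_axioms.intro K0.is_group M.factorgroup_is_group ph)
    have "p ` carrier K0 = carrier (K Mod M)"
      using K(3) by (auto simp: p_def FactGroup_def RCOSETS_def)
    then have "K0 Mod kernel K0 (K Mod M) p \<cong> K Mod M" by (rule p.FactGroup_iso)
    moreover have "of_class C (K0 Mod kernel K0 (K Mod M) p)"
      using C(2) K0(1) p.normal_kernel unfolding quotient_closed_def by blast
    ultimately show ?thesis
      unfolding of_class_def using M.factorgroup_is_group iso_trans by blast
  qed
  moreover have "topological_group_on K (discrete_topology (carrier K))"
    unfolding topological_group_on_def
    by (auto simp: K.is_group simp flip: prod_topology_discrete_topology)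
  moreover have "profinite_space (discrete_topology (carrier K))"
    using finK0 K(3)
    by (auto simp: profinite_space_def totally_disconnected_space_def connectedin_discrete_topology
        compact_space_discrete_topology)
  ultimately have "pro_C_group C K (discrete_topology (carrier K))"
    by (simp add: pro_C_group_def)
  then show thesis
    using that[of K q] qhom cont surj keq by (simp add: continuous_hom_def)
qed

theorem free_pro_C_group_extends_uniquely:
  fixes G :: "'a monoid" and H :: "'b monoid"
  assumes inf: "infinite (UNIV :: 'a set)"
    and C: "class_of_finite_groups C" "quotient_closed C"
    and free: "free_pro_C_group C G T F" and H: "pro_C_group C H S"
  shows "extends_uniquely G T F H S"
  unfolding extends_uniquely_def
proof (intro allI impI)
  fix f assume f: "continuous_map (subtopology T F) S f \<and> (\<one>\<^bsub>G\<^esub> \<in> F \<longrightarrow> f \<one>\<^bsub>G\<^esub> = \<one>\<^bsub>H\<^esub>)"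
  interpret G: group G
    using free by (simp add: free_pro_C_group_def pro_C_group_def topological_group_on_def)
  interpret H: group H using H by (simp add: pro_C_group_def topological_group_on_def)
  have FG: "F \<subseteq> carrier G" and topG: "topspace T = carrier G"
    using free by (auto simp: free_pro_C_group_def pro_C_group_def topological_group_on_def)
  have tg: "topological_group_on H S" and prof: "profinite_space S" and top: "topspace S = carrier H"
    and mul: "continuous_map (prod_topology S S) S (\<lambda>(x, y). x \<otimes>\<^bsub>H\<^esub> y)"
    using H by (auto simp: pro_C_group_def topological_group_on_def)
  have fF: "f x \<in> carrier H" if "x \<in> F" for x
    using f that FG topG top continuous_map_image_subset_topspace[of "subtopology T F" S f]
    by (simp add: image_subset_iff subset_iff)
  have restr: "restrict g (carrier G) \<in> continuous_hom G T L R"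
    if "g \<in> continuous_hom G T L R" for g and L :: "'c monoid" and R
    using that topG continuous_map_eq[of T R g "restrict g (carrier G)"]
    by (auto simp: continuous_hom_def hom_def Pi_iff)
  define \<N> where "\<N> = {N. N \<lhd> H \<and> openin S N}"
  have "\<forall>N\<in>\<N>. \<exists>(K :: 'a monoid) q. pro_C_group C K (discrete_topology (carrier K)) \<and>
    q \<in> continuous_hom H S K (discrete_topology (carrier K)) \<and> q ` carrier H = carrier K \<and>
    (\<forall>x\<in>carrier H. \<forall>y\<in>carrier H. q x = q y \<longleftrightarrow> x \<otimes>\<^bsub>H\<^esub> inv\<^bsub>H\<^esub> y \<in> N)"
  proof
    fix N assume "N \<in> \<N>"
    then have N: "N \<lhd> H" "openin S N" by (simp_all add: \<N>_def)
    obtain K :: "'a monoid" and q where "pro_C_group C K (discrete_topology (carrier K))"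
      "q \<in> continuous_hom H S K (discrete_topology (carrier K))" "q ` carrier H = carrier K"
      "\<And>x y. x \<in> carrier H \<Longrightarrow> y \<in> carrier H \<Longrightarrow> q x = q y \<longleftrightarrow> x \<otimes>\<^bsub>H\<^esub> inv\<^bsub>H\<^esub> y \<in> N"
      by (rule open_normal_quotient_copy[OF inf C H N]) blast
    then show "\<exists>(K :: 'a monoid) q. pro_C_group C K (discrete_topology (carrier K)) \<and>
      q \<in> continuous_hom H S K (discrete_topology (carrier K)) \<and> q ` carrier H = carrier K \<and>
      (\<forall>x\<in>carrier H. \<forall>y\<in>carrier H. q x = q y \<longleftrightarrow> x \<otimes>\<^bsub>H\<^esub> inv\<^bsub>H\<^esub> y \<in> N)"
      by (intro exI[of _ K] exI[of _ q]) blast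
  qed
  then obtain K :: "'b set \<Rightarrow> 'a monoid" and q where
    K: "\<And>N. N \<in> \<N> \<Longrightarrow> pro_C_group C (K N) (discrete_topology (carrier (K N)))"
    and q: "\<And>N. N \<in> \<N> \<Longrightarrow> q N \<in> continuous_hom H S (K N) (discrete_topology (carrier (K N)))"
    and qsurj: "\<And>N. N \<in> \<N> \<Longrightarrow> q N ` carrier H = carrier (K N)"
    and qeq: "\<And>N x y. \<lbrakk>N \<in> \<N>; x \<in> carrier H; y \<in> carrier H\<rbrakk> \<Longrightarrow>
      q N x = q N y \<longleftrightarrow> x \<otimes>\<^bsub>H\<^esub> inv\<^bsub>H\<^esub> y \<in> N"
    by metis
  let ?D = "\<lambda>N. discrete_topology (carrier (K N))"
  have Kg: "group (K N)" if "N \<in> \<N>" for N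
    using K[OF that] by (simp add: pro_C_group_def topological_group_on_def)
  have qh: "group_hom H (K N) (q N)" if "N \<in> \<N>" for N
    using q[OF that] Kg[OF that] H.is_group
    by (simp add: continuous_hom_def group_hom_def group_hom_axioms_def)
  have qc: "continuous_map S (?D N) (q N)" if "N \<in> \<N>" for N
    using q[OF that] by (simp add: continuous_hom_def)
  have ex1: "\<exists>!g. g \<in> extensional (carrier G) \<and> g \<in> continuous_hom G T (K N) (?D N) \<and>
      (\<forall>x\<in>F. g x = q N (f x))" if N: "N \<in> \<N>" for N
  proof -
    have "extends_uniquely G T F (K N) (?D N)"
      using free K[OF N] by (simp add: free_pro_C_group_def)
    moreover have "continuous_map (subtopology T F) (?D N) (\<lambda>x. q N (f x))"
      using continuous_map_compose[of "subtopology T F" S f "?D N" "q N"] f qc[OF N]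
      by (simp add: o_def)
    moreover have "\<one>\<^bsub>G\<^esub> \<in> F \<longrightarrow> q N (f \<one>\<^bsub>G\<^esub>) = \<one>\<^bsub>K N\<^esub>"
      using f group_hom.hom_one[OF qh[OF N]] by simp
    ultimately show ?thesis unfolding extends_uniquely_def by blast
  qed
  then obtain \<rho> where
    \<rho>: "\<And>N. N \<in> \<N> \<Longrightarrow> \<rho> N \<in> continuous_hom G T (K N) (?D N)"
    and \<rho>F: "\<And>N x. N \<in> \<N> \<Longrightarrow> x \<in> F \<Longrightarrow> \<rho> N x = q N (f x)"
    and \<rho>ext: "\<And>N. N \<in> \<N> \<Longrightarrow> \<rho> N \<in> extensional (carrier G)"
    by metis
  have \<rho>uniq: "g x = \<rho> N x"
    if N: "N \<in> \<N>" and g: "g \<in> continuous_hom G T (K N) (?D N)" "\<And>x. x \<in> F \<Longrightarrow> g x = q N (f x)"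
      and x: "x \<in> carrier G" for N g x
  proof -
    have "restrict g (carrier G) \<in> continuous_hom G T (K N) (?D N)"
      by (rule restr[OF g(1)])
    then have gr: "restrict g (carrier G) \<in> extensional (carrier G) \<and>
        restrict g (carrier G) \<in> continuous_hom G T (K N) (?D N) \<and>
        (\<forall>x\<in>F. restrict g (carrier G) x = q N (f x))"
      using g(2) FG by auto
    have "restrict g (carrier G) = \<rho> N"
      using ex1[OF N] \<rho>[OF N] \<rho>ext[OF N] \<rho>F[OF N] gr by blast
    then show ?thesis using x by (metis restrict_apply')
  qed
  have \<rho>G: "\<rho> N x \<in> carrier (K N)" if "N \<in> \<N>" "x \<in> carrier G" for N x
    using \<rho>[OF that(1)] that(2) by (auto simp: continuous_hom_def hom_def)
  have compat: "q N h = \<rho> N x"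
    if M: "M \<in> \<N>" and N: "N \<in> \<N>" and MN: "M \<subseteq> N" and x: "x \<in> carrier G"
      and h: "h \<in> carrier H" and eq: "q M h = \<rho> M x" for M N x h
  proof -
    define r where "r k = q N (inv_into (carrier H) (q M) k)" for k
    have rq: "r (q M y) = q N y" if y: "y \<in> carrier H" for y
    proof -
      let ?z = "inv_into (carrier H) (q M) (q M y)"
      have "?z \<in> carrier H" "q M ?z = q M y"
        using y by (auto intro: inv_into_into f_inv_into_f)
      then have "?z \<otimes>\<^bsub>H\<^esub> inv\<^bsub>H\<^esub> y \<in> N" using qeq[OF M] y MN by blast
      then show ?thesis using qeq[OF N] y \<open>?z \<in> carrier H\<close> by (simp add: r_def)
    qed
    interpret qM: group_hom H "K M" "q M" using qh[OF M] .
    interpret qN: group_hom H "K N" "q N" using qh[OF N] .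
    have rh: "r \<in> hom (K M) (K N)"
    proof (rule homI)
      fix a b assume "a \<in> carrier (K M)" "b \<in> carrier (K M)"
      then obtain y z where yz: "a = q M y" "b = q M z" "y \<in> carrier H" "z \<in> carrier H"
        using qsurj[OF M] by blast
      then show "r a \<in> carrier (K N)" using rq by simp
      have "r (q M (y \<otimes>\<^bsub>H\<^esub> z)) = q N y \<otimes>\<^bsub>K N\<^esub> q N z" using yz by (simp add: rq del: qM.hom_mult)
      then show "r (a \<otimes>\<^bsub>K M\<^esub> b) = r a \<otimes>\<^bsub>K N\<^esub> r b" using yz rq by simp
    qed
    have "(\<lambda>x. r (\<rho> M x)) \<in> continuous_hom G T (K N) (?D N)"
    proof -
      have "(\<lambda>x. r (\<rho> M x)) \<in> hom G (K N)"
        using \<rho>[OF M] rh by (auto simp: continuous_hom_def hom_def Pi_iff)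
      moreover have "continuous_map (?D M) (?D N) r"
        using rh by (simp add: hom_def)
      then have "continuous_map T (?D N) (\<lambda>x. r (\<rho> M x))"
        using continuous_map_compose[of T "?D M" "\<rho> M" "?D N" r] \<rho>[OF M]
        by (simp add: continuous_hom_def o_def)
      ultimately show ?thesis by (simp add: continuous_hom_def)
    qed
    moreover have "r (\<rho> M x) = q N (f x)" if "x \<in> F" for x
      using that \<rho>F[OF M] rq fF by simp
    ultimately have "r (\<rho> M x) = \<rho> N x" using \<rho>uniq[OF N] x by blast
    then show ?thesis using eq rq[OF h] by simp
  qed
  have Hin: "carrier H \<in> \<N>"
  proof -
    have "carrier H \<lhd> H" by (simp add: H.normal_inv_iff H.subgroup_self)
    then show ?thesis using openin_topspace[of S] top by (simp add: \<N>_def)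
  qed
  have Int: "M \<inter> N \<in> \<N>" if "M \<in> \<N>" "N \<in> \<N>" for M N
    using that H.normal_subgroup_intersect unfolding \<N>_def by auto
  have FInt: "\<exists>M\<in>\<N>. \<forall>N\<in>I. M \<subseteq> N" if "finite I" "I \<subseteq> \<N>" for I
    using that
  proof (induction I)
    case empty
    then show ?case using Hin by blast
  next
    case (insert N I)
    then obtain M where "M \<in> \<N>" "\<forall>N\<in>I. M \<subseteq> N" by auto
    then show ?case using Int[of M N] insert.prems by (intro bexI[of _ "M \<inter> N"]) auto
  qed
  have "\<exists>h\<in>carrier H. \<forall>N\<in>\<N>. q N h = \<rho> N x" if x: "x \<in> carrier G" for x
  proof -
    define A where "A N = {h \<in> topspace S. q N h \<in> {\<rho> N x}}" for N
    have clos: "closedin S (A N)" if "N \<in> \<N>" for N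
      unfolding A_def using \<rho>G[OF that x]
      by (intro closedin_continuous_map_preimage[OF qc[OF that]]) simp
    have fin: "\<Inter>\<F> \<noteq> {}" if \<F>: "finite \<F>" "\<F> \<subseteq> A ` \<N>" for \<F>
    proof -
      obtain I where I: "I \<subseteq> \<N>" "finite I" "\<F> = A ` I"
        using finite_subset_image[OF \<F>] by blast
      obtain M where M: "M \<in> \<N>" "\<forall>N\<in>I. M \<subseteq> N" using FInt I by blast
      obtain h where h: "h \<in> carrier H" "q M h = \<rho> M x"
        using qsurj[OF M(1)] \<rho>G[OF M(1) x] by (metis imageE)
      have "h \<in> A N" if "N \<in> I" for N
        using compat[OF M(1) _ _ x h] M(2) I that h top by (auto simp: A_def)
      then show ?thesis using I by auto
    qed
    have "\<Inter>(A ` \<N>) \<noteq> {}"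
    proof -
      have fip: "\<forall>\<U>. (\<forall>C\<in>\<U>. closedin S C) \<and> (\<forall>\<F>. finite \<F> \<and> \<F> \<subseteq> \<U> \<longrightarrow> \<Inter>\<F> \<noteq> {}) \<longrightarrow> \<Inter>\<U> \<noteq> {}"
        using compact_space_fip[of S] prof unfolding profinite_space_def by blast
      show ?thesis by (rule fip[rule_format]) (use clos fin in blast)+
    qed
    then obtain h where h: "\<And>N. N \<in> \<N> \<Longrightarrow> h \<in> A N" by blast
    then have "h \<in> carrier H" using Hin top by (auto simp: A_def)
    then show ?thesis using h by (auto simp: A_def)
  qed
  then obtain \<psi> where \<psi>: "\<And>x. x \<in> carrier G \<Longrightarrow> \<psi> x \<in> carrier H"
    and q\<psi>: "\<And>x N. \<lbrakk>x \<in> carrier G; N \<in> \<N>\<rbrakk> \<Longrightarrow> q N (\<psi> x) = \<rho> N x"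
    by metis
  have sep: "h = h'"
    if h: "h \<in> carrier H" "h' \<in> carrier H" and eq: "\<And>N. N \<in> \<N> \<Longrightarrow> q N h = q N h'" for h h'
  proof (rule ccontr)
    assume "h \<noteq> h'"
    have ne: "h \<otimes>\<^bsub>H\<^esub> inv\<^bsub>H\<^esub> h' \<noteq> \<one>\<^bsub>H\<^esub>"
    proof
      assume "h \<otimes>\<^bsub>H\<^esub> inv\<^bsub>H\<^esub> h' = \<one>\<^bsub>H\<^esub>"
      then have "h \<otimes>\<^bsub>H\<^esub> inv\<^bsub>H\<^esub> h' \<otimes>\<^bsub>H\<^esub> h' = h'" using h by simp
      then show False using h \<open>h \<noteq> h'\<close> by (simp add: H.m_assoc)
    qed
    have "closedin S {h \<otimes>\<^bsub>H\<^esub> inv\<^bsub>H\<^esub> h'}"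
      using prof h top by (simp add: profinite_space_def closedin_Hausdorff_singleton)
    then have "openin S (topspace S - {h \<otimes>\<^bsub>H\<^esub> inv\<^bsub>H\<^esub> h'})" by blast
    moreover have "\<one>\<^bsub>H\<^esub> \<in> topspace S - {h \<otimes>\<^bsub>H\<^esub> inv\<^bsub>H\<^esub> h'}" using ne top by simp
    ultimately obtain N where N: "N \<lhd> H" "openin S N" "N \<subseteq> topspace S - {h \<otimes>\<^bsub>H\<^esub> inv\<^bsub>H\<^esub> h'}"
      by (rule profinite_group_open_normal[OF tg prof])
    then have "N \<in> \<N>" by (simp add: \<N>_def)
    then have "h \<otimes>\<^bsub>H\<^esub> inv\<^bsub>H\<^esub> h' \<in> N" using eq qeq[of N h h'] h by simp
    then show False using N(3) by blast
  qed
  have \<psi>hom: "\<psi> \<in> hom G H"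
  proof (rule homI)
    fix x y assume xy: "x \<in> carrier G" "y \<in> carrier G"
    show "\<psi> (x \<otimes>\<^bsub>G\<^esub> y) = \<psi> x \<otimes>\<^bsub>H\<^esub> \<psi> y"
    proof (rule sep)
      fix N assume N: "N \<in> \<N>"
      have "\<rho> N (x \<otimes>\<^bsub>G\<^esub> y) = \<rho> N x \<otimes>\<^bsub>K N\<^esub> \<rho> N y"
        using \<rho>[OF N] xy by (simp add: continuous_hom_def hom_def)
      then show "q N (\<psi> (x \<otimes>\<^bsub>G\<^esub> y)) = q N (\<psi> x \<otimes>\<^bsub>H\<^esub> \<psi> y)"
        using xy N \<psi> q\<psi> group_hom.hom_mult[OF qh[OF N]] by simp
    qed (use xy \<psi> in auto)
  qed (use \<psi> in auto)
  have \<psi>cont: "continuous_map T S \<psi>"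
    unfolding continuous_map_def
  proof (intro conjI allI impI)
    show "\<psi> \<in> topspace T \<rightarrow> topspace S" using \<psi> top topG by auto
    fix U assume U: "openin S U"
    show "openin T {x \<in> topspace T. \<psi> x \<in> U}"
    proof (subst openin_subopen, intro ballI)
      fix x assume "x \<in> {x \<in> topspace T. \<psi> x \<in> U}"
      then have x: "x \<in> carrier G" "\<psi> x \<in> U" using topG by auto
      have tr: "continuous_map S S (\<lambda>y. y \<otimes>\<^bsub>H\<^esub> \<psi> x)"
        using continuous_map_compose[OF _ mul, of S "\<lambda>y. (y, \<psi> x)"] \<psi>[OF x(1)] top
        by (simp add: continuous_map_paired o_def)
      have "openin S {y \<in> topspace S. y \<otimes>\<^bsub>H\<^esub> \<psi> x \<in> U}"
        by (rule openin_continuous_map_preimage[OF tr U])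
      moreover have "\<one>\<^bsub>H\<^esub> \<in> {y \<in> topspace S. y \<otimes>\<^bsub>H\<^esub> \<psi> x \<in> U}"
        using x \<psi> top by simp
      ultimately obtain N where "N \<lhd> H" "openin S N"
        and NU: "N \<subseteq> {y \<in> topspace S. y \<otimes>\<^bsub>H\<^esub> \<psi> x \<in> U}"
        by (rule profinite_group_open_normal[OF tg prof])
      then have N: "N \<in> \<N>" by (simp add: \<N>_def)
      let ?V = "{y \<in> topspace T. \<rho> N y \<in> {\<rho> N x}}"
      have "openin T ?V"
        using \<rho>[OF N] \<rho>G[OF N x(1)]
        by (intro openin_continuous_map_preimage[of T "?D N"]) (auto simp: continuous_hom_def)
      moreover have "x \<in> ?V" using x topG by simp
      moreover have "?V \<subseteq> {x \<in> topspace T. \<psi> x \<in> U}"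
      proof
        fix y assume "y \<in> ?V"
        then have y: "y \<in> carrier G" "\<rho> N y = \<rho> N x" using topG by auto
        then have "\<psi> y \<otimes>\<^bsub>H\<^esub> inv\<^bsub>H\<^esub> \<psi> x \<in> N"
          using qeq[OF N \<psi>[OF y(1)] \<psi>[OF x(1)]] q\<psi>[OF y(1) N] q\<psi>[OF x(1) N] by simp
        then have "\<psi> y \<otimes>\<^bsub>H\<^esub> inv\<^bsub>H\<^esub> \<psi> x \<otimes>\<^bsub>H\<^esub> \<psi> x \<in> U" using NU by blast
        then show "y \<in> {x \<in> topspace T. \<psi> x \<in> U}"
          using x y \<psi> topG by (simp add: H.m_assoc)
      qed
      ultimately show "\<exists>V. openin T V \<and> x \<in> V \<and> V \<subseteq> {x \<in> topspace T. \<psi> x \<in> U}" by blast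
    qed
  qed
  have \<psi>F: "\<psi> x = f x" if x: "x \<in> F" for x
  proof (rule sep)
    show "\<psi> x \<in> carrier H" "f x \<in> carrier H" using x FG \<psi> fF by auto
    show "q N (\<psi> x) = q N (f x)" if "N \<in> \<N>" for N
      using that x FG q\<psi>[of x N] \<rho>F[of N x] by auto
  qed
  show "\<exists>!g. g \<in> extensional (carrier G) \<and> g \<in> continuous_hom G T H S \<and> (\<forall>x\<in>F. g x = f x)"
  proof (rule ex1I)
    show "restrict \<psi> (carrier G) \<in> extensional (carrier G) \<and>
      restrict \<psi> (carrier G) \<in> continuous_hom G T H S \<and> (\<forall>x\<in>F. restrict \<psi> (carrier G) x = f x)"
      using restr[of \<psi> H S] \<psi>hom \<psi>cont \<psi>F FG by (auto simp: continuous_hom_def)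
    fix g assume g: "g \<in> extensional (carrier G) \<and> g \<in> continuous_hom G T H S \<and> (\<forall>x\<in>F. g x = f x)"
    show "g = restrict \<psi> (carrier G)"
    proof (rule extensionalityI[of _ "carrier G"])
      fix x assume x: "x \<in> carrier G"
      have gG: "g y \<in> carrier H" if "y \<in> carrier G" for y
        using g that by (auto simp: continuous_hom_def hom_def)
      have "g x = \<psi> x"
      proof (rule sep)
        fix N assume N: "N \<in> \<N>"
        have "(\<lambda>x. q N (g x)) \<in> hom G (K N)"
          using g q[OF N] by (auto simp: continuous_hom_def hom_def Pi_iff)
        moreover have "continuous_map T (?D N) (\<lambda>x. q N (g x))"
          using continuous_map_compose[of T S g "?D N" "q N"] g qc[OF N]
          by (simp add: continuous_hom_def o_def)
        ultimately have "q N (g x) = \<rho> N x"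
          using g N x by (intro \<rho>uniq) (auto simp: continuous_hom_def)
        then show "q N (g x) = q N (\<psi> x)" using q\<psi> x N by simp
      qed (use x gG \<psi> in auto)
      then show "g x = restrict \<psi> (carrier G) x" using x by simp
    qed (use g in auto)
  qed
qed


section \<open>Simplicial pro-\<open>C\<close>-groups and their homotopy groups\<close>

record 'b simplicial_top_group =
  grp :: "nat \<Rightarrow> 'b monoid"
  tpl :: "nat \<Rightarrow> 'b topology"
  face :: "nat \<Rightarrow> nat \<Rightarrow> 'b \<Rightarrow> 'b"
  degen :: "nat \<Rightarrow> nat \<Rightarrow> 'b \<Rightarrow> 'b"

text \<open>
  \<open>face X n i\<close> is \<open>d\<^sub>i : X\<^sub>n \<rightarrow> X\<^sub>n\<^sub>-\<^sub>1\<close> (for \<open>n > 0\<close>, \<open>i \<le> n\<close>) and \<open>degen X n i\<close> is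
  \<open>s\<^sub>i : X\<^sub>n \<rightarrow> X\<^sub>n\<^sub>+\<^sub>1\<close> (for \<open>i \<le> n\<close>); other values are irrelevant.
\<close>

definition simplicial_identities :: "'b simplicial_top_group \<Rightarrow> bool" where
  "simplicial_identities X \<longleftrightarrow>
     (\<forall>n i j. \<forall>x\<in>carrier (grp X (Suc (Suc n))). i < j \<and> j \<le> Suc (Suc n) \<longrightarrow>
        face X (Suc n) i (face X (Suc (Suc n)) j x) =
        face X (Suc n) (j - 1) (face X (Suc (Suc n)) i x)) \<and>
     (\<forall>n i j. \<forall>x\<in>carrier (grp X (Suc n)). i < j \<and> j \<le> Suc n \<longrightarrow>
        face X (Suc (Suc n)) i (degen X (Suc n) j x) = degen X n (j - 1) (face X (Suc n) i x)) \<and>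
     (\<forall>n i j. \<forall>x\<in>carrier (grp X n). j \<le> n \<and> (i = j \<or> i = Suc j) \<longrightarrow>
        face X (Suc n) i (degen X n j x) = x) \<and>
     (\<forall>n i j. \<forall>x\<in>carrier (grp X (Suc n)). Suc j < i \<and> i \<le> Suc (Suc n) \<longrightarrow>
        face X (Suc (Suc n)) i (degen X (Suc n) j x) = degen X n j (face X (Suc n) (i - 1) x)) \<and>
     (\<forall>n i j. \<forall>x\<in>carrier (grp X n). i \<le> j \<and> j \<le> n \<longrightarrow>
        degen X (Suc n) i (degen X n j x) = degen X (Suc n) (Suc j) (degen X n i x))"

definition simplicial_pro_C_group :: "nat monoid set \<Rightarrow> 'b simplicial_top_group \<Rightarrow> bool" where
  "simplicial_pro_C_group C X \<longleftrightarrow>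
     (\<forall>n. pro_C_group C (grp X n) (tpl X n)) \<and>
     (\<forall>n i. i \<le> Suc n \<longrightarrow>
        face X (Suc n) i \<in> continuous_hom (grp X (Suc n)) (tpl X (Suc n)) (grp X n) (tpl X n)) \<and>
     (\<forall>n i. i \<le> n \<longrightarrow>
        degen X n i \<in> continuous_hom (grp X n) (tpl X n) (grp X (Suc n)) (tpl X (Suc n))) \<and>
     simplicial_identities X"

definition moore :: "'b simplicial_top_group \<Rightarrow> nat \<Rightarrow> 'b set" where
  "moore X n = {x \<in> carrier (grp X n). \<forall>i<n. face X n i x = \<one>\<^bsub>grp X (n - 1)\<^esub>}"

definition moore_cycles :: "'b simplicial_top_group \<Rightarrow> nat \<Rightarrow> 'b set" where
  "moore_cycles X n = {x \<in> moore X n. n > 0 \<longrightarrow> face X n n x = \<one>\<^bsub>grp X (n - 1)\<^esub>}"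

definition moore_boundaries :: "'b simplicial_top_group \<Rightarrow> nat \<Rightarrow> 'b set" where
  "moore_boundaries X n = face X (Suc n) (Suc n) ` moore X (Suc n)"

definition homotopy_group :: "'b simplicial_top_group \<Rightarrow> nat \<Rightarrow> 'b set monoid" where
  "homotopy_group X n = (grp X n)\<lparr>carrier := moore_cycles X n\<rparr> Mod moore_boundaries X n"

definition quotient_topology :: "'a topology \<Rightarrow> ('a \<Rightarrow> 'b) \<Rightarrow> 'b topology" where
  "quotient_topology T q =
     topology (\<lambda>U. U \<subseteq> q ` topspace T \<and> openin T {x \<in> topspace T. q x \<in> U})"

lemma openin_quotient_topology:
  "openin (quotient_topology T q) U \<longleftrightarrow> U \<subseteq> q ` topspace T \<and> openin T {x \<in> topspace T. q x \<in> U}"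
proof -
  have "istopology (\<lambda>U. U \<subseteq> q ` topspace T \<and> openin T {x \<in> topspace T. q x \<in> U})"
    unfolding istopology_def
  proof (intro conjI allI impI)
    fix U V
    assume "U \<subseteq> q ` topspace T \<and> openin T {x \<in> topspace T. q x \<in> U}"
      and "V \<subseteq> q ` topspace T \<and> openin T {x \<in> topspace T. q x \<in> V}"
    moreover have "{x \<in> topspace T. q x \<in> U \<inter> V} =
        {x \<in> topspace T. q x \<in> U} \<inter> {x \<in> topspace T. q x \<in> V}" by blast
    ultimately show "U \<inter> V \<subseteq> q ` topspace T" "openin T {x \<in> topspace T. q x \<in> U \<inter> V}"
      by auto
  next
    fix K
    assume K: "\<forall>U\<in>K. U \<subseteq> q ` topspace T \<and> openin T {x \<in> topspace T. q x \<in> U}"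
    then show "\<Union>K \<subseteq> q ` topspace T" by blast
    have "{x \<in> topspace T. q x \<in> \<Union>K} = (\<Union>U\<in>K. {x \<in> topspace T. q x \<in> U})" by blast
    then show "openin T {x \<in> topspace T. q x \<in> \<Union>K}"
      using K by auto
  qed
  then show ?thesis
    unfolding quotient_topology_def by simp
qed

definition homotopy_group_topology :: "'b simplicial_top_group \<Rightarrow> nat \<Rightarrow> 'b set topology" where
  "homotopy_group_topology X n =
     quotient_topology (subtopology (tpl X n) (moore_cycles X n))
       (\<lambda>x. moore_boundaries X n #>\<^bsub>grp X n\<^esub> x)"


section \<open>Free simplicial resolutions\<close>

text \<open>
  As each \<open>F n\<close> is pointed, if at all, by the identity, disjointness up to the base point means
  that the intersection contains nothing but, possibly, the identity.
\<close>

definition CW_basis ::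
  "nat monoid set \<Rightarrow> 'b simplicial_top_group \<Rightarrow> (nat \<Rightarrow> 'b set) \<Rightarrow> bool" where
  "CW_basis C X F \<longleftrightarrow>
     (\<forall>n. free_pro_C_group C (grp X n) (tpl X n) (F n)) \<and>
     (\<forall>n. \<forall>i\<le>n. degen X n i ` F n \<subseteq> F (Suc n)) \<and>
     (\<forall>n. \<exists>Y. closedin (tpl X (Suc n)) Y \<and>
        F (Suc n) = (\<Union>i\<le>n. degen X n i ` F n) \<union> Y \<and>
        (\<Union>i\<le>n. degen X n i ` F n) \<inter> Y \<subseteq> {\<one>\<^bsub>grp X (Suc n)\<^esub>})"

text \<open>
  The type of the elements of \<open>X\<close> has to be chosen in an existence statement; it only has to be
  large enough. If \<open>'a\<close> is the type of the elements of \<open>G\<close>, then \<open>'a set + nat \<Rightarrow> nat\<close> is: with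
  \<open>B = 'a set + nat\<close>, every profinite group with at most \<open>|B|\<close> open normal subgroups embeds into a
  product of finite groups over \<^typ>\<open>nat\<close> indexed by \<open>B\<close>. This applies to \<open>G\<close> and to every free
  pro-\<open>C\<close>-group on a profinite space with at most \<open>|B|\<close> clopen subsets.
\<close>

definition free_simplicial_resolution ::
  "nat monoid set \<Rightarrow> 'b simplicial_top_group \<Rightarrow> 'a monoid \<Rightarrow> 'a topology \<Rightarrow> bool" where
  "free_simplicial_resolution C X G T \<longleftrightarrow>
     simplicial_pro_C_group C X \<and>
     (\<forall>n>0. carrier (homotopy_group X n) = {\<one>\<^bsub>homotopy_group X n\<^esub>}) \<and>
     (\<exists>h \<in> iso (homotopy_group X 0) G. homeomorphic_map (homotopy_group_topology X 0) T h) \<and>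
     (\<exists>F. CW_basis C X F)"

end

theory Submission
  imports Defs "HOL-Algebra.Product_Groups"
begin

text \<open>
  The resolution is built by attaching free cells that kill the homotopy, all at once in each
  dimension. Let profinite spaces \<open>Y\<^sub>0, Y\<^sub>1, \<dots>\<close> be given, where \<open>Y\<^sub>k\<close> consists of elements of
  \<open>X\<^sub>k\<^sub>-\<^sub>1\<close> when \<open>k > 0\<close>. The group \<open>X\<^sub>n\<close> is free on the disjoint union of copies of the \<open>Y\<^sub>k\<close>, one for
  each nondecreasing surjection \<open>\<sigma> : [n] \<rightarrow> [k]\<close>; the generator \<open>(\<sigma>, y)\<close> is the degeneracy along \<open>\<sigma>\<close>
  of a \<open>k\<close>-cell \<open>y\<close>, whose last face is the element \<open>y\<close> of \<open>X\<^sub>k\<^sub>-\<^sub>1\<close> and whose other faces are trivial.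
  So the operator of \<open>\<alpha> : [m] \<rightarrow> [n]\<close> must send \<open>(\<sigma>, y)\<close> to the simplex of this cell that is indexed by
  \<open>\<rho> = \<sigma>\<alpha>\<close>: a generator if \<open>\<rho>\<close> is onto \<open>[k]\<close>, a degeneracy of the element \<open>y\<close> if the image of \<open>\<rho>\<close> is
  \<open>[k - 1]\<close>, and the identity otherwise. As degeneracies only reindex generators, this defines all
  operators once the \<open>Y\<^sub>k\<close> are given. They compose correctly (\<open>smap_comp\<close>, by induction on the dimension)
  because the elements of \<open>Y\<^sub>k\<close> are Moore cycles. Taking \<open>Y\<^sub>k\<^sub>+\<^sub>1\<close> to consist of all cycles of
  \<open>X\<^sub>k\<close> turns every cycle into a boundary (\<open>boundaries_eq_cycles\<close>). In dimension \<open>0\<close>, \<open>Y\<^sub>0\<close> is a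
  profinite space that maps onto \<open>G\<close>, and the cycles are the kernel of the induced map \<open>X\<^sub>0 \<rightarrow> G\<close>, so
  that \<open>\<pi>\<^sub>0\<close> is \<open>G\<close>.

  The generators form an unpointed space, and different ones coincide in \<open>X\<^sub>n\<close> if the class consists of
  trivial groups. Still, degenerate and new generators can only meet in the identity, since some
  endomorphism of \<open>X\<^sub>n\<close> fixes the former and kills the latter (\<open>degenerate_meets_new\<close>).

  The free pro-\<open>C\<close>-group on a space \<open>E\<close> is the closed subgroup that the image of \<open>E\<close> generates in the
  product of all its finite quotients of class \<open>C\<close> (\<open>ex_free_on\<close>); a map to an arbitrary pro-\<open>C\<close>-group
  extends because the closed subgroup generated by its graph is again a graph (\<open>free_on_extend\<close>). All
  the groups must live in one type \<open>'i \<Rightarrow> nat\<close>, hence the finite quotients of \<open>E\<close> have to be indexed by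
  \<open>'i\<close>. This is possible if \<open>E\<close> has at most \<open>|'i|\<close> clopen subsets, a bound that holds for all compact
  subsets of \<open>'i \<Rightarrow> nat\<close>, hence for all \<open>Y\<^sub>k\<close>. The elements of \<open>G\<close> have another type \<open>'a\<close>; this is why
  \<open>Y\<^sub>0\<close> is not \<open>G\<close> itself but the free pro-\<open>C\<close>-group on the space underlying \<open>G\<close>, which exists in
  \<open>'i \<Rightarrow> nat\<close> for \<open>'i = 'a set + nat\<close>, as the clopen subsets of \<open>G\<close> are elements of \<open>'a set\<close>.
\<close>

section \<open>Groups of the class\<close>

lemma of_class_iso:
  assumes "of_class C K" "K \<cong> L" "group L"
  shows "of_class C L"
  using assms iso_trans unfolding of_class_def by blast

lemma of_class_hom_image:
  fixes K :: "'k monoid" and L :: "'l monoid"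
  assumes C: "class_of_finite_groups C" "quotient_closed C"
    and K: "of_class C K" and L: "group L"
    and h: "h \<in> hom K L" and surj: "h ` carrier K = carrier L"
  shows "of_class C L"
proof -
  obtain K0 \<theta> where K0: "K0 \<in> C" and \<theta>: "\<theta> \<in> iso K0 K"
    using K by (auto simp: of_class_def is_iso_def)
  interpret K0: group K0 using C(1) K0 by (simp add: class_of_finite_groups_def)
  interpret h: group_hom K0 L "h \<circ> \<theta>"
    using \<theta> h L K0.is_group K
    by (auto simp: group_hom_def group_hom_axioms_def iso_def hom_def Pi_iff of_class_def)
  have "(h \<circ> \<theta>) ` carrier K0 = carrier L"
    using \<theta> surj by (simp add: iso_def bij_betw_def image_comp flip: image_image)
  then have "K0 Mod kernel K0 L (h \<circ> \<theta>) \<cong> L" by (rule h.FactGroup_iso)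
  moreover have "of_class C (K0 Mod kernel K0 L (h \<circ> \<theta>))"
    using C(2) K0 h.normal_kernel unfolding quotient_closed_def by blast
  ultimately show ?thesis using L of_class_iso by blast
qed

lemma of_class_embed:
  fixes K :: "'k monoid" and L :: "'l monoid"
  assumes C: "class_of_finite_groups C" "subgroup_closed C"
    and K: "of_class C K" and L: "group L"
    and h: "h \<in> hom L K" and inj: "inj_on h (carrier L)"
  shows "of_class C L"
proof -
  obtain K0 where K0: "K0 \<in> C" "K0 \<cong> K"
    using K by (auto simp: of_class_def)
  interpret K0: group K0 using C(1) K0 by (simp add: class_of_finite_groups_def)
  interpret L: group L by fact
  obtain \<theta> where \<theta>: "\<theta> \<in> iso K K0" using K0.iso_sym[OF K0(2)] by (auto simp: is_iso_def)
  interpret g: group_hom L K0 "\<theta> \<circ> h"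
    using \<theta> h L K0.is_group by (auto simp: group_hom_def group_hom_axioms_def iso_def hom_def Pi_iff)
  have inj': "inj_on (\<theta> \<circ> h) (carrier L)"
    using \<theta> h inj by (intro comp_inj_on) (auto simp: iso_def bij_betw_def hom_def intro: inj_on_subset)
  let ?H = "K0\<lparr>carrier := (\<theta> \<circ> h) ` carrier L\<rparr>"
  have "of_class C ?H"
    using C(2) K0(1) g.img_is_subgroup unfolding subgroup_closed_def by blast
  moreover have "(\<theta> \<circ> h) \<in> iso L ?H"
    using g.homh inj' by (auto simp: iso_def bij_betw_def hom_def)
  then have "?H \<cong> L" using L.iso_sym[of ?H] by (auto simp: is_iso_def)
  ultimately show ?thesis using of_class_iso L by blast
qed

lemma of_class_DirProd:
  assumes C: "class_of_finite_groups C" "product_closed C"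
    and K: "of_class C K" and L: "of_class C L"
  shows "of_class C (K \<times>\<times> L)"
proof -
  obtain K0 L0 where 0: "K0 \<in> C" "L0 \<in> C" "K0 \<cong> K" "L0 \<cong> L"
    using K L unfolding of_class_def by blast
  interpret K0: group K0 using C(1) 0 by (simp add: class_of_finite_groups_def)
  have "of_class C (K0 \<times>\<times> L0)" using C(2) 0 by (simp add: product_closed_def)
  moreover have "K0 \<times>\<times> L0 \<cong> K \<times>\<times> L" using K0.DirProd_iso_trans 0 by blast
  ultimately show ?thesis using of_class_iso DirProd_group K L unfolding of_class_def by blast
qed

text \<open>
  \<open>F / M\<close> is a quotient of the image of \<open>F\<close> in \<open>K\<close>, because the kernel is contained in \<open>M\<close>.
\<close>

lemma of_class_Mod:
  fixes F :: "'f monoid" and K :: "'k monoid"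
  assumes C: "class_of_finite_groups C" "subgroup_closed C" "quotient_closed C"
    and K: "of_class C K" and \<phi>: "\<phi> \<in> hom F K" and M: "M \<lhd> F"
    and ker: "\<And>x. x \<in> carrier F \<Longrightarrow> \<phi> x = \<one>\<^bsub>K\<^esub> \<Longrightarrow> x \<in> M"
  shows "of_class C (F Mod M)"
proof -
  interpret M: normal M F by fact
  interpret \<phi>: group_hom F K \<phi>
    using K \<phi> M.is_group by (simp add: of_class_def group_hom_def group_hom_axioms_def)
  let ?N = "kernel F K \<phi>"
  note N = \<phi>.normal_kernel
  have "of_class C (F Mod ?N)"
    by (rule of_class_embed[OF C(1,2) K normal.factorgroup_is_group[OF N] \<phi>.FactGroup_hom \<phi>.FactGroup_inj_on])
  have p: "group_hom F (F Mod M) (\<lambda>x. M #>\<^bsub>F\<^esub> x)"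
    by (intro group_hom.intro group_hom_axioms.intro M.is_group M.factorgroup_is_group
        M.r_coset_hom_Mod)
  have "?N \<subseteq> kernel F (F Mod M) (\<lambda>x. M #>\<^bsub>F\<^esub> x)"
  proof
    fix x assume "x \<in> ?N"
    then have x: "x \<in> carrier F" "\<phi> x = \<one>\<^bsub>K\<^esub>" unfolding kernel_def by blast+
    then show "x \<in> kernel F (F Mod M) (\<lambda>x. M #>\<^bsub>F\<^esub> x)"
      using M.coset_join2[OF x(1) M.subgroup_axioms ker[OF x]] x(1)
      unfolding kernel_def FactGroup_def by simp
  qed
  then obtain g where g: "g \<in> hom (F Mod ?N) (F Mod M)"
      "\<And>x. x \<in> carrier F \<Longrightarrow> g (?N #>\<^bsub>F\<^esub> x) = M #>\<^bsub>F\<^esub> x"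
    by (rule group_hom.FactGroup_universal_kernel[OF p N]) blast
  have "g ` carrier (F Mod ?N) = carrier (F Mod M)"
    using g(2) by (auto simp: FactGroup_def RCOSETS_def image_UN)
  then show ?thesis
    using of_class_hom_image[OF C(1,3) \<open>of_class C (F Mod ?N)\<close> M.factorgroup_is_group g(1)] by blast
qed

lemma of_class_Mod_Int:
  fixes F :: "'f monoid"
  assumes C: "class_of_finite_groups C" "subgroup_closed C" "quotient_closed C" "product_closed C"
    and M: "M1 \<lhd> F" "M2 \<lhd> F" and cl: "of_class C (F Mod M1)" "of_class C (F Mod M2)"
  shows "of_class C (F Mod (M1 \<inter> M2))"
proof -
  interpret M1: normal M1 F by fact
  interpret M2: normal M2 F by fact
  show ?thesis
  proof (rule of_class_Mod[OF C(1-3) of_class_DirProd[OF C(1,4) cl]])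
    show "(\<lambda>x. (M1 #>\<^bsub>F\<^esub> x, M2 #>\<^bsub>F\<^esub> x)) \<in> hom F ((F Mod M1) \<times>\<times> (F Mod M2))"
      using M1.r_coset_hom_Mod M2.r_coset_hom_Mod by (auto simp: hom_def Pi_iff)
    show "M1 \<inter> M2 \<lhd> F" using M1.normal_subgroup_intersect[OF M] .
  next
    fix x assume x: "x \<in> carrier F" "(M1 #>\<^bsub>F\<^esub> x, M2 #>\<^bsub>F\<^esub> x) = \<one>\<^bsub>(F Mod M1) \<times>\<times> (F Mod M2)\<^esub>"
    then have "M1 #>\<^bsub>F\<^esub> x = M1" "M2 #>\<^bsub>F\<^esub> x = M2" by (simp_all add: FactGroup_def)
    then show "x \<in> M1 \<inter> M2"
      using x(1) M1.coset_join1 M1.subgroup_axioms M2.subgroup_axioms by blast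
  qed
qed

lemma of_class_finite:
  assumes "class_of_finite_groups C" "of_class C K"
  shows "finite (carrier K)"
proof -
  obtain K0 h where "K0 \<in> C" "bij_betw h (carrier K0) (carrier K)"
    using assms(2) by (auto simp: of_class_def is_iso_def iso_def)
  then show ?thesis using assms(1) bij_betw_finite[of h "carrier K0"] by (simp add: class_of_finite_groups_def)
qed

lemma of_class_if_pro_C_discrete:
  fixes K :: "'k monoid"
  assumes C: "class_of_finite_groups C" "subgroup_closed C"
    and K: "pro_C_group C K (discrete_topology (carrier K))"
  shows "of_class C K"
proof -
  interpret group K using K by (simp add: pro_C_group_def topological_group_on_def)
  have N: "{\<one>\<^bsub>K\<^esub>} \<lhd> K" by (rule one_is_normal)
  interpret N: normal "{\<one>\<^bsub>K\<^esub>}" K by fact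
  have "of_class C (K Mod {\<one>\<^bsub>K\<^esub>})" using K N by (simp add: pro_C_group_def)
  moreover have "inj_on (\<lambda>x. {\<one>\<^bsub>K\<^esub>} #>\<^bsub>K\<^esub> x) (carrier K)"
    by (auto simp: inj_on_def r_coset_def)
  ultimately show ?thesis
    using of_class_embed[OF C _ is_group N.r_coset_hom_Mod] by blast
qed

section \<open>Spaces with few clopen subsets\<close>

lemma ex_inj_list:
  assumes inf: "infinite (UNIV :: 'i set)"
  shows "\<exists>j :: 'i list \<Rightarrow> 'i. inj j"
proof -
  have "(card_of (UNIV :: ('i \<times> 'i) set), card_of (UNIV :: 'i set)) \<in> ordLeq"
    using card_of_Times_same_infinite[OF inf] ordIso_imp_ordLeq by (metis UNIV_Times_UNIV)
  then obtain p :: "'i \<times> 'i \<Rightarrow> 'i" where p: "inj p"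
    using card_of_ordLeq[of "UNIV :: ('i \<times> 'i) set" "UNIV :: 'i set"] by blast
  obtain e :: "nat \<Rightarrow> 'i" where e: "inj e"
    using inf infinite_countable_subset by blast
  define w where "w l = foldr (\<lambda>x a. p (x, a)) l (e 0)" for l
  (* Folding the pairing recovers a list only once its length is known. *)
  have w: "l = l'" if "length l = length l'" "w l = w l'" for l l'
    using that
  proof (induction l l' rule: list_induct2)
    case (Cons x xs y ys)
    then have "p (x, w xs) = p (y, w ys)" by (simp add: w_def)
    then show ?case using Cons p by (simp add: inj_eq)
  qed simp
  have "inj (\<lambda>l. p (e (length l), w l))"
    using p e w by (auto intro!: injI simp: inj_eq)
  then show ?thesis by blast
qed

definition nat_power :: "('i \<Rightarrow> nat) topology" where
  "nat_power = product_topology (\<lambda>_. discrete_topology UNIV) UNIV"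

lemma topspace_nat_power [simp]: "topspace nat_power = UNIV"
  by (simp add: nat_power_def)

lemma Hausdorff_nat_power: "Hausdorff_space nat_power"
  by (simp add: nat_power_def Hausdorff_space_product_topology)

lemma continuous_map_nat_power:
  "continuous_map T nat_power f \<longleftrightarrow> (\<forall>i. continuous_map T (discrete_topology UNIV) (\<lambda>x. f x i))"
  by (simp add: nat_power_def continuous_map_componentwise_UNIV)

lemma continuous_map_nat_power_coordinate:
  "continuous_map nat_power (discrete_topology UNIV) (\<lambda>x. x i)"
  by (rule continuous_map_nat_power[THEN iffD1, THEN spec]) simp

lemma openin_nat_power_nbhd:
  assumes "openin nat_power U" "x \<in> U"
  obtains J where "finite J" "{y. \<forall>i\<in>J. y i = x i} \<subseteq> U"
proof -
  obtain V where V: "finite {i. V i \<noteq> UNIV}" "x \<in> Pi\<^sub>E UNIV V" "Pi\<^sub>E UNIV V \<subseteq> U"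
    using assms by (auto simp: nat_power_def openin_product_topology_alt)
  have "y \<in> Pi\<^sub>E UNIV V" if "\<forall>i\<in>{i. V i \<noteq> UNIV}. y i = x i" for y
    using that V(2) by (auto simp: PiE_iff) (metis UNIV_I)
  then show thesis using that[OF V(1)] V(3) by blast
qed

text \<open>
  A witness that \<open>E\<close> has at most \<open>|'i|\<close> clopen subsets. The code is a function on all sets so that no
  type of clopen sets is needed.
\<close>

definition codes_clopens :: "('e set \<Rightarrow> 'i) \<Rightarrow> 'e topology \<Rightarrow> bool" where
  "codes_clopens k E \<longleftrightarrow> inj_on k {U. openin E U \<and> closedin E U}"

text \<open>
  By compactness a clopen subset is a finite union of basic open sets, and each of these is given by a
  finite list of prescribed coordinates.
\<close>

lemma ex_codes_clopens_compact:
  fixes S :: "('i \<Rightarrow> nat) set"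
  assumes inf: "infinite (UNIV :: 'i set)" and S: "compactin nat_power S"
  shows "\<exists>k :: ('i \<Rightarrow> nat) set \<Rightarrow> 'i. codes_clopens k (subtopology nat_power S)"
proof -
  define B where "B l = {x :: 'i \<Rightarrow> nat. \<forall>(i, v)\<in>set l. x i = v}" for l
  have oB: "openin nat_power (B l)" for l
  proof (induction l)
    case (Cons p l)
    have "openin nat_power {x \<in> topspace nat_power. x (fst p) \<in> {snd p}}"
      by (rule openin_continuous_map_preimage[OF continuous_map_nat_power_coordinate]) simp
    moreover have "B (p # l) = {x \<in> topspace nat_power. x (fst p) \<in> {snd p}} \<inter> B l"
      by (auto simp: B_def)
    ultimately show ?case using Cons by auto
  qed (use openin_topspace[of nat_power] in \<open>simp add: B_def\<close>)
  have "\<exists>L. U = S \<inter> (\<Union>l\<in>set L. B l)"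
    if U: "openin (subtopology nat_power S) U" "closedin (subtopology nat_power S) U" for U
  proof -
    obtain V where V: "openin nat_power V" "U = V \<inter> S" using U(1) by (auto simp: openin_subtopology)
    have "compactin (subtopology nat_power S) U"
      using U(2) S closedin_compact_space compact_space_subtopology by blast
    then have cU: "compactin nat_power U" by (simp add: compactin_subtopology)
    let ?A = "{l. S \<inter> B l \<subseteq> U}"
    have "\<exists>l\<in>?A. x \<in> B l" if x: "x \<in> U" for x
    proof -
      obtain J where J: "finite J" "{y. \<forall>i\<in>J. y i = x i} \<subseteq> V"
        using openin_nat_power_nbhd[OF V(1)] x V(2) by blast
      obtain js where js: "set js = J" using finite_list[OF J(1)] by blast
      have "B (map (\<lambda>i. (i, x i)) js) = {y. \<forall>i\<in>J. y i = x i}" using js by (auto simp: B_def)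
      then show ?thesis using J V(2) by (intro bexI[of _ "map (\<lambda>i. (i, x i)) js"]) auto
    qed
    then have "U \<subseteq> \<Union>(B ` ?A)" by blast
    then obtain \<F> where \<F>: "finite \<F>" "\<F> \<subseteq> B ` ?A" "U \<subseteq> \<Union>\<F>"
      using compactinD[OF cU, of "B ` ?A"] oB by blast
    obtain I where I: "I \<subseteq> ?A" "finite I" "\<F> = B ` I" using finite_subset_image[OF \<F>(1,2)] by blast
    obtain L where L: "set L = I" using finite_list[OF I(2)] by blast
    have "U = S \<inter> (\<Union>l\<in>set L. B l)" using \<F>(3) I L V(2) by blast
    then show ?thesis by blast
  qed
  then obtain L where L: "\<And>U. openin (subtopology nat_power S) U \<Longrightarrow>
      closedin (subtopology nat_power S) U \<Longrightarrow> U = S \<inter> (\<Union>l\<in>set (L U). B l)"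
    by metis
  obtain j :: "'i list \<Rightarrow> 'i" where j: "inj j" using ex_inj_list[OF inf] by blast
  obtain e :: "nat \<Rightarrow> 'i" where e: "inj e" using inf infinite_countable_subset by blast
  define c where "c = j \<circ> map (j \<circ> map (\<lambda>(i, v). j [i, e v]))"
  have "inj (\<lambda>(i, v). j [i, e v])" using j e by (auto intro!: injI simp: inj_eq)
  then have "inj c" unfolding c_def by (intro inj_compose j inj_mapI)
  then have "codes_clopens (\<lambda>U. c (L U)) (subtopology nat_power S)"
    unfolding codes_clopens_def inj_on_def by (auto simp: inj_eq) (metis L)+
  then show ?thesis by blast
qed

lemma compact_space_sum_topology:
  assumes "finite I" "\<And>i. i \<in> I \<Longrightarrow> compact_space (X i)"
  shows "compact_space (sum_topology X I)"
proof -
  have "compactin (sum_topology X I) (\<Union>i\<in>I. (\<lambda>x. (i, x)) ` topspace (X i))"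
    using assms by (intro compactin_Union)
      (auto intro!: image_compactin continuous_map_component_injection simp flip: compact_space_def)
  moreover have "(\<Union>i\<in>I. (\<lambda>x. (i, x)) ` topspace (X i)) = topspace (sum_topology X I)" by auto
  ultimately show ?thesis by (simp add: compact_space_def)
qed

lemma continuous_map_from_sum_topology:
  assumes "\<And>i. i \<in> I \<Longrightarrow> continuous_map (X i) Z (\<lambda>x. f (i, x))"
  shows "continuous_map (sum_topology X I) Z f"
  unfolding continuous_map_def
proof (intro conjI allI impI)
  show "f \<in> topspace (sum_topology X I) \<rightarrow> topspace Z"
    using assms by (auto simp: continuous_map_def Pi_iff)
  fix U assume "openin Z U"
  then have "openin (X i) {x \<in> topspace (X i). f (i, x) \<in> U}" if "i \<in> I" for i
    using openin_continuous_map_preimage[OF assms[OF that]] by blast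
  then show "openin (sum_topology X I) {x \<in> topspace (sum_topology X I). f x \<in> U}"
    by (auto simp: openin_sum_topology)
qed

lemma ex_codes_clopens_sum:
  fixes X :: "'c \<Rightarrow> 'e topology"
  assumes inf: "infinite (UNIV :: 'i set)" and I: "finite I"
    and X: "\<And>c. c \<in> I \<Longrightarrow> \<exists>k :: 'e set \<Rightarrow> 'i. codes_clopens k (X c)"
  shows "\<exists>k :: ('c \<times> 'e) set \<Rightarrow> 'i. codes_clopens k (sum_topology X I)"
proof -
  obtain k :: "'c \<Rightarrow> 'e set \<Rightarrow> 'i" where k: "\<And>c. c \<in> I \<Longrightarrow> codes_clopens (k c) (X c)"
    using X by metis
  obtain cs where cs: "set cs = I" using finite_list[OF I] by blast
  obtain j :: "'i list \<Rightarrow> 'i" where j: "inj j" using ex_inj_list[OF inf] by blast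
  have "codes_clopens (\<lambda>U. j (map (\<lambda>c. k c {x. (c, x) \<in> U}) cs)) (sum_topology X I)"
    unfolding codes_clopens_def
  proof (rule inj_onI, clarsimp simp: inj_eq[OF j] cs)
    fix U V
    assume U: "openin (sum_topology X I) U" "closedin (sum_topology X I) U"
      and V: "openin (sum_topology X I) V" "closedin (sum_topology X I) V"
      and eq: "\<forall>c\<in>I. k c {x. (c, x) \<in> U} = k c {x. (c, x) \<in> V}"
    have "{x. (c, x) \<in> U} = {x. (c, x) \<in> V}" if "c \<in> I" for c
      by (rule inj_onD[OF k[OF that, unfolded codes_clopens_def]])
        (use U V eq that in \<open>auto simp: openin_sum_topology closedin_sum_topology\<close>)
    then show "U = V" using U(1) V(1) by (auto simp: openin_sum_topology)
  qed
  then show ?thesis by blast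
qed

section \<open>Free pro-\<open>C\<close>-groups\<close>

text \<open>
  All pairs of a group \<open>L\<close> of the class and a continuous map \<open>\<phi> : E \<rightarrow> L\<close> are represented in a family
  indexed by \<open>'i\<close>. A pair is coded by the elements of \<open>L\<close>, its multiplication table and the clopen
  fibres of \<open>\<phi>\<close>; pairs with the same code differ only by values outside the carriers.
\<close>

lemma ex_finite_quotient_family:
  fixes C :: "nat monoid set" and E :: "'e topology" and k :: "'e set \<Rightarrow> 'i"
  assumes C: "class_of_finite_groups C" and inf: "infinite (UNIV :: 'i set)"
    and k: "codes_clopens k E" and ne: "of_class C (L0 :: nat monoid)"
  obtains K :: "'i \<Rightarrow> nat monoid" and f where
    "\<And>i. of_class C (K i)"
    "\<And>i. continuous_map E (discrete_topology (carrier (K i))) (f i)"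
    "\<And>(L :: nat monoid) \<phi>. \<lbrakk>of_class C L; continuous_map E (discrete_topology (carrier L)) \<phi>\<rbrakk> \<Longrightarrow>
       \<exists>i. (\<lambda>x. x) \<in> hom (K i) L \<and> (\<forall>e\<in>topspace E. f i e = \<phi> e)"
proof -
  obtain j :: "'i list \<Rightarrow> 'i" where j: "inj j" using ex_inj_list[OF inf] by blast
  obtain e :: "nat \<Rightarrow> 'i" where e: "inj e" using inf infinite_countable_subset by blast
  define cs where "cs L = sorted_list_of_set (carrier L)" for L :: "nat monoid"
  define code where "code = (\<lambda>(L :: nat monoid, \<phi>).
    j [j (map e (cs L)), j (map (\<lambda>(x, y). e (x \<otimes>\<^bsub>L\<^esub> y)) (List.product (cs L) (cs L))),
       j (map (\<lambda>v. k {x \<in> topspace E. \<phi> x = v}) (cs L))])"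
  define Q where "Q = {(L :: nat monoid, \<phi>). of_class C L \<and>
    continuous_map E (discrete_topology (carrier L)) \<phi>}"
  have set_cs: "set (cs L) = carrier L" if "of_class C L" for L
    using of_class_finite[OF C that] by (simp add: cs_def)
  have clopen: "openin E {x \<in> topspace E. \<phi> x = v} \<and> closedin E {x \<in> topspace E. \<phi> x = v}"
    if "continuous_map E (discrete_topology (carrier L)) \<phi>" "v \<in> carrier L" for L :: "nat monoid" and \<phi> v
    using openin_continuous_map_preimage[OF that(1), of "{v}"]
      closedin_continuous_map_preimage[OF that(1), of "{v}"] that(2) by simp
  have codeD: "(\<lambda>x. x) \<in> hom L L' \<and> (\<forall>x\<in>topspace E. \<phi> x = \<phi>' x)"
    if q: "(L, \<phi>) \<in> Q" "(L', \<phi>') \<in> Q" and eq: "code (L, \<phi>) = code (L', \<phi>')" for L L' \<phi> \<phi>'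
  proof -
    have L: "of_class C L" "of_class C L'"
      and \<phi>: "continuous_map E (discrete_topology (carrier L)) \<phi>"
        "continuous_map E (discrete_topology (carrier L')) \<phi>'"
      using q by (auto simp: Q_def)
    have "cs L = cs L'"
      using eq by (simp add: code_def inj_eq[OF j] inj_map_eq_map[OF e])
    then have car: "carrier L = carrier L'" using set_cs[OF L(1)] set_cs[OF L(2)] by simp
    have "\<forall>x\<in>carrier L. \<forall>y\<in>carrier L. x \<otimes>\<^bsub>L\<^esub> y = x \<otimes>\<^bsub>L'\<^esub> y"
      using eq \<open>cs L = cs L'\<close> set_cs[OF L(2)] car by (auto simp: code_def inj_eq[OF j] inj_eq[OF e])
    then have "(\<lambda>x. x) \<in> hom L L'" using car by (auto simp: hom_def)
    moreover have "\<phi> x = \<phi>' x" if x: "x \<in> topspace E" for x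
    proof -
      have v: "\<phi> x \<in> carrier L" using \<phi>(1) x by (auto simp: continuous_map_def)
      then have "k {y \<in> topspace E. \<phi> y = \<phi> x} = k {y \<in> topspace E. \<phi>' y = \<phi> x}"
        using eq \<open>cs L = cs L'\<close> set_cs[OF L(2)] car by (auto simp: code_def inj_eq[OF j])
      then have "{y \<in> topspace E. \<phi> y = \<phi> x} = {y \<in> topspace E. \<phi>' y = \<phi> x}"
        using k clopen[OF \<phi>(1) v] clopen[OF \<phi>(2), of "\<phi> x"] v car
        by (auto simp only: codes_clopens_def dest!: inj_onD)
      moreover have "x \<in> {y \<in> topspace E. \<phi> y = \<phi> x}" using x by simp
      ultimately show ?thesis by simp
    qed
    ultimately show ?thesis by blast
  qed
  have "(L0, \<lambda>_. \<one>\<^bsub>L0\<^esub>) \<in> Q"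
    using ne by (auto simp: Q_def of_class_def group.is_monoid)
  (* An index that is no code gets an arbitrary pair, which exists as the class is nonempty. *)
  then have "\<exists>q. q \<in> Q \<and> (i \<in> code ` Q \<longrightarrow> code q = i)" for i by (cases "i \<in> code ` Q") auto
  then obtain R where R: "\<And>i. R i \<in> Q" "\<And>i. i \<in> code ` Q \<Longrightarrow> code (R i) = i" by metis
  show thesis
  proof (rule that[of "fst \<circ> R" "snd \<circ> R"])
    fix i
    show "of_class C ((fst \<circ> R) i)"
      "continuous_map E (discrete_topology (carrier ((fst \<circ> R) i))) ((snd \<circ> R) i)"
      using R(1)[of i] by (auto simp: Q_def)
  next
    fix L :: "nat monoid" and \<phi>
    assume "of_class C L" "continuous_map E (discrete_topology (carrier L)) \<phi>"
    then have q: "(L, \<phi>) \<in> Q" by (simp add: Q_def)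
    obtain L' \<phi>' where R': "R (code (L, \<phi>)) = (L', \<phi>')" by (cases "R (code (L, \<phi>))")
    then have "(L', \<phi>') \<in> Q" "code (L', \<phi>') = code (L, \<phi>)"
      using R(1)[of "code (L, \<phi>)"] R(2)[of "code (L, \<phi>)"] q by auto
    then show "\<exists>i. (\<lambda>x. x) \<in> hom ((fst \<circ> R) i) L \<and> (\<forall>e\<in>topspace E. (snd \<circ> R) i e = \<phi> e)"
      using codeD[of L' \<phi>' L \<phi>] q R' by (intro exI[of _ "code (L, \<phi>)"]) simp
  qed
qed

text \<open>
  An open normal subgroup \<open>N\<close> contains the common kernel of finitely many coordinates, and the quotient
  by such a common kernel is of class \<open>C\<close> by closure under subgroups and products.
\<close>

lemma closed_subgroup_of_product_pro_C:
  fixes K :: "'i \<Rightarrow> nat monoid"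
  assumes C: "class_of_finite_groups C" "subgroup_closed C" "quotient_closed C" "product_closed C"
    and K: "\<And>i. of_class C (K i)"
    and A: "subgroup A (product_group UNIV K)" "closedin nat_power A"
  shows "compactin nat_power A"
    and "pro_C_group C ((product_group UNIV K)\<lparr>carrier := A\<rparr>) (subtopology nat_power A)"
proof -
  let ?P = "product_group UNIV K" and ?T = "subtopology nat_power A"
  have Kg: "group (K i)" for i using K by (simp add: of_class_def)
  interpret P: group ?P by (rule product_group) (rule Kg)
  let ?F = "?P\<lparr>carrier := A\<rparr>"
  interpret F: group ?F using P.subgroup_imp_group[OF A(1)] .
  have AK: "a i \<in> carrier (K i)" if "a \<in> A" for a i
    using subgroup.subset[OF A(1)] that by (auto simp: PiE_iff)
  have "compactin nat_power (Pi\<^sub>E UNIV (\<lambda>i. carrier (K i)))"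
    using of_class_finite[OF C(1) K] by (simp add: nat_power_def compactin_PiE compactin_discrete_topology)
  moreover have "A \<subseteq> Pi\<^sub>E UNIV (\<lambda>i. carrier (K i))" using AK by auto
  ultimately show compact: "compactin nat_power A" using closed_compactin A(2) by blast
  have coord: "continuous_map ?T (discrete_topology UNIV) (\<lambda>x. x i)" for i
    by (rule continuous_map_from_subtopology[OF continuous_map_nat_power_coordinate])
  have any: "continuous_map (discrete_topology UNIV) (discrete_topology UNIV) g" for g by simp
  have mult: "continuous_map (prod_topology ?T ?T) ?T (\<lambda>(x, y). x \<otimes>\<^bsub>?F\<^esub> y)"
    unfolding continuous_map_in_subtopology continuous_map_nat_power
  proof (intro conjI allI)
    fix i
    have "continuous_map (prod_topology ?T ?T) (discrete_topology (UNIV \<times> UNIV)) (\<lambda>z. (fst z i, snd z i))"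
      unfolding prod_topology_discrete_topology continuous_map_paired
      by (intro conjI continuous_map_compose[OF continuous_map_fst coord, unfolded o_def]
          continuous_map_compose[OF continuous_map_snd coord, unfolded o_def])
    then have "continuous_map (prod_topology ?T ?T) (discrete_topology UNIV)
        ((\<lambda>(a, b). a \<otimes>\<^bsub>K i\<^esub> b) \<circ> (\<lambda>z. (fst z i, snd z i)))"
      by (rule continuous_map_compose) simp
    then show "continuous_map (prod_topology ?T ?T) (discrete_topology UNIV)
        (\<lambda>z. (case z of (x, y) \<Rightarrow> x \<otimes>\<^bsub>?F\<^esub> y) i)"
      by (simp add: o_def case_prod_unfold)
  qed (use F.m_closed in \<open>auto simp del: mult_product_group\<close>)
  have inv_eq: "inv\<^bsub>?F\<^esub> x = (\<lambda>i. inv\<^bsub>K i\<^esub> x i)" if x: "x \<in> A" for x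
  proof -
    have "inv\<^bsub>?F\<^esub> x = inv\<^bsub>?P\<^esub> x" using P.m_inv_consistent[OF A(1) x] by simp
    also have "\<dots> = (\<lambda>i. inv\<^bsub>K i\<^esub> x i)" using AK[OF x] by (subst inv_product_group) (auto simp: Kg)
    finally show ?thesis .
  qed
  have inv: "continuous_map ?T ?T (\<lambda>x. inv\<^bsub>?F\<^esub> x)"
  proof (rule continuous_map_eq)
    show "continuous_map ?T ?T (\<lambda>x i. inv\<^bsub>K i\<^esub> x i)"
      unfolding continuous_map_in_subtopology continuous_map_nat_power
    proof (intro conjI allI)
      show "continuous_map ?T (discrete_topology UNIV) (\<lambda>x. inv\<^bsub>K i\<^esub> x i)" for i
        by (rule continuous_map_compose[OF coord any, unfolded o_def])
      show "(\<lambda>x i. inv\<^bsub>K i\<^esub> x i) \<in> topspace ?T \<rightarrow> A"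
        using F.inv_closed by (auto simp flip: inv_eq)
    qed
  qed (simp add: inv_eq)
  have tg: "topological_group_on ?F ?T"
    unfolding topological_group_on_def using mult inv F.is_group by simp
  have prof: "profinite_space ?T"
    unfolding profinite_space_def totally_disconnected_space_def
  proof (intro conjI allI impI)
    show "compact_space ?T" using compact by (simp add: compact_space_subtopology)
    show "Hausdorff_space ?T" by (simp add: Hausdorff_nat_power Hausdorff_space_subtopology)
    fix S assume S: "connectedin ?T S"
    have "x = y" if "x \<in> S" "y \<in> S" for x y
    proof
      fix i
      have "connectedin (discrete_topology UNIV) ((\<lambda>x. x i) ` S)"
        by (rule connectedin_continuous_map_image[OF coord S])
      then show "x i = y i" using that by (auto simp: connectedin_discrete_topology)
    qed
    then show "\<exists>a. S \<subseteq> {a}" by blast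
  qed
  have "carrier ?F \<lhd> ?F"
    unfolding F.normal_inv_iff using F.subgroup_self F.m_closed F.inv_closed by blast
  then have AF: "A \<lhd> ?F" by simp
  have "of_class C (?F Mod N)" if N: "N \<lhd> ?F" "openin ?T N" for N
  proof -
    interpret N: normal N ?F by fact
    obtain V where V: "openin nat_power V" "N = V \<inter> A" using N(2) by (auto simp: openin_subtopology)
    have "(\<lambda>i. \<one>\<^bsub>K i\<^esub>) \<in> N" using N.one_closed by (simp add: restrict_UNIV)
    then have "(\<lambda>i. \<one>\<^bsub>K i\<^esub>) \<in> V" using V(2) by simp
    then obtain J where J: "finite J" "{y. \<forall>i\<in>J. y i = \<one>\<^bsub>K i\<^esub>} \<subseteq> V"
      using openin_nat_power_nbhd[OF V(1)] by blast
    have "\<exists>M. M \<lhd> ?F \<and> of_class C (?F Mod M) \<and> (\<forall>x\<in>M. \<forall>i\<in>J. x i = \<one>\<^bsub>K i\<^esub>)"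
      using J(1)
    proof (induction J)
      case empty
      have "of_class C (?F Mod A)"
      proof (rule of_class_Mod[OF C(1-3) K _ AF])
        show "(\<lambda>x. \<one>\<^bsub>K undefined\<^esub>) \<in> hom ?F (K undefined)"
          using Kg by (simp add: hom_def group.is_monoid)
      qed simp
      then show ?case using AF by blast
    next
      case (insert i J)
      then obtain M where M: "M \<lhd> ?F" "of_class C (?F Mod M)" "\<forall>x\<in>M. \<forall>i\<in>J. x i = \<one>\<^bsub>K i\<^esub>" by blast
      interpret pr: group_hom ?F "K i" "\<lambda>x. x i"
        by (intro group_hom.intro group_hom_axioms.intro F.is_group Kg) (auto simp: hom_def AK)
      let ?M = "kernel ?F (K i) (\<lambda>x. x i)"
      have "of_class C (?F Mod ?M)"
        by (rule of_class_Mod[OF C(1-3) K pr.homh pr.normal_kernel]) (simp add: kernel_def)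
      then have "of_class C (?F Mod (M \<inter> ?M))"
        using of_class_Mod_Int[OF C M(1) pr.normal_kernel M(2)] by blast
      moreover have "M \<inter> ?M \<lhd> ?F" by (rule F.normal_subgroup_intersect[OF M(1) pr.normal_kernel])
      ultimately show ?case using M(3) by (intro exI[of _ "M \<inter> ?M"]) (auto simp: kernel_def)
    qed
    then obtain M where M: "M \<lhd> ?F" "of_class C (?F Mod M)" "\<And>x i. x \<in> M \<Longrightarrow> i \<in> J \<Longrightarrow> x i = \<one>\<^bsub>K i\<^esub>"
      by blast
    interpret M: normal M ?F by (rule M)
    have MN: "M \<subseteq> N"
      using M(3) J(2) V(2) M.subset by auto
    show ?thesis
    proof (rule of_class_Mod[OF C(1-3) M(2) M.r_coset_hom_Mod N(1)])
      fix x assume "x \<in> carrier ?F" "M #>\<^bsub>?F\<^esub> x = \<one>\<^bsub>?F Mod M\<^esub>"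
      then have "x \<in> M" using F.coset_join1[of M x] M.subgroup_axioms
        by (simp add: FactGroup_def del: mult_product_group)
      then show "x \<in> N" using MN by blast
    qed
  qed
  then show "pro_C_group C ?F ?T"
    using tg prof by (simp add: pro_C_group_def del: mult_product_group)
qed

text \<open>
  Freeness in terms of generation and of maps to finite groups only, so that it is expressible
  for an arbitrary type of generators and independent of the type of the test groups. The map \<open>\<iota>\<close> can
  fail to be injective: it is constant if the class consists of trivial groups.
\<close>

definition free_on ::
  "nat monoid set \<Rightarrow> 'e topology \<Rightarrow> 'f monoid \<Rightarrow> 'f topology \<Rightarrow> ('e \<Rightarrow> 'f) \<Rightarrow> bool" where
  "free_on C E F T \<iota> \<longleftrightarrow>
     pro_C_group C F T \<and> continuous_map E T \<iota> \<and>
     (\<forall>A. subgroup A F \<and> closedin T A \<and> \<iota> ` topspace E \<subseteq> A \<longrightarrow> A = carrier F) \<and>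
     (\<forall>(L :: nat monoid) \<phi>. of_class C L \<and> continuous_map E (discrete_topology (carrier L)) \<phi> \<longrightarrow>
        (\<exists>\<theta>\<in>continuous_hom F T L (discrete_topology (carrier L)). \<forall>e\<in>topspace E. \<theta> (\<iota> e) = \<phi> e))"

lemma free_on_minimal:
  assumes "free_on C E F T \<iota>" "subgroup A F" "closedin T A" "\<iota> ` topspace E \<subseteq> A"
  shows "A = carrier F"
  using assms by (simp add: free_on_def)

lemma free_on_finite:
  fixes L :: "nat monoid"
  assumes "free_on C E F T \<iota>" "of_class C L" "continuous_map E (discrete_topology (carrier L)) \<phi>"
  obtains \<theta> where "\<theta> \<in> continuous_hom F T L (discrete_topology (carrier L))"
    "\<And>e. e \<in> topspace E \<Longrightarrow> \<theta> (\<iota> e) = \<phi> e"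
  using assms unfolding free_on_def by meson

lemma continuous_map_discrete_iff:
  "continuous_map T (discrete_topology S) f \<longleftrightarrow>
    continuous_map T (discrete_topology UNIV) f \<and> f \<in> topspace T \<rightarrow> S"
  using continuous_map_in_subtopology[of T "discrete_topology UNIV" S f] by simp

text \<open>
  The subgroup is chosen as the smallest closed one containing the generators, which makes the
  generation property immediate; a map to a finite group of the class extends by a coordinate
  projection.
\<close>

lemma ex_free_on:
  fixes C :: "nat monoid set" and E :: "'e topology" and k :: "'e set \<Rightarrow> 'i"
  assumes C: "class_of_finite_groups C" "subgroup_closed C" "quotient_closed C" "product_closed C"
    and inf: "infinite (UNIV :: 'i set)"
    and k: "codes_clopens k E" and ne: "C \<noteq> {}"
  shows "\<exists>(F :: ('i \<Rightarrow> nat) monoid) \<iota>. compactin nat_power (carrier F) \<and>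
    free_on C E F (subtopology nat_power (carrier F)) \<iota>"
proof -
  obtain L0 where "L0 \<in> C" using ne by blast
  then have L0: "of_class C L0" using C(1) Group.iso_refl[of L0]
    unfolding of_class_def class_of_finite_groups_def by blast
  obtain K :: "'i \<Rightarrow> nat monoid" and f where K: "\<And>i. of_class C (K i)"
    and f: "\<And>i. continuous_map E (discrete_topology (carrier (K i))) (f i)"
    and fK: "\<And>(L :: nat monoid) \<phi>. \<lbrakk>of_class C L; continuous_map E (discrete_topology (carrier L)) \<phi>\<rbrakk> \<Longrightarrow>
       \<exists>i. (\<lambda>x. x) \<in> hom (K i) L \<and> (\<forall>e\<in>topspace E. f i e = \<phi> e)"
    by (rule ex_finite_quotient_family[OF C(1) inf k L0]) blast
  let ?P = "product_group UNIV K"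
  interpret P: group ?P by (rule product_group) (use K in \<open>simp add: of_class_def\<close>)
  define \<iota> where "\<iota> e = (\<lambda>i. f i e)" for e
  define \<B> where "\<B> = {B. subgroup B ?P \<and> closedin nat_power B \<and> \<iota> ` topspace E \<subseteq> B}"
  define A where "A = \<Inter>\<B>"
  have fE: "f i e \<in> carrier (K i)" if "e \<in> topspace E" for i e
    using f[of i] that by (auto simp: continuous_map_def)
  have "compactin nat_power (Pi\<^sub>E UNIV (\<lambda>i. carrier (K i)))"
    using of_class_finite[OF C(1) K] by (simp add: nat_power_def compactin_PiE compactin_discrete_topology)
  then have "closedin nat_power (carrier ?P)"
    using compactin_imp_closedin[OF Hausdorff_nat_power] by simp
  then have P\<B>: "carrier ?P \<in> \<B>"
    using P.subgroup_self fE by (auto simp: \<B>_def \<iota>_def)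
  have A: "subgroup A ?P" "closedin nat_power A" "\<iota> ` topspace E \<subseteq> A"
    unfolding A_def using P\<B> by (auto simp: \<B>_def intro!: P.subgroups_Inter closedin_Inter)
  let ?F = "?P\<lparr>carrier := A\<rparr>" and ?T = "subtopology nat_power A"
  have pro: "compactin nat_power A" "pro_C_group C ?F ?T"
    by (rule closed_subgroup_of_product_pro_C[OF C K A(1,2)])+
  have \<iota>c: "continuous_map E ?T \<iota>"
    unfolding continuous_map_in_subtopology continuous_map_nat_power
  proof (intro conjI allI)
    show "continuous_map E (discrete_topology UNIV) (\<lambda>e. \<iota> e i)" for i
      using f[of i] continuous_map_discrete_iff[of E "carrier (K i)"] by (simp add: \<iota>_def)
    show "\<iota> \<in> topspace E \<rightarrow> A" using A(3) by auto
  qed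
  have min: "B = A" if B: "subgroup B ?F" "closedin ?T B" "\<iota> ` topspace E \<subseteq> B" for B
  proof -
    have "subgroup B ?P" using P.incl_subgroup[OF A(1) B(1)] .
    moreover have "closedin nat_power B" using closedin_trans_full[OF B(2) A(2)] .
    ultimately have "A \<subseteq> B" using B(3) by (auto simp: A_def \<B>_def)
    then show ?thesis using subgroup.subset[OF B(1)] by auto
  qed
  have ext: "\<exists>\<theta>\<in>continuous_hom ?F ?T L (discrete_topology (carrier L)). \<forall>e\<in>topspace E. \<theta> (\<iota> e) = \<phi> e"
    if L: "of_class C L" "continuous_map E (discrete_topology (carrier L)) \<phi>" for L :: "nat monoid" and \<phi>
  proof -
    obtain i where i: "(\<lambda>x. x) \<in> hom (K i) L" "\<And>e. e \<in> topspace E \<Longrightarrow> f i e = \<phi> e" using fK[OF L] by blast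
    have AK: "a i \<in> carrier (K i)" if "a \<in> A" for a i
      using subgroup.subset[OF A(1)] that by (auto simp: PiE_iff)
    then have hom: "(\<lambda>x. x i) \<in> hom ?F L"
      using i(1) by (auto simp: hom_def)
    have "continuous_map ?T (discrete_topology (carrier L)) (\<lambda>x. x i)"
      using hom continuous_map_from_subtopology[OF continuous_map_nat_power_coordinate[of i], of A]
      by (subst continuous_map_discrete_iff) (auto simp: hom_def)
    then show ?thesis using hom i(2)
      by (intro bexI[of _ "\<lambda>x. x i"]) (auto simp: continuous_hom_def \<iota>_def)
  qed
  have "free_on C E ?F ?T \<iota>"
    unfolding free_on_def using pro(2) \<iota>c min ext by (simp del: mult_product_group)
  then show ?thesis using pro(1) by (intro exI[of _ ?F] exI[of _ \<iota>]) (simp del: mult_product_group)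
qed

lemma free_on_unique:
  assumes F: "free_on C E F T \<iota>" and H: "pro_C_group C H S"
    and g: "g \<in> continuous_hom F T H S" "g' \<in> continuous_hom F T H S"
    and eq: "\<And>e. e \<in> topspace E \<Longrightarrow> g (\<iota> e) = g' (\<iota> e)" and x: "x \<in> carrier F"
  shows "g x = g' x"
proof -
  let ?A = "{x \<in> topspace T. g x = g' x}"
  have FT: "group F" "topspace T = carrier F" and HS: "group H" "Hausdorff_space S"
    and \<iota>: "continuous_map E T \<iota>"
    using F H by (auto simp: free_on_def pro_C_group_def topological_group_on_def profinite_space_def)
  interpret g: group_hom F H g using FT HS g by (simp add: group_hom_def group_hom_axioms_def continuous_hom_def)
  interpret g': group_hom F H g' using FT HS g by (simp add: group_hom_def group_hom_axioms_def continuous_hom_def)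
  have "closedin T ?A"
    using closedin_continuous_maps_eq[OF HS(2)] g by (simp add: continuous_hom_def)
  moreover have "subgroup ?A F"
    by (rule g.G.subgroupI) (use FT(2) in auto)
  moreover have "\<iota> ` topspace E \<subseteq> ?A" using eq \<iota> by (auto simp: continuous_map_def)
  ultimately have "?A = carrier F" using free_on_minimal[OF F] by blast
  then show ?thesis using x by blast
qed

text \<open>
  The closed subgroup of \<open>F \<times> H\<close> generated by the graph of \<open>f\<close> is the graph of the extension: it
  projects onto \<open>F\<close> by minimality, and the projection is injective because every finite quotient of
  \<open>H\<close> turns \<open>f\<close> into a map that does extend to \<open>F\<close>.
\<close>

lemma free_on_extend:
  fixes F :: "'f monoid" and H :: "'h monoid"
  assumes C: "class_of_finite_groups C" "subgroup_closed C" "quotient_closed C"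
    and F: "free_on C E F T \<iota>" and H: "pro_C_group C H S" and f: "continuous_map E S f"
  obtains g where "g \<in> continuous_hom F T H S" "\<And>e. e \<in> topspace E \<Longrightarrow> g (\<iota> e) = f e"
proof -
  have FT: "group F" "topspace T = carrier F" "compact_space T" "Hausdorff_space T"
    and HS: "group H" "topspace S = carrier H" "compact_space S" "Hausdorff_space S"
    and \<iota>: "continuous_map E T \<iota>"
    and tgH: "topological_group_on H S" "profinite_space S"
    using F H by (auto simp: free_on_def pro_C_group_def topological_group_on_def profinite_space_def)
  interpret F: group F by fact
  interpret H: group H by fact
  interpret P: group "F \<times>\<times> H" by (rule DirProd_group[OF FT(1) HS(1)])
  let ?PT = "prod_topology T S"
  have \<iota>F: "\<iota> e \<in> carrier F" and fH: "f e \<in> carrier H" if "e \<in> topspace E" for e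
    using \<iota> f that FT HS by (auto simp: continuous_map_def)
  define \<B> where "\<B> = {B. subgroup B (F \<times>\<times> H) \<and> closedin ?PT B \<and> (\<lambda>e. (\<iota> e, f e)) ` topspace E \<subseteq> B}"
  define \<Gamma> where "\<Gamma> = \<Inter>\<B>"
  have "closedin ?PT (carrier (F \<times>\<times> H))"
    using closedin_topspace[of ?PT] FT HS by simp
  then have P\<B>: "carrier (F \<times>\<times> H) \<in> \<B>"
    using P.subgroup_self \<iota>F fH by (auto simp: \<B>_def)
  have \<Gamma>: "subgroup \<Gamma> (F \<times>\<times> H)" "closedin ?PT \<Gamma>" "(\<lambda>e. (\<iota> e, f e)) ` topspace E \<subseteq> \<Gamma>"
    unfolding \<Gamma>_def using P\<B> by (auto simp: \<B>_def intro!: P.subgroups_Inter closedin_Inter)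
  interpret \<Gamma>: subgroup \<Gamma> "F \<times>\<times> H" by (rule \<Gamma>(1))
  have \<Gamma>FH: "x \<in> carrier F" "h \<in> carrier H" if "(x, h) \<in> \<Gamma>" for x h
    using \<Gamma>.subset that by auto
  have cPT: "compact_space ?PT" using FT HS by (simp add: compact_space_prod_topology)
  have "fst ` \<Gamma> = carrier F"
  proof -
    have "closedin T (fst ` \<Gamma>)"
      using image_compactin[OF closedin_compact_space[OF cPT \<Gamma>(2)] continuous_map_fst]
        compactin_imp_closedin[OF FT(4)] by blast
    moreover have "subgroup (fst ` \<Gamma>) F"
    proof (rule F.subgroupI)
      show "fst ` \<Gamma> \<subseteq> carrier F" using \<Gamma>FH by auto
      show "fst ` \<Gamma> \<noteq> {}" using \<Gamma>.one_closed by blast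
      show "inv\<^bsub>F\<^esub> a \<in> fst ` \<Gamma>" if a: "a \<in> fst ` \<Gamma>" for a
      proof -
        obtain h where h: "(a, h) \<in> \<Gamma>" using a by auto
        then have "(inv\<^bsub>F\<^esub> a, inv\<^bsub>H\<^esub> h) \<in> \<Gamma>"
          using \<Gamma>.m_inv_closed[OF h] inv_DirProd[OF FT(1) HS(1) \<Gamma>FH[OF h]] by simp
        then show ?thesis by force
      qed
      show "a \<otimes>\<^bsub>F\<^esub> b \<in> fst ` \<Gamma>" if "a \<in> fst ` \<Gamma>" "b \<in> fst ` \<Gamma>" for a b
        using that \<Gamma>.m_closed by force
    qed
    moreover have "\<iota> ` topspace E \<subseteq> fst ` \<Gamma>" using \<Gamma>(3) by force
    ultimately show ?thesis using free_on_minimal[OF F] by blast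
  qed
  then have ex: "\<exists>h. (x, h) \<in> \<Gamma>" if "x \<in> carrier F" for x using that by force
  have triv: "h = \<one>\<^bsub>H\<^esub>" if h: "(\<one>\<^bsub>F\<^esub>, h) \<in> \<Gamma>" for h
  proof (rule ccontr)
    assume "h \<noteq> \<one>\<^bsub>H\<^esub>"
    have hH: "h \<in> carrier H" using \<Gamma>FH[OF h] by blast
    have "closedin S {h}" using HS hH by (simp add: closedin_Hausdorff_singleton)
    then have "openin S (topspace S - {h})" by blast
    moreover have "\<one>\<^bsub>H\<^esub> \<in> topspace S - {h}" using \<open>h \<noteq> \<one>\<^bsub>H\<^esub>\<close> HS by simp
    ultimately obtain N where N: "N \<lhd> H" "openin S N" "N \<subseteq> topspace S - {h}"
      by (rule profinite_group_open_normal[OF tgH])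
    obtain K :: "nat monoid" and q where K: "pro_C_group C K (discrete_topology (carrier K))"
      and q: "q \<in> continuous_hom H S K (discrete_topology (carrier K))"
      and qeq: "\<And>x y. x \<in> carrier H \<Longrightarrow> y \<in> carrier H \<Longrightarrow> q x = q y \<longleftrightarrow> x \<otimes>\<^bsub>H\<^esub> inv\<^bsub>H\<^esub> y \<in> N"
      by (rule open_normal_quotient_copy[OF infinite_UNIV_nat C(1,3) H N(1,2)]) blast
    have Kg: "group K" using K by (simp add: pro_C_group_def topological_group_on_def)
    have "continuous_map E (discrete_topology (carrier K)) (\<lambda>e. q (f e))"
      using continuous_map_compose[OF f] q by (auto simp: continuous_hom_def o_def)
    then obtain \<theta> where \<theta>: "\<theta> \<in> continuous_hom F T K (discrete_topology (carrier K))"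
      "\<And>e. e \<in> topspace E \<Longrightarrow> \<theta> (\<iota> e) = q (f e)"
      by (rule free_on_finite[OF F of_class_if_pro_C_discrete[OF C(1,2) K]]) blast
    interpret \<theta>: group_hom F K \<theta> using \<theta> FT Kg by (simp add: group_hom_def group_hom_axioms_def continuous_hom_def)
    interpret q: group_hom H K q using q HS Kg by (simp add: group_hom_def group_hom_axioms_def continuous_hom_def)
    let ?D = "{z \<in> topspace ?PT. \<theta> (fst z) = q (snd z)}"
    have "continuous_map ?PT (discrete_topology (carrier K)) (\<lambda>z. \<theta> (fst z))"
      "continuous_map ?PT (discrete_topology (carrier K)) (\<lambda>z. q (snd z))"
      using continuous_map_compose[OF continuous_map_fst[of T S], of _ \<theta>] \<theta>(1)
        continuous_map_compose[OF continuous_map_snd[of T S], of _ q] q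
      by (auto simp: continuous_hom_def o_def)
    then have "closedin ?PT ?D"
      by (intro closedin_continuous_maps_eq[where Y="discrete_topology (carrier K)"]) simp
    moreover have "subgroup ?D (F \<times>\<times> H)"
    proof (rule P.subgroupI)
      have "(\<one>\<^bsub>F\<^esub>, \<one>\<^bsub>H\<^esub>) \<in> ?D" using FT HS by simp
      then show "?D \<noteq> {}" by blast
    qed (use FT HS in \<open>auto simp: inv_DirProd[OF FT(1) HS(1)]\<close>)
    moreover have "(\<lambda>e. (\<iota> e, f e)) ` topspace E \<subseteq> ?D"
      using \<theta>(2) \<iota>F fH FT HS by auto
    ultimately have "?D \<in> \<B>" by (simp add: \<B>_def)
    then have "(\<one>\<^bsub>F\<^esub>, h) \<in> ?D" using h by (auto simp: \<Gamma>_def)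
    then have "q h = q \<one>\<^bsub>H\<^esub>" by simp
    then have "h \<in> N" using qeq[OF hH H.one_closed] hH by simp
    then show False using N(3) by blast
  qed
  have uniq: "h = h'" if h: "(x, h) \<in> \<Gamma>" "(x, h') \<in> \<Gamma>" for x h h'
  proof -
    note c = \<Gamma>FH[OF h(1)] \<Gamma>FH[OF h(2)]
    have "(x, h) \<otimes>\<^bsub>F \<times>\<times> H\<^esub> inv\<^bsub>F \<times>\<times> H\<^esub> (x, h') \<in> \<Gamma>" using h by simp
    then have "(\<one>\<^bsub>F\<^esub>, h \<otimes>\<^bsub>H\<^esub> inv\<^bsub>H\<^esub> h') \<in> \<Gamma>" using c by (simp add: inv_DirProd[OF FT(1) HS(1)])
    then have "h \<otimes>\<^bsub>H\<^esub> inv\<^bsub>H\<^esub> h' = \<one>\<^bsub>H\<^esub>" by (rule triv)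
    then have "inv\<^bsub>H\<^esub> (inv\<^bsub>H\<^esub> h') = h" using c by (intro H.inv_equality) auto
    then show ?thesis using c by simp
  qed
  define g where "g x = (THE h. (x, h) \<in> \<Gamma>)" for x
  have g: "(x, g x) \<in> \<Gamma>" if x: "x \<in> carrier F" for x
  proof -
    obtain h where "(x, h) \<in> \<Gamma>" using ex[OF x] by blast
    then show ?thesis unfolding g_def by (rule theI) (rule uniq[OF _ \<open>(x, h) \<in> \<Gamma>\<close>])
  qed
  have geq: "g x = h" if "(x, h) \<in> \<Gamma>" for x h 
    by (rule uniq[OF g[OF \<Gamma>FH(1)[OF that]] that])
  have "g \<in> hom F H"
  proof (rule homI)
    show "g x \<in> carrier H" if "x \<in> carrier F" for x using \<Gamma>FH(2)[OF g[OF that]] .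
    fix x y assume xy: "x \<in> carrier F" "y \<in> carrier F"
    show "g (x \<otimes>\<^bsub>F\<^esub> y) = g x \<otimes>\<^bsub>H\<^esub> g y"
      using \<Gamma>.m_closed[OF g[OF xy(1)] g[OF xy(2)]] by (intro geq) simp
  qed
  moreover have "continuous_map T S g"
    unfolding continuous_map_closedin
  proof (intro conjI allI impI)
    show "g \<in> topspace T \<rightarrow> topspace S" using \<open>g \<in> hom F H\<close> FT HS by (auto simp: hom_def)
    fix V assume V: "closedin S V"
    have "closedin ?PT (\<Gamma> \<inter> (topspace T \<times> V))"
      using \<Gamma>(2) V by (intro closedin_Int) (auto simp: closedin_prod_Times_iff)
    then have "closedin T (fst ` (\<Gamma> \<inter> (topspace T \<times> V)))"
      using image_compactin[OF closedin_compact_space[OF cPT] continuous_map_fst]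
        compactin_imp_closedin[OF FT(4)] by blast
    moreover have "fst ` (\<Gamma> \<inter> (topspace T \<times> V)) = {x \<in> topspace T. g x \<in> V}"
    proof (intro equalityI subsetI)
      fix x assume "x \<in> fst ` (\<Gamma> \<inter> (topspace T \<times> V))"
      then obtain h where "(x, h) \<in> \<Gamma>" "x \<in> topspace T" "h \<in> V" by auto
      then show "x \<in> {x \<in> topspace T. g x \<in> V}" by (simp add: geq)
    next
      fix x assume x: "x \<in> {x \<in> topspace T. g x \<in> V}"
      then have "(x, g x) \<in> \<Gamma> \<inter> (topspace T \<times> V)" using g FT(2) by blast
      then show "x \<in> fst ` (\<Gamma> \<inter> (topspace T \<times> V))" by (metis fst_conv imageI)
    qed
    ultimately show "closedin T {x \<in> topspace T. g x \<in> V}" by simp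
  qed
  ultimately have "g \<in> continuous_hom F T H S" by (simp add: continuous_hom_def)
  moreover have "g (\<iota> e) = f e" if "e \<in> topspace E" for e using \<Gamma>(3) that by (intro geq) auto
  ultimately show thesis by (rule that)
qed

text \<open>
  A map on the image of \<open>\<iota>\<close>, pointed or not, is pulled back along \<open>\<iota>\<close> to a map on \<open>E\<close>, which has a unique
  extension.
\<close>

lemma free_on_imp_free_pro_C_group:
  fixes F :: "'f monoid"
  assumes C: "class_of_finite_groups C" "subgroup_closed C" "quotient_closed C"
    and F: "free_on C E F T \<iota>" and E: "compact_space E"
  shows "free_pro_C_group C F T (\<iota> ` topspace E)"
proof -
  have FT: "group F" "topspace T = carrier F" "Hausdorff_space T" "profinite_space T" "pro_C_group C F T"
    and \<iota>: "continuous_map E T \<iota>"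
    using F by (auto simp: free_on_def pro_C_group_def topological_group_on_def profinite_space_def)
  let ?B = "\<iota> ` topspace E" and ?S = "subtopology T (\<iota> ` topspace E)"
  have BF: "?B \<subseteq> carrier F" using \<iota> FT by (auto simp: continuous_map_def)
  have "compactin T ?B" using E \<iota> image_compactin by (auto simp: compact_space_def)
  then have "profinite_space ?S"
    using FT(4) by (auto simp: profinite_space_def totally_disconnected_space_def compact_space_subtopology
        Hausdorff_space_subtopology connectedin_subtopology)
  moreover have "extends_uniquely F T ?B H S" if H: "pro_C_group C H S" for H :: "'f monoid" and S
    unfolding extends_uniquely_def
  proof (intro allI impI)
    fix f assume f: "continuous_map ?S S f \<and> (\<one>\<^bsub>F\<^esub> \<in> ?B \<longrightarrow> f \<one>\<^bsub>F\<^esub> = \<one>\<^bsub>H\<^esub>)"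
    have "continuous_map E ?S \<iota>" using \<iota> by (auto simp: continuous_map_in_subtopology)
    then have "continuous_map E S (\<lambda>e. f (\<iota> e))"
      using continuous_map_compose[of E ?S \<iota> S f] f by (simp add: o_def)
    then obtain g where g: "g \<in> continuous_hom F T H S" "\<And>e. e \<in> topspace E \<Longrightarrow> g (\<iota> e) = f (\<iota> e)"
      by (rule free_on_extend[OF C F H]) blast
    have "restrict g (carrier F) \<in> continuous_hom F T H S"
      using g(1) FT(1,2) continuous_map_eq[of T S g "restrict g (carrier F)"]
      by (auto simp: continuous_hom_def hom_def Pi_iff group.is_monoid monoid.m_closed)
    moreover have "\<forall>x\<in>?B. restrict g (carrier F) x = f x" using g(2) BF by auto
    moreover have "g' = restrict g (carrier F)"
      if g': "g' \<in> extensional (carrier F) \<and> g' \<in> continuous_hom F T H S \<and> (\<forall>x\<in>?B. g' x = f x)" for g'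
    proof (rule extensionalityI[of _ "carrier F"])
      fix x assume x: "x \<in> carrier F"
      have "g' x = g x" by (rule free_on_unique[OF F H _ g(1) _ x]) (use g' g(2) in auto)
      then show "g' x = restrict g (carrier F) x" using x by simp
    qed (use g' in auto)
    ultimately show "\<exists>!g. g \<in> extensional (carrier F) \<and> g \<in> continuous_hom F T H S \<and> (\<forall>x\<in>?B. g x = f x)"
      by (intro ex1I[of _ "restrict g (carrier F)"]) auto
  qed
  ultimately show ?thesis unfolding free_pro_C_group_def using FT(5) BF by blast
qed

section \<open>The simplex category in terms of lists\<close>

text \<open>
  A map \<open>[m] \<rightarrow> [n]\<close> of the simplex category is the sorted list of its \<open>m + 1\<close> values. The list does not
  determine \<open>n\<close>; thus a map with image \<open>[k - 1]\<close> in \<open>[k]\<close> and the corresponding surjection onto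
  \<open>[k - 1]\<close> are the same list.
\<close>

definition ordmaps :: "nat \<Rightarrow> nat \<Rightarrow> nat list set" where
  "ordmaps m n = {\<alpha>. sorted \<alpha> \<and> length \<alpha> = Suc m \<and> set \<alpha> \<subseteq> {..n}}"

text \<open>
  Surjections with source \<open>[n]\<close>; the target of \<open>\<sigma>\<close> is \<open>[k]\<close> for \<open>k = Max (set \<sigma>)\<close>.
\<close>

definition ordsurjs :: "nat \<Rightarrow> nat list set" where
  "ordsurjs n = {\<sigma>. sorted \<sigma> \<and> length \<sigma> = Suc n \<and> set \<sigma> = {..Max (set \<sigma>)}}"

definition lcomp :: "nat list \<Rightarrow> nat list \<Rightarrow> nat list" where
  "lcomp \<sigma> \<alpha> = map ((!) \<sigma>) \<alpha>"

text \<open>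
  The maps \<open>\<delta>\<^sub>i : [n - 1] \<rightarrow> [n]\<close>, which omits \<open>i\<close>, and \<open>\<sigma>\<^sub>i : [n + 1] \<rightarrow> [n]\<close>, which repeats \<open>i\<close>.
\<close>

definition coface :: "nat \<Rightarrow> nat \<Rightarrow> nat list" where
  "coface n i = map (\<lambda>j. if j < i then j else Suc j) [0..<n]"

definition codegeneracy :: "nat \<Rightarrow> nat \<Rightarrow> nat list" where
  "codegeneracy n i = map (\<lambda>j. if j \<le> i then j else j - 1) [0..<Suc (Suc n)]"

lemma length_lcomp [simp]: "length (lcomp \<sigma> \<alpha>) = length \<alpha>"
  by (simp add: lcomp_def)

lemma length_coface [simp]: "length (coface n i) = n"
  by (simp add: coface_def)

lemma length_codegeneracy [simp]: "length (codegeneracy n i) = Suc (Suc n)"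
  by (simp add: codegeneracy_def)

lemma nth_lcomp [simp]: "j < length \<alpha> \<Longrightarrow> lcomp \<sigma> \<alpha> ! j = \<sigma> ! (\<alpha> ! j)"
  by (simp add: lcomp_def)

lemma nth_coface [simp]: "j < n \<Longrightarrow> coface n i ! j = (if j < i then j else Suc j)"
  by (simp add: coface_def)

lemma nth_codegeneracy [simp]: "j < Suc (Suc n) \<Longrightarrow> codegeneracy n i ! j = (if j \<le> i then j else j - 1)"
  unfolding codegeneracy_def by (simp del: upt_Suc)

lemma ordmaps_nth:
  assumes "\<alpha> \<in> ordmaps m n" "j \<le> m"
  shows "\<alpha> ! j \<le> n"
proof -
  have "\<alpha> ! j \<in> set \<alpha>" using assms by (intro nth_mem) (simp add: ordmaps_def)
  then show ?thesis using assms(1) by (auto simp: ordmaps_def)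
qed

lemma ordmapsI:
  assumes "length \<alpha> = Suc m" "\<And>j. j \<le> m \<Longrightarrow> \<alpha> ! j \<le> n"
    "\<And>i j. i \<le> j \<Longrightarrow> j \<le> m \<Longrightarrow> \<alpha> ! i \<le> \<alpha> ! j"
  shows "\<alpha> \<in> ordmaps m n"
  using assms unfolding ordmaps_def by (auto simp: sorted_iff_nth_mono in_set_conv_nth)

lemma ordmaps_length: "\<alpha> \<in> ordmaps m n \<Longrightarrow> length \<alpha> = Suc m"
  by (simp add: ordmaps_def)

lemma lcomp_assoc:
  assumes "\<beta> \<in> ordmaps l m" "\<alpha> \<in> ordmaps m n"
  shows "lcomp \<sigma> (lcomp \<alpha> \<beta>) = lcomp (lcomp \<sigma> \<alpha>) \<beta>"
  using assms ordmaps_nth[OF assms(1)]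
  by (intro nth_equalityI) (auto simp: ordmaps_length less_Suc_eq_le)

lemma lcomp_ordmaps:
  assumes "\<sigma> \<in> ordmaps m n" "\<alpha> \<in> ordmaps l m"
  shows "lcomp \<sigma> \<alpha> \<in> ordmaps l n"
proof (rule ordmapsI)
  show "length (lcomp \<sigma> \<alpha>) = Suc l" using assms by (simp add: ordmaps_length)
  show "lcomp \<sigma> \<alpha> ! j \<le> n" if "j \<le> l" for j
    using that assms by (simp add: ordmaps_length ordmaps_nth)
  show "lcomp \<sigma> \<alpha> ! i \<le> lcomp \<sigma> \<alpha> ! j" if "i \<le> j" "j \<le> l" for i j
  proof -
    have "\<alpha> ! i \<le> \<alpha> ! j" "\<alpha> ! j \<le> m"
      using that assms(2) ordmaps_nth[OF assms(2)] by (auto simp: ordmaps_def sorted_iff_nth_mono)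
    then have "\<sigma> ! (\<alpha> ! i) \<le> \<sigma> ! (\<alpha> ! j)"
      using assms(1) by (auto simp: ordmaps_def sorted_iff_nth_mono)
    then show ?thesis using that assms by (simp add: ordmaps_length)
  qed
qed

lemma set_lcomp_subset:
  assumes "\<sigma> \<in> ordmaps m n" "\<alpha> \<in> ordmaps l m"
  shows "set (lcomp \<sigma> \<alpha>) \<subseteq> set \<sigma>"
proof -
  have "\<sigma> ! j \<in> set \<sigma>" if "j \<in> set \<alpha>" for j
    using that assms by (intro nth_mem) (auto simp: ordmaps_def less_Suc_eq_le)
  then show ?thesis by (auto simp: lcomp_def)
qed

lemma set_lcomp_surj:
  assumes "\<sigma> \<in> ordmaps m n" "set \<alpha> = {..m}"
  shows "set (lcomp \<sigma> \<alpha>) = set \<sigma>"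
proof -
  have "set \<sigma> = (!) \<sigma> ` {..m}"
    using ordmaps_length[OF assms(1)] by (auto simp: set_conv_nth image_iff less_Suc_eq_le)
  then show ?thesis using assms(2) by (simp add: lcomp_def)
qed

lemma Max_atMost_nat [simp]: "Max {..k :: nat} = k"
  by (simp add: Max_eq_iff)

lemma Max_le_ordsurjs: "\<sigma> \<in> ordsurjs n \<Longrightarrow> Max (set \<sigma>) \<le> n"
proof -
  assume \<sigma>: "\<sigma> \<in> ordsurjs n"
  then have "card {..Max (set \<sigma>)} \<le> Suc n"
    unfolding ordsurjs_def by (metis (mono_tags, lifting) card_length mem_Collect_eq)
  then show ?thesis by simp
qed

lemma ordsurjs_ordmaps: "\<sigma> \<in> ordsurjs n \<Longrightarrow> \<sigma> \<in> ordmaps n (Max (set \<sigma>))"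
  unfolding ordsurjs_def ordmaps_def by blast

lemma ordsurjs_iff: "\<sigma> \<in> ordsurjs n \<longleftrightarrow> (\<exists>k. \<sigma> \<in> ordmaps n k \<and> set \<sigma> = {..k})"
  unfolding ordsurjs_def ordmaps_def by auto

lemma finite_ordsurjs: "finite (ordsurjs n)"
proof (rule finite_subset)
  show "ordsurjs n \<subseteq> {\<sigma>. set \<sigma> \<subseteq> {..n} \<and> length \<sigma> = Suc n}"
  proof
    fix \<sigma> assume \<sigma>: "\<sigma> \<in> ordsurjs n"
    then show "\<sigma> \<in> {\<sigma>. set \<sigma> \<subseteq> {..n} \<and> length \<sigma> = Suc n}"
      using order.trans[OF Max_ge Max_le_ordsurjs[OF \<sigma>]] ordsurjs_ordmaps[OF \<sigma>]
      by (auto simp: ordmaps_def)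
  qed
  show "finite {\<sigma>. set \<sigma> \<subseteq> {..n} \<and> length \<sigma> = Suc n}" by (rule finite_lists_length_eq) simp
qed

lemma lcomp_ordsurjs:
  assumes "\<sigma> \<in> ordsurjs n" "\<tau> \<in> ordmaps m n" "set \<tau> = {..n}"
  shows "lcomp \<sigma> \<tau> \<in> ordsurjs m" "set (lcomp \<sigma> \<tau>) = set \<sigma>"
proof -
  note \<sigma> = ordsurjs_ordmaps[OF assms(1)]
  show "set (lcomp \<sigma> \<tau>) = set \<sigma>" by (rule set_lcomp_surj[OF \<sigma> assms(3)])
  then show "lcomp \<sigma> \<tau> \<in> ordsurjs m"
    using assms(1) lcomp_ordmaps[OF \<sigma> assms(2)] unfolding ordsurjs_def ordmaps_def by simp
qed

lemma coface_ordmaps: "coface (Suc m) i \<in> ordmaps m (Suc m)"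
  by (rule ordmapsI) auto

lemma codegeneracy_ordmaps: "i \<le> n \<Longrightarrow> codegeneracy n i \<in> ordmaps (Suc n) n"
  by (rule ordmapsI) auto

lemma set_coface: "set (coface (Suc m) i) = {..Suc m} - {i}" if "i \<le> Suc m"
proof (intro equalityI subsetI)
  fix x assume "x \<in> {..Suc m} - {i}"
  then have "x = coface (Suc m) i ! (if x < i then x else x - 1)" "(if x < i then x else x - 1) < Suc m"
    using that by auto
  then show "x \<in> set (coface (Suc m) i)" by (metis length_coface nth_mem)
qed (auto simp: coface_def split: if_splits)

lemma set_codegeneracy: "i \<le> n \<Longrightarrow> set (codegeneracy n i) = {..n}"
proof (intro equalityI subsetI)
  fix x assume "i \<le> n" "x \<in> {..n}"
  then have "x = codegeneracy n i ! (if x \<le> i then x else Suc x)" "(if x \<le> i then x else Suc x) < Suc (Suc n)"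
    by auto
  then show "x \<in> set (codegeneracy n i)" by (metis length_codegeneracy nth_mem)
qed (auto simp: codegeneracy_def split: if_splits)

lemma idlist_ordmaps: "[0..<Suc n] \<in> ordmaps n n"
  by (rule ordmapsI) (auto simp del: upt_Suc)

lemma set_idlist: "set [0..<Suc n] = {..n}"
  by auto

lemma lcomp_id_right: "\<sigma> \<in> ordmaps n k \<Longrightarrow> lcomp \<sigma> [0..<Suc n] = \<sigma>"
  by (intro nth_equalityI) (auto simp: ordmaps_length simp del: upt_Suc)

lemma lcomp_id_left: "\<alpha> \<in> ordmaps m n \<Longrightarrow> lcomp [0..<Suc n] \<alpha> = \<alpha>"
  using ordmaps_nth[of \<alpha> m n]
  by (intro nth_equalityI) (auto simp: ordmaps_length less_Suc_eq_le simp del: upt_Suc)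

lemma ordmaps_factor_coface:
  assumes \<gamma>: "\<gamma> \<in> ordmaps l (Suc m)" and i: "i \<le> Suc m" "i \<notin> set \<gamma>"
  obtains \<gamma>' where "\<gamma>' \<in> ordmaps l m" "\<gamma> = lcomp (coface (Suc m) i) \<gamma>'"
proof
  let ?\<gamma>' = "map (\<lambda>x. if x < i then x else x - 1) \<gamma>"
  have ne: "\<gamma> ! j \<noteq> i" if "j \<le> l" for j using that i(2) ordmaps_length[OF \<gamma>] by (metis le_imp_less_Suc nth_mem)
  show g: "?\<gamma>' \<in> ordmaps l m"
  proof (rule ordmapsI)
    show "length ?\<gamma>' = Suc l" using \<gamma> by (simp add: ordmaps_length)
    show "?\<gamma>' ! j \<le> m" if "j \<le> l" for j
      using that ordmaps_nth[OF \<gamma> that] ne[OF that] ordmaps_length[OF \<gamma>] i by auto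
    show "?\<gamma>' ! p \<le> ?\<gamma>' ! q" if "p \<le> q" "q \<le> l" for p q
      using that ordmaps_length[OF \<gamma>] \<gamma> sorted_nth_mono[of \<gamma> p q] by (auto simp: ordmaps_def)
  qed
  show "\<gamma> = lcomp (coface (Suc m) i) ?\<gamma>'"
  proof (rule nth_equalityI)
    fix j assume j: "j < length \<gamma>"
    then have jl: "j \<le> l" using ordmaps_length[OF \<gamma>] by simp
    then show "\<gamma> ! j = lcomp (coface (Suc m) i) ?\<gamma>' ! j"
      using j ne[OF jl] ordmaps_nth[OF \<gamma> jl] i by auto
  qed simp
qed

text \<open>
  This is the reason why every generator in dimension \<open>n + 1\<close> is either degenerate or new: a surjection
  that is not injective takes the same value at two consecutive places.
\<close>

lemma ordsurjs_Suc_cases: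
  assumes \<sigma>: "\<sigma> \<in> ordsurjs (Suc n)"
  obtains "\<sigma> = [0..<Suc (Suc n)]"
  | i \<sigma>' where "i \<le> n" "\<sigma>' \<in> ordsurjs n" "\<sigma> = lcomp \<sigma>' (codegeneracy n i)"
proof (cases "\<exists>i\<le>n. \<sigma> ! i = \<sigma> ! Suc i")
  case True
  then obtain i where i: "i \<le> n" "\<sigma> ! i = \<sigma> ! Suc i" by blast
  note \<sigma>m = ordsurjs_ordmaps[OF \<sigma>]
  let ?\<sigma>' = "lcomp \<sigma> (coface (Suc n) (Suc i))"
  have eq: "\<sigma> = lcomp ?\<sigma>' (codegeneracy n i)"
  proof (rule nth_equalityI)
    show "length \<sigma> = length (lcomp ?\<sigma>' (codegeneracy n i))" using \<sigma>m by (simp add: ordmaps_length)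
    fix j assume "j < length \<sigma>"
    then have j: "j < Suc (Suc n)" using \<sigma>m by (simp add: ordmaps_length)
    show "\<sigma> ! j = lcomp ?\<sigma>' (codegeneracy n i) ! j"
      using i j by (cases "j = Suc i") (auto)
  qed
  have m: "?\<sigma>' \<in> ordmaps n (Max (set \<sigma>))" by (rule lcomp_ordmaps[OF \<sigma>m coface_ordmaps])
  have "set \<sigma> \<subseteq> set ?\<sigma>'" using set_lcomp_subset[OF m codegeneracy_ordmaps[OF i(1)]] eq by simp
  moreover have "set ?\<sigma>' \<subseteq> set \<sigma>" by (rule set_lcomp_subset[OF \<sigma>m coface_ordmaps])
  moreover have "set \<sigma> = {..Max (set \<sigma>)}" using \<sigma> unfolding ordsurjs_def by blast
  ultimately have "set ?\<sigma>' = {..Max (set \<sigma>)}" by blast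
  then have "?\<sigma>' \<in> ordsurjs n" using m ordsurjs_iff by blast
  then show thesis using that(2) i(1) eq by blast
next
  case False
  have srt: "sorted \<sigma>" and len: "length \<sigma> = Suc (Suc n)" using \<sigma> unfolding ordsurjs_def by blast+
  have "\<sigma> ! i < \<sigma> ! Suc i" if "i \<le> n" for i
    using False that srt len sorted_nth_mono[of \<sigma> i "Suc i"] by (auto simp: le_less)
  then have "sorted_wrt (<) \<sigma>"
    using len by (auto simp: sorted_wrt_iff_nth_Suc_transp)
  then have d: "distinct \<sigma>" by (simp add: strict_sorted_iff)
  have "card (set \<sigma>) = Suc (Suc n)" using d len by (simp add: distinct_card)
  moreover obtain k where "set \<sigma> = {..k}" using \<sigma> ordsurjs_iff by blast
  ultimately have "set \<sigma> = set [0..<Suc (Suc n)]" unfolding set_idlist by simp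
  then have "\<sigma> = [0..<Suc (Suc n)]" 
    using sorted_distinct_set_unique[OF srt d sorted_upt distinct_upt] by blast
  then show thesis by (rule that(1))
qed

lemma lcomp_codegeneracy_not_id:
  assumes "i \<le> n" shows "lcomp \<sigma> (codegeneracy n i) \<noteq> [0..<Suc (Suc n)]"
proof
  assume eq: "lcomp \<sigma> (codegeneracy n i) = [0..<Suc (Suc n)]"
  have "lcomp \<sigma> (codegeneracy n i) ! i = lcomp \<sigma> (codegeneracy n i) ! Suc i" using assms by simp
  then show False unfolding eq using assms by (simp del: upt_Suc)
qed

lemma coface_coface:
  assumes "i < j" "j \<le> Suc (Suc n)"
  shows "lcomp (coface (Suc (Suc n)) j) (coface (Suc n) i) =
    lcomp (coface (Suc (Suc n)) i) (coface (Suc n) (j - 1))"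
  by (rule nth_equalityI) (use assms in auto)

lemma codegeneracy_coface_less:
  assumes "i < j" "j \<le> Suc n"
  shows "lcomp (codegeneracy (Suc n) j) (coface (Suc (Suc n)) i) =
    lcomp (coface (Suc n) i) (codegeneracy n (j - 1))"
  by (rule nth_equalityI) (use assms in auto)

lemma codegeneracy_coface_id:
  assumes "j \<le> n" "i = j \<or> i = Suc j"
  shows "lcomp (codegeneracy n j) (coface (Suc n) i) = [0..<Suc n]"
  by (rule nth_equalityI) (use assms in \<open>auto simp del: upt_Suc\<close>)

lemma codegeneracy_coface_greater:
  assumes "Suc j < i" "i \<le> Suc (Suc n)"
  shows "lcomp (codegeneracy (Suc n) j) (coface (Suc (Suc n)) i) =
    lcomp (coface (Suc n) (i - 1)) (codegeneracy n j)"
  by (rule nth_equalityI) (use assms in auto)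

lemma codegeneracy_codegeneracy:
  assumes "i \<le> j" "j \<le> n"
  shows "lcomp (codegeneracy n j) (codegeneracy (Suc n) i) = lcomp (codegeneracy n i) (codegeneracy (Suc n) (Suc j))"
  by (rule nth_equalityI) (use assms in auto)

section \<open>Attaching cells\<close>

text \<open>
  A continuous map from a compact space onto a Hausdorff space is closed, hence a quotient map.
\<close>

lemma homeomorphic_map_from_quotient_topology:
  assumes S: "compact_space S" and T: "Hausdorff_space T"
    and p: "continuous_map S T p" "p ` topspace S = topspace T"
    and h: "\<And>x. x \<in> topspace S \<Longrightarrow> h (q x) = p x" "inj_on h (q ` topspace S)"
  shows "homeomorphic_map (quotient_topology S q) T h"
proof -
  let ?Q = "quotient_topology S q"
  have top: "topspace ?Q = q ` topspace S"
  proof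
    show "topspace ?Q \<subseteq> q ` topspace S"
      using openin_topspace[of ?Q] unfolding openin_quotient_topology by blast
    have "{x \<in> topspace S. q x \<in> q ` topspace S} = topspace S" by auto
    then have "openin ?Q (q ` topspace S)" unfolding openin_quotient_topology by simp
    then show "q ` topspace S \<subseteq> topspace ?Q" by (rule openin_subset)
  qed
  have "closed_map S T p" by (rule continuous_imp_closed_map[OF p(1) S T])
  then have pq: "quotient_map S T p"
    using p continuous_closed_imp_quotient_map by blast
  have "openin ?Q {c \<in> topspace ?Q. h c \<in> U} \<longleftrightarrow> openin T U" if U: "U \<subseteq> topspace T" for U
  proof -
    have "{x \<in> topspace S. q x \<in> {c \<in> topspace ?Q. h c \<in> U}} = {x \<in> topspace S. p x \<in> U}"
    proof -
      have "q x \<in> {c \<in> topspace ?Q. h c \<in> U} \<longleftrightarrow> p x \<in> U" if "x \<in> topspace S" for x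
      proof -
        have "q x \<in> topspace ?Q" unfolding top using that by (rule imageI)
        then show ?thesis using h(1)[OF that] by simp
      qed
      then show ?thesis by blast
    qed
    moreover have "{c \<in> topspace ?Q. h c \<in> U} \<subseteq> q ` topspace S" using top by blast
    ultimately show ?thesis using pq U unfolding openin_quotient_topology quotient_map_def by simp
  qed
  moreover have "h ` topspace ?Q = topspace T" 
    unfolding top image_image p(2)[symmetric] by (rule image_cong) (simp_all add: h(1))
  ultimately show ?thesis
    using h(2) top unfolding homeomorphic_map_def quotient_map_def by simp
qed

lemma Mod_self_trivial:
  assumes "group H"
  shows "carrier (H Mod carrier H) = {carrier H}"
proof -
  interpret group H by fact
  have "carrier H #>\<^bsub>H\<^esub> x = carrier H" if "x \<in> carrier H" for x
    using coset_join2[OF that subgroup_self that] .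
  then show ?thesis using one_closed by (auto simp: FactGroup_def RCOSETS_def)
qed

lemma continuous_hom_comp:
  assumes "f \<in> continuous_hom A R B S" "g \<in> continuous_hom B S D Q"
  shows "(\<lambda>x. g (f x)) \<in> continuous_hom A R D Q"
  using assms continuous_map_compose[of R S f Q g]
  by (auto simp: continuous_hom_def hom_def Pi_iff o_def)

lemma pro_C_groupD:
  assumes "pro_C_group C H S"
  shows "group H" "topspace S = carrier H" "Hausdorff_space S" "compact_space S"
  using assms by (auto simp: pro_C_group_def topological_group_on_def profinite_space_def)

lemma closedin_one_preimage:
  assumes "f \<in> continuous_hom A R B S" "pro_C_group C B S"
  shows "closedin R {x \<in> topspace R. f x = \<one>\<^bsub>B\<^esub>}"
  using assms pro_C_groupD[OF assms(2)] 
    closedin_continuous_map_preimage[of R S f "{\<one>\<^bsub>B\<^esub>}"]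
  by (simp add: continuous_hom_def closedin_Hausdorff_singleton group.is_monoid)

lemma pro_C_group_class_nonempty:
  assumes G: "pro_C_group C G T"
  shows "C \<noteq> {}"
proof -
  have "topspace T = carrier G" using pro_C_groupD[OF G] by simp
  interpret G: group G using pro_C_groupD[OF G] by simp
  have "carrier G \<lhd> G" unfolding G.normal_inv_iff using G.subgroup_self by simp
  moreover have "openin T (carrier G)" using openin_topspace[of T] \<open>topspace T = carrier G\<close> by simp
  ultimately show ?thesis using G by (auto simp: pro_C_group_def of_class_def)
qed

text \<open>
  \<open>Y0\<close> is the space of cells of dimension \<open>0\<close>. The space \<open>G\<close> is replaced by it because the cells have
  to be elements of \<open>'i \<Rightarrow> nat\<close>.
\<close>

locale resolution_construction =
  fixes C :: "nat monoid set" and G :: "'a monoid" and T :: "'a topology"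
    and Y0 :: "('i \<Rightarrow> nat) set" and aug :: "('i \<Rightarrow> nat) \<Rightarrow> 'a"
  assumes C: "class_of_finite_groups C" "subgroup_closed C" "quotient_closed C" "product_closed C"
    and inf: "infinite (UNIV :: 'i set)"
    and G: "pro_C_group C G T"
    and Y0: "compactin nat_power Y0"
    and aug: "continuous_map (subtopology nat_power Y0) T aug" "aug ` Y0 = carrier G"
begin

text \<open>
  The definitions up to \<open>cycles\<close> take the whole sequence of cell spaces as a parameter, although the
  objects in dimension \<open>n\<close> depend only on its members up to \<open>n\<close>. This makes the recursive definition of
  the sequence possible.
\<close>

definition gens :: "(nat \<Rightarrow> ('i \<Rightarrow> nat) set) \<Rightarrow> nat \<Rightarrow> (nat list \<times> ('i \<Rightarrow> nat)) topology" where
  "gens Y n = sum_topology (\<lambda>\<sigma>. subtopology nat_power (Y (Max (set \<sigma>)))) (ordsurjs n)"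

definition level_pair :: "(nat \<Rightarrow> ('i \<Rightarrow> nat) set) \<Rightarrow> nat \<Rightarrow>
    ('i \<Rightarrow> nat) monoid \<times> (nat list \<times> ('i \<Rightarrow> nat) \<Rightarrow> ('i \<Rightarrow> nat))" where
  "level_pair Y n = (SOME (F, \<iota>). compactin nat_power (carrier F) \<and>
     free_on C (gens Y n) F (subtopology nat_power (carrier F)) \<iota>)"

definition level :: "(nat \<Rightarrow> ('i \<Rightarrow> nat) set) \<Rightarrow> nat \<Rightarrow> ('i \<Rightarrow> nat) monoid" where
  "level Y n = fst (level_pair Y n)"

definition gen :: "(nat \<Rightarrow> ('i \<Rightarrow> nat) set) \<Rightarrow> nat \<Rightarrow> nat list \<times> ('i \<Rightarrow> nat) \<Rightarrow> ('i \<Rightarrow> nat)" where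
  "gen Y n = snd (level_pair Y n)"

abbreviation leveltop :: "(nat \<Rightarrow> ('i \<Rightarrow> nat) set) \<Rightarrow> nat \<Rightarrow> ('i \<Rightarrow> nat) topology" where
  "leveltop Y n \<equiv> subtopology nat_power (carrier (level Y n))"

text \<open>
  The homomorphism that extends \<open>f\<close>, or some homomorphism if \<open>f\<close> does not extend. With this default the
  result is a continuous homomorphism in any case, so the cycles form a closed set before anything
  is known about the operators.
\<close>

definition lift :: "(nat \<Rightarrow> ('i \<Rightarrow> nat) set) \<Rightarrow> nat \<Rightarrow> 'b monoid \<Rightarrow> 'b topology \<Rightarrow>
    (nat list \<times> ('i \<Rightarrow> nat) \<Rightarrow> 'b) \<Rightarrow> ('i \<Rightarrow> nat) \<Rightarrow> 'b" where
  "lift Y n H S f = (SOME g. g \<in> continuous_hom (level Y n) (leveltop Y n) H S \<and>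
     ((\<exists>g'\<in>continuous_hom (level Y n) (leveltop Y n) H S. \<forall>e\<in>topspace (gens Y n). g' (gen Y n e) = f e) \<longrightarrow>
      (\<forall>e\<in>topspace (gens Y n). g (gen Y n e) = f e)))"

text \<open>
  The operator of a surjection \<open>\<tau>\<close>. It needs a definition of its own, because the operators of
  the other maps refer to it.
\<close>

definition reindex :: "(nat \<Rightarrow> ('i \<Rightarrow> nat) set) \<Rightarrow> nat list \<Rightarrow> ('i \<Rightarrow> nat) \<Rightarrow> ('i \<Rightarrow> nat)" where
  "reindex Y \<tau> = (let m = length \<tau> - 1 in
     lift Y (Max (set \<tau>)) (level Y m) (leveltop Y m) (\<lambda>e. gen Y m (lcomp (fst e) \<tau>, snd e)))"

text \<open>
  The simplex indexed by \<open>\<rho> : [m] \<rightarrow> [k]\<close> in the \<open>k\<close>-cell attached along \<open>y\<close>. In the second case \<open>y\<close> is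
  regarded as an element of dimension \<open>k - 1\<close> and \<open>\<rho>\<close> as a surjection onto \<open>[k - 1]\<close>.
\<close>

definition cell :: "(nat \<Rightarrow> ('i \<Rightarrow> nat) set) \<Rightarrow> nat \<Rightarrow> ('i \<Rightarrow> nat) \<Rightarrow> nat list \<Rightarrow> ('i \<Rightarrow> nat)" where
  "cell Y k y \<rho> = (let m = length \<rho> - 1 in
     if set \<rho> = {..k} then gen Y m (\<rho>, y)
     else if set \<rho> = {..<k} then reindex Y \<rho> y
     else \<one>\<^bsub>level Y m\<^esub>)"

text \<open>
  The operator \<open>X\<^sub>n \<rightarrow> X\<^sub>m\<close> of \<open>\<alpha> : [m] \<rightarrow> [n]\<close>.
\<close>

definition smap :: "(nat \<Rightarrow> ('i \<Rightarrow> nat) set) \<Rightarrow> nat \<Rightarrow> nat list \<Rightarrow> ('i \<Rightarrow> nat) \<Rightarrow> ('i \<Rightarrow> nat)" where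
  "smap Y n \<alpha> = (let m = length \<alpha> - 1 in
     lift Y n (level Y m) (leveltop Y m) (\<lambda>e. cell Y (Max (set (fst e))) (snd e) (lcomp (fst e) \<alpha>)))"

definition augmentation :: "(nat \<Rightarrow> ('i \<Rightarrow> nat) set) \<Rightarrow> ('i \<Rightarrow> nat) \<Rightarrow> 'a" where
  "augmentation Y = lift Y 0 G T (\<lambda>e. aug (snd e))"

definition cycles :: "(nat \<Rightarrow> ('i \<Rightarrow> nat) set) \<Rightarrow> nat \<Rightarrow> ('i \<Rightarrow> nat) set" where
  "cycles Y n = {x \<in> carrier (level Y n).
     if n = 0 then augmentation Y x = \<one>\<^bsub>G\<^esub>
     else \<forall>i\<le>n. smap Y n (coface n i) x = \<one>\<^bsub>level Y (n - 1)\<^esub>}"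

text \<open>
  Each step is given only the members already defined; that these determine the cycles is \<open>cycles_cong\<close>.
\<close>

fun Y :: "nat \<Rightarrow> ('i \<Rightarrow> nat) set" where
  "Y 0 = Y0"
| "Y (Suc n) = cycles (\<lambda>k. if k \<le> n then Y k else {}) n"

lemma gens_cong:
  assumes "\<And>k. k \<le> n \<Longrightarrow> Z k = Z' k"
  shows "gens Z n = gens Z' n"
  unfolding gens_def topology_eq openin_sum_topology
  using assms Max_le_ordsurjs[of _ n] by (simp add: Sigma_def)

lemma level_cong:
  assumes "\<And>k. k \<le> n \<Longrightarrow> Z k = Z' k"
  shows "level Z n = level Z' n" "gen Z n = gen Z' n"
  using gens_cong[OF assms] by (simp_all add: level_def gen_def level_pair_def)

lemma lift_cong:
  fixes f f' :: "nat list \<times> ('i \<Rightarrow> nat) \<Rightarrow> 'b"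
  assumes Z: "\<And>k. k \<le> n \<Longrightarrow> Z k = Z' k" and f: "\<And>e. e \<in> topspace (gens Z n) \<Longrightarrow> f e = f' e"
  shows "lift Z n H S f = lift Z' n H S f'"
proof -
  have g: "gens Z n = gens Z' n" "level Z n = level Z' n" "gen Z n = gen Z' n"
    using gens_cong[of n Z Z'] level_cong[of n Z Z'] Z by auto
  have "(\<forall>e\<in>topspace (gens Z n). h (gen Z n e) = f e) \<longleftrightarrow>
      (\<forall>e\<in>topspace (gens Z' n). h (gen Z' n e) = f' e)" for h :: "('i \<Rightarrow> nat) \<Rightarrow> 'b"
    using f g by simp
  then show ?thesis unfolding lift_def g(2) by simp
qed

lemma topspace_gens: "topspace (gens Z n) = {(\<sigma>, y). \<sigma> \<in> ordsurjs n \<and> y \<in> Z (Max (set \<sigma>))}"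
  by (auto simp: gens_def)

lemma smap_cong:
  assumes Z: "\<And>k. k \<le> n \<Longrightarrow> Z k = Z' k" and \<alpha>: "\<alpha> \<in> ordmaps m n" "m \<le> n"
  shows "smap Z n \<alpha> = smap Z' n \<alpha>"
proof -
  have m: "length \<alpha> - 1 = m" using \<alpha> by (simp add: ordmaps_length)
  have Zm: "\<And>k. k \<le> m \<Longrightarrow> Z k = Z' k" using Z \<alpha>(2) by simp
  have lm: "level Z m = level Z' m" "gen Z m = gen Z' m" using level_cong[of m Z Z'] Zm by auto
  show ?thesis
    unfolding smap_def Let_def m lm
  proof (rule lift_cong)
    fix e assume "e \<in> topspace (gens Z n)"
    then have \<sigma>: "fst e \<in> ordsurjs n" by (auto simp: topspace_gens)
    let ?\<rho> = "lcomp (fst e) \<alpha>" and ?k = "Max (set (fst e))"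
    have \<rho>: "length ?\<rho> - 1 = m" using m by simp
    have "reindex Z ?\<rho> = reindex Z' ?\<rho>" if "set ?\<rho> = {..<?k}"
      unfolding reindex_def Let_def \<rho> lm
    proof (rule lift_cong)
      have "set ?\<rho> \<noteq> {}" using \<alpha> by (auto simp: ordmaps_def lcomp_def)
      then have "Max (set ?\<rho>) \<in> set ?\<rho>" by simp
      then have "Max (set ?\<rho>) < ?k" using that by blast
      then show "Z k = Z' k" if "k \<le> Max (set ?\<rho>)" for k
        using that Max_le_ordsurjs[OF \<sigma>] Z by simp
    qed simp
    then show "cell Z ?k (snd e) ?\<rho> = cell Z' ?k (snd e) ?\<rho>"
      unfolding cell_def Let_def \<rho> lm by simp
  qed (rule Z)
qed

lemma cycles_cong:
  assumes Z: "\<And>k. k \<le> n \<Longrightarrow> Z k = Z' k"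
  shows "cycles Z n = cycles Z' n"
proof (cases n)
  case 0
  then show ?thesis
    using level_cong(1)[of 0 Z Z'] lift_cong[of 0 Z Z' "\<lambda>e. aug (snd e)" "\<lambda>e. aug (snd e)"] Z
    by (simp add: cycles_def augmentation_def)
next
  case (Suc m)
  have "smap Z n (coface n i) = smap Z' n (coface n i)" for i
    unfolding Suc by (rule smap_cong[OF _ coface_ordmaps]) (use Z Suc in simp_all)
  moreover have "level Z m = level Z' m" using level_cong(1)[of m Z Z'] Z Suc by simp
  ultimately show ?thesis using level_cong(1)[of n Z Z'] Z Suc by (simp add: cycles_def)
qed

lemma Y_Suc: "Y (Suc n) = cycles Y n"
  using cycles_cong[of n "\<lambda>k. if k \<le> n then Y k else {}" Y] by simp

lemma level_free:
  assumes Z: "\<And>k. k \<le> n \<Longrightarrow> compactin nat_power (Z k)"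
  shows "compactin nat_power (carrier (level Z n))"
    and "free_on C (gens Z n) (level Z n) (leveltop Z n) (gen Z n)"
proof -
  have "\<exists>k :: (nat list \<times> ('i \<Rightarrow> nat)) set \<Rightarrow> 'i. codes_clopens k (gens Z n)"
    unfolding gens_def
    by (intro ex_codes_clopens_sum[OF inf finite_ordsurjs] ex_codes_clopens_compact[OF inf] Z Max_le_ordsurjs)
  then obtain k :: "(nat list \<times> ('i \<Rightarrow> nat)) set \<Rightarrow> 'i" where "codes_clopens k (gens Z n)" by blast
  then obtain F \<iota> where "compactin nat_power (carrier F) \<and>
      free_on C (gens Z n) (F :: ('i \<Rightarrow> nat) monoid) (subtopology nat_power (carrier F)) \<iota>"
    using ex_free_on[OF C inf _ pro_C_group_class_nonempty[OF G]] by blast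
  then have "case level_pair Z n of (F, \<iota>) \<Rightarrow> compactin nat_power (carrier F) \<and>
      free_on C (gens Z n) F (subtopology nat_power (carrier F)) \<iota>"
    unfolding level_pair_def
    by (intro someI_ex[where P="\<lambda>(F, \<iota>). compactin nat_power (carrier F) \<and>
      free_on C (gens Z n) F (subtopology nat_power (carrier F)) \<iota>"]) auto
  then show "compactin nat_power (carrier (level Z n))"
    "free_on C (gens Z n) (level Z n) (leveltop Z n) (gen Z n)"
    by (auto simp: level_def gen_def case_prod_unfold)
qed

lemma lift_hom:
  assumes "group (level Z n)" "group H" "topspace S = carrier H"
  shows "lift Z n H S f \<in> continuous_hom (level Z n) (leveltop Z n) H S"
    and "\<lbrakk>g' \<in> continuous_hom (level Z n) (leveltop Z n) H S;
      \<And>e. e \<in> topspace (gens Z n) \<Longrightarrow> g' (gen Z n e) = f e; e \<in> topspace (gens Z n)\<rbrakk> \<Longrightarrow>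
      lift Z n H S f (gen Z n e) = f e"
proof -
  have one: "(\<lambda>_. \<one>\<^bsub>H\<^esub>) \<in> continuous_hom (level Z n) (leveltop Z n) H S"
    using assms by (simp add: continuous_hom_def hom_def group.is_monoid)
  let ?P = "\<lambda>g. g \<in> continuous_hom (level Z n) (leveltop Z n) H S \<and>
     ((\<exists>g'\<in>continuous_hom (level Z n) (leveltop Z n) H S. \<forall>e\<in>topspace (gens Z n). g' (gen Z n e) = f e) \<longrightarrow>
      (\<forall>e\<in>topspace (gens Z n). g (gen Z n e) = f e))"
  have "\<exists>g. ?P g" using one by blast
  then have P: "?P (lift Z n H S f)" unfolding lift_def by (rule someI_ex)
  then show "lift Z n H S f \<in> continuous_hom (level Z n) (leveltop Z n) H S" by blast
  show "lift Z n H S f (gen Z n e) = f e"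
    if "g' \<in> continuous_hom (level Z n) (leveltop Z n) H S"
      "\<And>e. e \<in> topspace (gens Z n) \<Longrightarrow> g' (gen Z n e) = f e" "e \<in> topspace (gens Z n)"
    using P that by blast
qed

lemma cycles_closed:
  assumes Z: "\<And>k. k \<le> n \<Longrightarrow> compactin nat_power (Z k)"
  shows "closedin (leveltop Z n) (cycles Z n)"
proof -
  have pro: "pro_C_group C (level Z k) (leveltop Z k)" if "k \<le> n" for k
    using level_free(2)[of k Z] Z that by (simp add: free_on_def)
  show ?thesis
  proof (cases n)
    case 0
    have "augmentation Z \<in> continuous_hom (level Z 0) (leveltop Z 0) G T"
      unfolding augmentation_def by (rule lift_hom(1)) (use pro_C_groupD[OF G] pro_C_groupD[OF pro] in auto)
    from closedin_one_preimage[OF this G] show ?thesis using 0 by (simp add: cycles_def)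
  next
    case (Suc m)
    have "smap Z n (coface n i) \<in> continuous_hom (level Z n) (leveltop Z n) (level Z m) (leveltop Z m)" for i
      unfolding smap_def Let_def length_coface
      using lift_hom(1)[of Z n "level Z m" "leveltop Z m"] pro_C_groupD[OF pro] Suc by simp
    from closedin_one_preimage[OF this pro]
    have cl: "closedin (leveltop Z n) {x \<in> carrier (level Z n). smap Z n (coface n i) x = \<one>\<^bsub>level Z m\<^esub>}" for i
      using Suc by simp
    have "cycles Z n = (\<Inter>i\<in>{..n}. {x \<in> carrier (level Z n). smap Z n (coface n i) x = \<one>\<^bsub>level Z m\<^esub>})"
      using Suc by (auto simp: cycles_def)
    then show ?thesis using cl by (simp add: closedin_INT)
  qed
qed

text \<open>
  The cycles are closed in the compact group \<open>X\<^sub>n\<close>, and this group exists because the earlier spaces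
  are compact, hence have few clopen subsets.
\<close>

lemma Y_compact: "compactin nat_power (Y n)"
proof (induction n rule: less_induct)
  case (less n)
  show ?case
  proof (cases n)
    case 0
    then show ?thesis by (simp add: Y0)
  next
    case (Suc m)
    have Z: "compactin nat_power (Y k)" if "k \<le> m" for k using less Suc that by simp
    have "closedin (leveltop Y m) (cycles Y m)" using cycles_closed[OF Z] .
    moreover have "compactin nat_power (carrier (level Y m))" by (rule level_free(1)[OF Z])
    ultimately have "compactin (leveltop Y m) (cycles Y m)"
      using closedin_compact_space[OF compact_space_subtopology] by blast
    then have "compactin nat_power (cycles Y m)" by (simp add: compactin_subtopology)
    then show ?thesis unfolding Suc Y_Suc .
  qed
qed

declare Y.simps(2) [simp del]

abbreviation "X \<equiv> level Y"
abbreviation "XT \<equiv> leveltop Y"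

lemma X_free: "free_on C (gens Y n) (X n) (XT n) (gen Y n)"
  by (rule level_free(2)[OF Y_compact])

lemma X_pro_C: "pro_C_group C (X n) (XT n)"
  using X_free by (simp add: free_on_def)

lemma X_group: "group (X n)"
  using pro_C_groupD(1)[OF X_pro_C] .

lemma Y_Suc_subset: "Y (Suc n) \<subseteq> carrier (X n)"
  unfolding Y_Suc by (auto simp: cycles_def)

section \<open>Composition of simplicial operators\<close>

lemma lift_gen:
  fixes H :: "'h monoid"
  assumes "pro_C_group C H S" "continuous_map (gens Y n) S f" "e \<in> topspace (gens Y n)"
  shows "lift Y n H S f (gen Y n e) = f e"
proof -
  obtain g where "g \<in> continuous_hom (X n) (XT n) H S"
    "\<And>e. e \<in> topspace (gens Y n) \<Longrightarrow> g (gen Y n e) = f e"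
    using free_on_extend[OF C(1-3) X_free assms(1,2)] by blast
  then show ?thesis
    using lift_hom(2)[OF X_group pro_C_groupD(1,2)[OF assms(1)]] assms(3) by blast
qed

lemma hom_eqI:
  fixes H :: "'h monoid"
  assumes H: "pro_C_group C H S"
    and g: "g \<in> continuous_hom (X n) (XT n) H S" "g' \<in> continuous_hom (X n) (XT n) H S"
    and eq: "\<And>\<sigma> y. \<sigma> \<in> ordsurjs n \<Longrightarrow> y \<in> Y (Max (set \<sigma>)) \<Longrightarrow> g (gen Y n (\<sigma>, y)) = g' (gen Y n (\<sigma>, y))"
    and x: "x \<in> carrier (X n)"
  shows "g x = g' x"
  by (rule free_on_unique[OF X_free H g _ x]) (use eq in \<open>auto simp: topspace_gens\<close>)

lemma gen_continuous:
  assumes "\<rho> \<in> ordsurjs m"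
  shows "continuous_map (subtopology nat_power (Y (Max (set \<rho>)))) (XT m) (\<lambda>y. gen Y m (\<rho>, y))"
proof -
  have "continuous_map (subtopology nat_power (Y (Max (set \<rho>)))) (gens Y m) (\<lambda>y. (\<rho>, y))"
    unfolding gens_def using assms by (rule continuous_map_component_injection)
  moreover have "continuous_map (gens Y m) (XT m) (gen Y m)" using X_free by (simp add: free_on_def)
  ultimately show ?thesis
    using continuous_map_compose[of _ "gens Y m" "\<lambda>y. (\<rho>, y)" "XT m" "gen Y m"] by (simp add: o_def)
qed

lemma gen_closed:
  assumes "\<rho> \<in> ordsurjs m" "y \<in> Y (Max (set \<rho>))"
  shows "gen Y m (\<rho>, y) \<in> carrier (X m)"
  using gen_continuous[OF assms(1)] assms(2) by (auto simp: continuous_map_def)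

lemma reindex_hom:
  assumes "length \<tau> = Suc m"
  shows "reindex Y \<tau> \<in> continuous_hom (X (Max (set \<tau>))) (XT (Max (set \<tau>))) (X m) (XT m)"
  unfolding reindex_def Let_def using lift_hom(1)[OF X_group X_group, of "XT m"] assms by simp

lemma smap_hom:
  assumes "length \<alpha> = Suc m"
  shows "smap Y n \<alpha> \<in> continuous_hom (X n) (XT n) (X m) (XT m)"
  unfolding smap_def Let_def using lift_hom(1)[OF X_group X_group, of "XT m"] assms by simp

lemma smap_group_hom:
  assumes "length \<alpha> = Suc m"
  shows "group_hom (X n) (X m) (smap Y n \<alpha>)"
  using smap_hom[OF assms, of n] X_group
  by (simp add: group_hom_def group_hom_axioms_def continuous_hom_def)

lemma cell_continuous:
  assumes \<rho>: "\<rho> \<in> ordmaps m k"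
  shows "continuous_map (subtopology nat_power (Y k)) (XT m) (\<lambda>y. cell Y k y \<rho>)"
proof -
  have m: "length \<rho> - 1 = m" "length \<rho> = Suc m" using \<rho> by (simp_all add: ordmaps_length)
  consider (top) "set \<rho> = {..k}" | (bd) "set \<rho> = {..<k}" "set \<rho> \<noteq> {..k}"
    | (other) "set \<rho> \<noteq> {..k}" "set \<rho> \<noteq> {..<k}" by blast
  then show ?thesis
  proof cases
    case top
    then have "\<rho> \<in> ordsurjs m" "Max (set \<rho>) = k" using \<rho> ordsurjs_iff by auto
    then show ?thesis using gen_continuous[of \<rho> m] top by (simp add: cell_def m)
  next
    case bd
    have "set \<rho> \<noteq> {}" using m by auto
    then obtain j where k: "k = Suc j" using bd by (cases k) auto
    then have j: "Max (set \<rho>) = j" using bd by (simp add: lessThan_Suc_atMost)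
    have "continuous_map (XT j) (XT m) (reindex Y \<rho>)"
      using reindex_hom[OF m(2)] j by (simp add: continuous_hom_def)
    then have "continuous_map (subtopology nat_power (Y k)) (XT m) (reindex Y \<rho>)"
      unfolding k using Y_Suc_subset[of j]
      by (rule continuous_map_from_subtopology_mono)
    then show ?thesis using bd by (simp add: cell_def m)
  next
    case other
    then show ?thesis using X_group[of m] by (simp add: cell_def m group.is_monoid)
  qed
qed

lemma smap_gen:
  assumes \<sigma>: "\<sigma> \<in> ordsurjs n" and y: "y \<in> Y (Max (set \<sigma>))" and \<alpha>: "\<alpha> \<in> ordmaps m n"
  shows "smap Y n \<alpha> (gen Y n (\<sigma>, y)) = cell Y (Max (set \<sigma>)) y (lcomp \<sigma> \<alpha>)"
proof -
  have "continuous_map (gens Y n) (XT m) (\<lambda>e. cell Y (Max (set (fst e))) (snd e) (lcomp (fst e) \<alpha>))"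
    unfolding gens_def
    by (rule continuous_map_from_sum_topology)
      (simp add: cell_continuous lcomp_ordmaps[OF ordsurjs_ordmaps \<alpha>])
  from lift_gen[OF X_pro_C this, of "(\<sigma>, y)"] show ?thesis
    using \<sigma> y by (simp add: smap_def ordmaps_length[OF \<alpha>] topspace_gens)
qed

text \<open>Along a surjection the generators are only reindexed, so \<open>smap\<close> agrees there with \<open>reindex\<close>.\<close>

lemma reindex_eq_smap:
  assumes \<tau>: "\<tau> \<in> ordmaps m k" "set \<tau> = {..k}"
  shows "reindex Y \<tau> = smap Y k \<tau>"
proof -
  have "cell Y (Max (set (fst e))) (snd e) (lcomp (fst e) \<tau>) = gen Y m (lcomp (fst e) \<tau>, snd e)"
    if "e \<in> topspace (gens Y k)" for e
  proof -
    have \<sigma>: "fst e \<in> ordsurjs k" using that by (auto simp: topspace_gens)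
    then have "set (lcomp (fst e) \<tau>) = {..Max (set (fst e))}"
      using set_lcomp_surj[OF ordsurjs_ordmaps[OF \<sigma>] \<tau>(2)] unfolding ordsurjs_def by simp
    then show ?thesis using \<tau>(1) by (simp add: cell_def ordmaps_length)
  qed
  then have "lift Y k (X m) (XT m) (\<lambda>e. cell Y (Max (set (fst e))) (snd e) (lcomp (fst e) \<tau>)) =
      lift Y k (X m) (XT m) (\<lambda>e. gen Y m (lcomp (fst e) \<tau>, snd e))"
    by (intro lift_cong) auto
  then show ?thesis using \<tau> by (simp add: reindex_def smap_def ordmaps_length)
qed

text \<open>
  A map that is not onto factors through some \<open>\<delta>\<^sub>i\<close>, and all faces of a cycle are trivial. In dimension
  \<open>0\<close> every map is onto, so that the different meaning of cycles there does no harm.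
\<close>

lemma cycles_smap_non_surj:
  assumes y: "y \<in> cycles Y j" and \<gamma>: "\<gamma> \<in> ordmaps l j" "set \<gamma> \<noteq> {..j}"
    and comp_eq: "\<And>m \<alpha> \<beta>. \<alpha> \<in> ordmaps m j \<Longrightarrow> \<beta> \<in> ordmaps l m \<Longrightarrow> smap Y m \<beta> (smap Y j \<alpha> y) = smap Y j (lcomp \<alpha> \<beta>) y"
  shows "smap Y j \<gamma> y = \<one>\<^bsub>X l\<^esub>"
proof (cases j)
  case 0
  have "set \<gamma> \<noteq> {}" "set \<gamma> \<subseteq> {0}" using \<gamma> 0 by (auto simp: ordmaps_def)
  then have "set \<gamma> = {0}" by (metis subset_singletonD)
  then show ?thesis using \<gamma>(2) 0 by auto
next
  case (Suc i')
  obtain i where i: "i \<le> Suc i'" "i \<notin> set \<gamma>" using \<gamma> Suc by (auto simp: ordmaps_def)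
  obtain \<gamma>' where \<gamma>': "\<gamma>' \<in> ordmaps l i'" "\<gamma> = lcomp (coface (Suc i') i) \<gamma>'"
    using ordmaps_factor_coface[OF _ i] \<gamma>(1) Suc by blast
  have "smap Y j \<gamma> y = smap Y i' \<gamma>' (smap Y j (coface (Suc i') i) y)"
    using comp_eq[of "coface (Suc i') i" i' \<gamma>'] \<gamma>' coface_ordmaps Suc by simp
  also have "smap Y j (coface (Suc i') i) y = \<one>\<^bsub>X i'\<^esub>"
    using y i(1) Suc by (simp add: cycles_def)
  also have "smap Y i' \<gamma>' \<one>\<^bsub>X i'\<^esub> = \<one>\<^bsub>X l\<^esub>"
    using group_hom.hom_one[OF smap_group_hom[OF ordmaps_length[OF \<gamma>'(1)]]] .
  finally show ?thesis .
qed

text \<open>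
  If \<open>\<rho>\<close> has image \<open>[k - 1]\<close>, the claim is about the operators on the element \<open>y\<close> of \<open>X\<^sub>k\<^sub>-\<^sub>1\<close>: the
  composition law in lower dimension reduces it to the operator of \<open>\<rho>\<beta>\<close>, which is trivial on the cycle
  \<open>y\<close> unless \<open>\<rho>\<beta>\<close> is still onto \<open>[k - 1]\<close>.
\<close>

lemma smap_cell:
  assumes comp_eq: "\<And>j m l \<alpha> \<beta> x. \<lbrakk>j < k; \<alpha> \<in> ordmaps m j; \<beta> \<in> ordmaps l m; x \<in> carrier (X j)\<rbrakk> \<Longrightarrow>
      smap Y m \<beta> (smap Y j \<alpha> x) = smap Y j (lcomp \<alpha> \<beta>) x"
    and y: "y \<in> Y k" and \<rho>: "\<rho> \<in> ordmaps m k" and \<beta>: "\<beta> \<in> ordmaps l m"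
  shows "smap Y m \<beta> (cell Y k y \<rho>) = cell Y k y (lcomp \<rho> \<beta>)"
proof -
  have m: "length \<rho> - 1 = m" "length \<rho> = Suc m" and l: "length \<beta> - 1 = l" "length \<beta> = Suc l"
    using \<rho> \<beta> by (simp_all add: ordmaps_length)
  have sub: "set (lcomp \<rho> \<beta>) \<subseteq> set \<rho>" by (rule set_lcomp_subset[OF \<rho> \<beta>])
  have \<rho>k: "set \<rho> \<subseteq> {..k}" using \<rho> by (simp add: ordmaps_def)
  have \<rho>\<beta>: "lcomp \<rho> \<beta> \<in> ordmaps l k" by (rule lcomp_ordmaps[OF \<rho> \<beta>])
  consider (top) "set \<rho> = {..k}" | (bd) "set \<rho> = {..<k}" | (other) "set \<rho> \<noteq> {..k}" "set \<rho> \<noteq> {..<k}"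
    by blast
  then show ?thesis
  proof cases
    case top
    then have "\<rho> \<in> ordsurjs m" "Max (set \<rho>) = k" using \<rho> ordsurjs_iff by auto
    then show ?thesis using smap_gen[of \<rho> m y \<beta> l] y \<beta> top by (simp add: cell_def m)
  next
    case bd
    have ne: "set (lcomp \<rho> \<beta>) \<noteq> {..k}" "set \<rho> \<noteq> {..k}" using sub bd by auto
    have "set \<rho> \<noteq> {}" using m by auto
    then obtain j where k: "k = Suc j" using bd by (cases k) auto
    then have \<rho>j: "set \<rho> = {..j}" "\<rho> \<in> ordmaps m j" using bd \<rho> by (auto simp: ordmaps_def lessThan_Suc_atMost)
    have \<rho>\<beta>j: "lcomp \<rho> \<beta> \<in> ordmaps l j" by (rule lcomp_ordmaps[OF \<rho>j(2) \<beta>])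
    have yj: "y \<in> cycles Y j" using y unfolding k Y_Suc .
    then have yX: "y \<in> carrier (X j)" by (simp add: cycles_def)
    have "smap Y m \<beta> (cell Y k y \<rho>) = smap Y m \<beta> (smap Y j \<rho> y)"
      using bd ne reindex_eq_smap[OF \<rho>j(2,1)] by (simp add: cell_def)
    also have "\<dots> = smap Y j (lcomp \<rho> \<beta>) y" using comp_eq[OF _ \<rho>j(2) \<beta> yX] k by simp
    also have "\<dots> = cell Y k y (lcomp \<rho> \<beta>)"
    proof (cases "set (lcomp \<rho> \<beta>) = {..j}")
      case True
      then show ?thesis
        using reindex_eq_smap[OF \<rho>\<beta>j True] k ne by (simp add: cell_def lessThan_Suc_atMost)
    next
      case False
      have "smap Y j (lcomp \<rho> \<beta>) y = \<one>\<^bsub>X l\<^esub>"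
        by (rule cycles_smap_non_surj[OF yj \<rho>\<beta>j False comp_eq]) (use k yX in auto)
      then show ?thesis using False ne k l by (simp add: cell_def lessThan_Suc_atMost)
    qed
    finally show ?thesis .
  next
    case other
    then have "set (lcomp \<rho> \<beta>) \<noteq> {..k}" "set (lcomp \<rho> \<beta>) \<noteq> {..<k}"
      using sub \<rho>k by (auto simp flip: lessThan_Suc_atMost simp: lessThan_Suc)
    then show ?thesis
      using other group_hom.hom_one[OF smap_group_hom[OF l(2), of m]] by (simp add: cell_def m l)
  qed
qed

text \<open>
  On a generator \<open>(\<sigma>, y)\<close> of \<open>X\<^sub>n\<close> with \<open>y\<close> in \<open>Y\<^sub>k\<close> the claim is \<open>smap_cell\<close>, which appeals only to dimension
  \<open>k - 1 < n\<close>.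
\<close>

theorem smap_comp:
  "\<lbrakk>\<alpha> \<in> ordmaps m n; \<beta> \<in> ordmaps l m; x \<in> carrier (X n)\<rbrakk> \<Longrightarrow>
    smap Y m \<beta> (smap Y n \<alpha> x) = smap Y n (lcomp \<alpha> \<beta>) x"
proof (induction n arbitrary: \<alpha> \<beta> m l x rule: less_induct)
  case (less n)
  note \<alpha> = less.prems(1) and \<beta> = less.prems(2)
  have len: "length \<alpha> = Suc m" "length \<beta> = Suc l" "length (lcomp \<alpha> \<beta>) = Suc l"
    using \<alpha> \<beta> by (simp_all add: ordmaps_length)
  show ?case
  proof (rule hom_eqI[OF X_pro_C _ _ _ less.prems(3)])
    show "(\<lambda>x. smap Y m \<beta> (smap Y n \<alpha> x)) \<in> continuous_hom (X n) (XT n) (X l) (XT l)"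
      by (rule continuous_hom_comp[OF smap_hom[OF len(1)] smap_hom[OF len(2)]])
    show "smap Y n (lcomp \<alpha> \<beta>) \<in> continuous_hom (X n) (XT n) (X l) (XT l)"
      by (rule smap_hom[OF len(3)])
    fix \<sigma> y assume \<sigma>: "\<sigma> \<in> ordsurjs n" and y: "y \<in> Y (Max (set \<sigma>))"
    have "smap Y m \<beta> (smap Y n \<alpha> (gen Y n (\<sigma>, y))) = smap Y m \<beta> (cell Y (Max (set \<sigma>)) y (lcomp \<sigma> \<alpha>))"
      using smap_gen[OF \<sigma> y \<alpha>] by simp
    also have "\<dots> = cell Y (Max (set \<sigma>)) y (lcomp (lcomp \<sigma> \<alpha>) \<beta>)"
      by (rule smap_cell[OF _ y lcomp_ordmaps[OF ordsurjs_ordmaps[OF \<sigma>] \<alpha>] \<beta>])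
        (use less.IH Max_le_ordsurjs[OF \<sigma>] in auto)
    also have "\<dots> = smap Y n (lcomp \<alpha> \<beta>) (gen Y n (\<sigma>, y))"
      using smap_gen[OF \<sigma> y lcomp_ordmaps[OF \<alpha> \<beta>]] lcomp_assoc[OF \<beta> \<alpha>] by simp
    finally show "smap Y m \<beta> (smap Y n \<alpha> (gen Y n (\<sigma>, y))) = smap Y n (lcomp \<alpha> \<beta>) (gen Y n (\<sigma>, y))" .
  qed
qed

lemma smap_id:
  assumes "x \<in> carrier (X n)"
  shows "smap Y n [0..<Suc n] x = x"
proof (rule hom_eqI[OF X_pro_C _ _ _ assms])
  show "smap Y n [0..<Suc n] \<in> continuous_hom (X n) (XT n) (X n) (XT n)"
    by (rule smap_hom) simp
  show "(\<lambda>x. x) \<in> continuous_hom (X n) (XT n) (X n) (XT n)"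
    by (simp add: continuous_hom_def hom_def)
  fix \<sigma> y assume \<sigma>: "\<sigma> \<in> ordsurjs n" and y: "y \<in> Y (Max (set \<sigma>))"
  have "set \<sigma> = {..Max (set \<sigma>)}" "length \<sigma> = Suc n" using \<sigma> unfolding ordsurjs_def by blast+
  then show "smap Y n [0..<Suc n] (gen Y n (\<sigma>, y)) = gen Y n (\<sigma>, y)"
    using smap_gen[OF \<sigma> y idlist_ordmaps] lcomp_id_right[OF ordsurjs_ordmaps[OF \<sigma>]]
    unfolding cell_def Let_def by simp
qed

section \<open>The resolution and its homotopy\<close>

definition resolution :: "('i \<Rightarrow> nat) simplicial_top_group" where
  "resolution = \<lparr>grp = X, tpl = XT, face = (\<lambda>n i. smap Y n (coface n i)),
     degen = (\<lambda>n i. smap Y n (codegeneracy n i))\<rparr>"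

lemma resolution_simps [simp]:
  "grp resolution = X" "tpl resolution = XT" "face resolution n i = smap Y n (coface n i)"
  "degen resolution n i = smap Y n (codegeneracy n i)"
  by (simp_all add: resolution_def)

lemma simplicial_identities_resolution: "simplicial_identities resolution"
proof -
  have 1: "smap Y (Suc n) (coface (Suc n) i) (smap Y (Suc (Suc n)) (coface (Suc (Suc n)) j) x) =
      smap Y (Suc n) (coface (Suc n) (j - 1)) (smap Y (Suc (Suc n)) (coface (Suc (Suc n)) i) x)"
    if "x \<in> carrier (X (Suc (Suc n)))" "i < j" "j \<le> Suc (Suc n)" for n i j x
    using that by (simp add: smap_comp[OF coface_ordmaps coface_ordmaps] coface_coface)
  have 2: "smap Y (Suc (Suc n)) (coface (Suc (Suc n)) i) (smap Y (Suc n) (codegeneracy (Suc n) j) x) =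
      smap Y n (codegeneracy n (j - 1)) (smap Y (Suc n) (coface (Suc n) i) x)"
    if "x \<in> carrier (X (Suc n))" "i < j" "j \<le> Suc n" for n i j x
    using that smap_comp[OF codegeneracy_ordmaps coface_ordmaps, of j "Suc n" x i]
      smap_comp[OF coface_ordmaps codegeneracy_ordmaps, of "j - 1" n x i]
    by (simp add: codegeneracy_coface_less)
  have 3: "smap Y (Suc n) (coface (Suc n) i) (smap Y n (codegeneracy n j) x) = x"
    if "x \<in> carrier (X n)" "j \<le> n" "i = j \<or> i = Suc j" for n i j x
    using that(1) smap_comp[OF codegeneracy_ordmaps coface_ordmaps, of j n x i] that(2)
    unfolding codegeneracy_coface_id[OF that(2,3)] by (simp add: smap_id del: upt_Suc)
  have 4: "smap Y (Suc (Suc n)) (coface (Suc (Suc n)) i) (smap Y (Suc n) (codegeneracy (Suc n) j) x) =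
      smap Y n (codegeneracy n j) (smap Y (Suc n) (coface (Suc n) (i - 1)) x)"
    if "x \<in> carrier (X (Suc n))" "Suc j < i" "i \<le> Suc (Suc n)" for n i j x
    using that smap_comp[OF codegeneracy_ordmaps coface_ordmaps, of j "Suc n" x i]
      smap_comp[OF coface_ordmaps codegeneracy_ordmaps, of j n x "i - 1"]
    by (simp add: codegeneracy_coface_greater)
  have 5: "smap Y (Suc n) (codegeneracy (Suc n) i) (smap Y n (codegeneracy n j) x) =
      smap Y (Suc n) (codegeneracy (Suc n) (Suc j)) (smap Y n (codegeneracy n i) x)"
    if "x \<in> carrier (X n)" "i \<le> j" "j \<le> n" for n i j x
    using that smap_comp[OF codegeneracy_ordmaps codegeneracy_ordmaps, of j n i x]
      smap_comp[OF codegeneracy_ordmaps codegeneracy_ordmaps, of i n "Suc j" x]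
    by (simp add: codegeneracy_codegeneracy)
  show ?thesis
    unfolding simplicial_identities_def resolution_simps
    by (intro conjI allI ballI impI; (elim conjE)?) (fact 1 2 3 4 5)+
qed

lemma simplicial_resolution: "simplicial_pro_C_group C resolution"
  unfolding simplicial_pro_C_group_def resolution_simps
  using X_pro_C smap_hom simplicial_identities_resolution by simp

text \<open>
  The \<open>i\<close>-th face is the simplex of the cell that is indexed by \<open>\<delta>\<^sub>i\<close>, and among these maps only the last
  one has image \<open>[n]\<close>.
\<close>

lemma top_generator_faces:
  assumes z: "z \<in> Y (Suc n)" and i: "i \<le> Suc n"
  shows "smap Y (Suc n) (coface (Suc n) i) (gen Y (Suc n) ([0..<Suc (Suc n)], z)) =
    (if i = Suc n then z else \<one>\<^bsub>X n\<^esub>)"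
proof -
  let ?id = "[0..<Suc (Suc n)]"
  have id: "?id \<in> ordsurjs (Suc n)" "Max (set ?id) = Suc n"
    using idlist_ordmaps[of "Suc n"] set_idlist[of "Suc n"] ordsurjs_iff
    by (simp_all del: upt_Suc set_upt)
  have zX: "z \<in> carrier (X n)" using z Y_Suc_subset by blast
  have eq: "smap Y (Suc n) (coface (Suc n) i) (gen Y (Suc n) (?id, z)) = cell Y (Suc n) z (coface (Suc n) i)"
    using smap_gen[OF id(1) _ coface_ordmaps, of z i] z id(2) lcomp_id_left[OF coface_ordmaps]
    by (simp del: upt_Suc)
  have ne: "set (coface (Suc n) i) \<noteq> {..Suc n}" unfolding set_coface[OF i] using i by auto
  show ?thesis
  proof (cases "i = Suc n")
    case True
    have c: "coface (Suc n) i = [0..<Suc n]"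
      by (rule nth_equalityI) (use True in \<open>auto simp del: upt_Suc\<close>)
    have "set (coface (Suc n) i) = {..<Suc n}" unfolding c by auto
    then have "cell Y (Suc n) z (coface (Suc n) i) = reindex Y (coface (Suc n) i) z"
      using ne by (simp add: cell_def)
    also have "\<dots> = smap Y n [0..<Suc n] z"
      unfolding c using reindex_eq_smap[OF idlist_ordmaps set_idlist] by simp
    finally show ?thesis using eq smap_id[OF zX] True by simp
  next
    case False
    then have "n + 1 \<in> set (coface (Suc n) i)" unfolding set_coface[OF i] by simp
    then have "set (coface (Suc n) i) \<noteq> {..<Suc n}" by auto
    then show ?thesis using ne False unfolding eq by (simp add: cell_def)
  qed
qed

lemma gen_id_closed:
  assumes "z \<in> Y n" shows "gen Y n ([0..<Suc n], z) \<in> carrier (X n)"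
  using gen_closed[of "[0..<Suc n]" n z] assms set_idlist[of n] idlist_ordmaps[of n] ordsurjs_iff
  by (simp del: upt_Suc set_upt)

lemma augmentation_hom: "augmentation Y \<in> continuous_hom (X 0) (XT 0) G T"
  unfolding augmentation_def using lift_hom(1) X_group pro_C_groupD[OF G] by blast

lemma ordsurjs_0: "\<sigma> \<in> ordsurjs 0 \<longleftrightarrow> \<sigma> = [0]"
proof
  assume \<sigma>: "\<sigma> \<in> ordsurjs 0"
  then obtain a where "\<sigma> = [a]" by (auto simp: ordsurjs_def length_Suc_conv)
  moreover have "a \<le> 0" using Max_le_ordsurjs[OF \<sigma>] calculation by simp
  ultimately show "\<sigma> = [0]" by simp
qed (auto simp: ordsurjs_def)

lemma augmentation_gen:
  assumes "y \<in> Y0"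
  shows "augmentation Y (gen Y 0 ([0], y)) = aug y"
proof -
  have "continuous_map (gens Y 0) T (\<lambda>e. aug (snd e))"
    unfolding gens_def by (rule continuous_map_from_sum_topology) (simp add: ordsurjs_0 aug(1))
  from lift_gen[OF G this, of "([0], y)"] show ?thesis
    using assms by (simp add: augmentation_def topspace_gens ordsurjs_0)
qed

lemma augmentation_surj: "augmentation Y ` carrier (X 0) = carrier G"
proof
  show "augmentation Y ` carrier (X 0) \<subseteq> carrier G"
    using augmentation_hom by (auto simp: continuous_hom_def hom_def)
  show "carrier G \<subseteq> augmentation Y ` carrier (X 0)"
  proof
    fix g assume "g \<in> carrier G"
    then have "g \<in> aug ` Y0" unfolding aug(2) .
    then obtain y where y: "y \<in> Y0" "aug y = g" by (elim imageE) simp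
    show "g \<in> augmentation Y ` carrier (X 0)"
    proof (rule image_eqI)
      show "g = augmentation Y (gen Y 0 ([0], y))" using augmentation_gen[OF y(1)] y(2) by simp
      show "gen Y 0 ([0], y) \<in> carrier (X 0)" using gen_id_closed[of y 0] y(1) by simp
    qed
  qed
qed

text \<open>
  The faces of a degenerate generator agree, and those of a \<open>1\<close>-cell are the identity and an element of
  the kernel of the augmentation.
\<close>

lemma augmentation_faces:
  assumes x: "x \<in> carrier (X (Suc 0))"
  shows "augmentation Y (smap Y (Suc 0) (coface (Suc 0) 0) x) =
    augmentation Y (smap Y (Suc 0) (coface (Suc 0) (Suc 0)) x)"
proof (rule hom_eqI[OF G _ _ _ x])
  show "(\<lambda>x. augmentation Y (smap Y (Suc 0) (coface (Suc 0) i) x))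
      \<in> continuous_hom (X (Suc 0)) (XT (Suc 0)) G T" for i
    by (rule continuous_hom_comp[OF smap_hom augmentation_hom]) simp
  then show "(\<lambda>x. augmentation Y (smap Y (Suc 0) (coface (Suc 0) (Suc 0)) x))
      \<in> continuous_hom (X (Suc 0)) (XT (Suc 0)) G T" .
  fix \<sigma> y assume \<sigma>: "\<sigma> \<in> ordsurjs (Suc 0)" and y: "y \<in> Y (Max (set \<sigma>))"
  show "augmentation Y (smap Y (Suc 0) (coface (Suc 0) 0) (gen Y (Suc 0) (\<sigma>, y))) =
    augmentation Y (smap Y (Suc 0) (coface (Suc 0) (Suc 0)) (gen Y (Suc 0) (\<sigma>, y)))"
  proof (cases rule: ordsurjs_Suc_cases[OF \<sigma>])
    case 1
    then have \<sigma>1: "\<sigma> = [0..<Suc (Suc 0)]" and z: "y \<in> Y (Suc 0)"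
      using y by simp_all
    have "augmentation Y y = \<one>\<^bsub>G\<^esub>" using z unfolding Y_Suc by (simp add: cycles_def)
    moreover have "augmentation Y \<one>\<^bsub>X 0\<^esub> = \<one>\<^bsub>G\<^esub>"
      using hom_one[of "augmentation Y" "X 0" G] augmentation_hom X_group pro_C_groupD(1)[OF G]
      by (simp add: continuous_hom_def)
    ultimately show ?thesis
      using top_generator_faces[OF z, of 0] top_generator_faces[OF z, of "Suc 0"] unfolding \<sigma>1
      by (simp del: upt_Suc)
  next
    case (2 i \<sigma>')
    then have "\<sigma>' = [0]" "i = 0" by (simp_all add: ordsurjs_0)
    then have \<sigma>0: "\<sigma> = [0, 0]" using 2(3) by (simp add: lcomp_def codegeneracy_def)
    have "lcomp \<sigma> (coface (Suc 0) i) = [0]" if "i \<le> Suc 0" for i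
      using that unfolding \<sigma>0 by (auto simp: lcomp_def coface_def le_Suc_eq)
    then show ?thesis using smap_gen[OF \<sigma> y coface_ordmaps] by simp
  qed
qed

text \<open>
  A cycle is the boundary of the generator that it contributes in the next dimension. Conversely, the
  faces of a boundary are computed by \<open>d\<^sub>i d\<^sub>n\<^sub>+\<^sub>1 = d\<^sub>n d\<^sub>i\<close>, and in dimension \<open>0\<close>, where the cycles are the
  kernel of the augmentation, by \<open>augmentation_faces\<close>.
\<close>

lemma boundaries_eq_cycles: "moore_boundaries resolution n = cycles Y n"
proof
  show "cycles Y n \<subseteq> moore_boundaries resolution n"
  proof
    fix z assume "z \<in> cycles Y n"
    then have z: "z \<in> Y (Suc n)" by (simp only: Y_Suc)
    let ?x = "gen Y (Suc n) ([0..<Suc (Suc n)], z)"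
    have "?x \<in> moore resolution (Suc n)"
      using gen_id_closed[OF z] top_generator_faces[OF z] by (simp add: moore_def del: upt_Suc)
    moreover have "face resolution (Suc n) (Suc n) ?x = z"
      using top_generator_faces[OF z, of "Suc n"] by (simp del: upt_Suc)
    ultimately show "z \<in> moore_boundaries resolution n"
      unfolding moore_boundaries_def by (metis image_eqI)
  qed
  show "moore_boundaries resolution n \<subseteq> cycles Y n"
  proof
    fix z assume "z \<in> moore_boundaries resolution n"
    then obtain x where x: "x \<in> carrier (X (Suc n))"
      "\<And>i. i \<le> n \<Longrightarrow> smap Y (Suc n) (coface (Suc n) i) x = \<one>\<^bsub>X n\<^esub>"
      and z: "z = smap Y (Suc n) (coface (Suc n) (Suc n)) x"
      by (auto simp: moore_boundaries_def moore_def less_Suc_eq_le)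
    have zX: "z \<in> carrier (X n)"
      unfolding z using group_hom.hom_closed[OF smap_group_hom x(1)] by simp
    show "z \<in> cycles Y n"
    proof (cases n)
      case 0
      have "augmentation Y z = augmentation Y \<one>\<^bsub>X 0\<^esub>"
        using augmentation_faces[of x] x z 0 by simp
      also have "\<dots> = \<one>\<^bsub>G\<^esub>"
        using hom_one[of "augmentation Y" "X 0" G] augmentation_hom X_group pro_C_groupD(1)[OF G]
        by (simp add: continuous_hom_def)
      finally show ?thesis using zX 0 by (simp add: cycles_def)
    next
      case (Suc m)
      have "smap Y n (coface n i) z = \<one>\<^bsub>X m\<^esub>" if i: "i \<le> n" for i
      proof -
        have "smap Y n (coface n i) z = smap Y n (coface n n) (smap Y (Suc n) (coface (Suc n) i) x)"
          unfolding z Suc using x(1) i Suc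
          by (simp add: smap_comp[OF coface_ordmaps coface_ordmaps] coface_coface)
        also have "\<dots> = \<one>\<^bsub>X m\<^esub>"
          unfolding x(2)[OF i] using group_hom.hom_one[OF smap_group_hom] Suc by simp
        finally show ?thesis .
      qed
      then show ?thesis using zX Suc by (simp add: cycles_def)
    qed
  qed
qed

lemma moore_cycles_eq: "n > 0 \<Longrightarrow> moore_cycles resolution n = cycles Y n"
  by (auto simp: moore_cycles_def moore_def cycles_def le_less)

lemma subgroup_cycles: "subgroup (cycles Y n) (X n)"
proof -
  interpret Xn: group "X n" by (rule X_group)
  show ?thesis
  proof (cases n)
    case 0
    interpret h: group_hom "X 0" G "augmentation Y"
      using augmentation_hom X_group pro_C_groupD(1)[OF G]
      by (simp add: group_hom_def group_hom_axioms_def continuous_hom_def)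
    have "cycles Y n = kernel (X 0) G (augmentation Y)" using 0 by (auto simp: cycles_def kernel_def)
    then show ?thesis using h.subgroup_kernel 0 by simp
  next
    case (Suc m)
    have "cycles Y n = \<Inter>((\<lambda>i. kernel (X n) (X m) (smap Y n (coface n i))) ` {..n})"
      using Suc by (auto simp: cycles_def kernel_def)
    moreover have "subgroup (kernel (X n) (X m) (smap Y n (coface n i))) (X n)" for i
      using group_hom.subgroup_kernel[OF smap_group_hom] Suc by simp
    ultimately show ?thesis using Xn.subgroups_Inter[of "(\<lambda>i. kernel (X n) (X m) (smap Y n (coface n i))) ` {..n}"]
      by auto
  qed
qed

lemma higher_homotopy_trivial:
  assumes "n > 0"
  shows "carrier (homotopy_group resolution n) = {\<one>\<^bsub>homotopy_group resolution n\<^esub>}"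
proof -
  let ?Z = "(X n)\<lparr>carrier := cycles Y n\<rparr>"
  have "group ?Z" using group.subgroup_imp_group[OF X_group subgroup_cycles] .
  moreover have "homotopy_group resolution n = ?Z Mod carrier ?Z"
    using moore_cycles_eq[OF assms] by (simp add: homotopy_group_def boundaries_eq_cycles)
  ultimately show ?thesis using Mod_self_trivial[of ?Z] by (simp add: FactGroup_def)
qed

lemma pi_0:
  "\<exists>h \<in> iso (homotopy_group resolution 0) G. homeomorphic_map (homotopy_group_topology resolution 0) T h"
proof -
  interpret h: group_hom "X 0" G "augmentation Y"
    using augmentation_hom X_group pro_C_groupD(1)[OF G]
    by (simp add: group_hom_def group_hom_axioms_def continuous_hom_def)
  let ?K = "kernel (X 0) G (augmentation Y)"
  let ?h = "\<lambda>c. the_elem (augmentation Y ` c)"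
  have K: "cycles Y 0 = ?K" by (auto simp: cycles_def kernel_def)
  have Z: "moore_cycles resolution 0 = carrier (X 0)" by (auto simp: moore_cycles_def moore_def)
  have "homotopy_group resolution 0 = X 0 Mod ?K"
    unfolding homotopy_group_def boundaries_eq_cycles K Z by simp
  then have iso: "?h \<in> iso (homotopy_group resolution 0) G"
    using h.FactGroup_iso_set[OF augmentation_surj] by simp
  have hq: "?h (?K #>\<^bsub>X 0\<^esub> x) = augmentation Y x" if x: "x \<in> carrier (X 0)" for x
  proof -
    have "augmentation Y ` (?K #>\<^bsub>X 0\<^esub> x) = {augmentation Y x}"
    proof (intro equalityI subsetI)
      show "b \<in> {augmentation Y x}" if "b \<in> augmentation Y ` (?K #>\<^bsub>X 0\<^esub> x)" for b
        using that x by (auto simp: r_coset_def kernel_def)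
      have "x \<in> ?K #>\<^bsub>X 0\<^esub> x" using h.G.rcos_self[OF x h.subgroup_kernel] .
      then show "b \<in> augmentation Y ` (?K #>\<^bsub>X 0\<^esub> x)" if "b \<in> {augmentation Y x}" for b
        using that by blast
    qed
    then show ?thesis by simp
  qed
  have top: "homotopy_group_topology resolution 0 = quotient_topology (XT 0) (\<lambda>x. ?K #>\<^bsub>X 0\<^esub> x)"
    unfolding homotopy_group_topology_def boundaries_eq_cycles K Z
    by (simp add: subtopology_subtopology)
  have "homeomorphic_map (homotopy_group_topology resolution 0) T ?h"
    unfolding top
  proof (rule homeomorphic_map_from_quotient_topology)
    show "compact_space (XT 0)" "Hausdorff_space T" using pro_C_groupD[OF X_pro_C] pro_C_groupD[OF G] by auto
    show "continuous_map (XT 0) T (augmentation Y)" using augmentation_hom by (simp add: continuous_hom_def)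
    show "augmentation Y ` topspace (XT 0) = topspace T"
      using augmentation_surj pro_C_groupD[OF G] pro_C_groupD[OF X_pro_C] by simp
    show "?h (?K #>\<^bsub>X 0\<^esub> x) = augmentation Y x" if "x \<in> topspace (XT 0)" for x
      using hq that by simp
    have "(\<lambda>x. ?K #>\<^bsub>X 0\<^esub> x) ` topspace (XT 0) = carrier (X 0 Mod ?K)"
      by (auto simp: FactGroup_def RCOSETS_def)
    then show "inj_on ?h ((\<lambda>x. ?K #>\<^bsub>X 0\<^esub> x) ` topspace (XT 0))"
      using h.FactGroup_inj_on by simp
  qed
  then show ?thesis using iso by blast
qed

lemma gens_compact: "compact_space (gens Y n)"
  unfolding gens_def by (rule compact_space_sum_topology[OF finite_ordsurjs])
    (simp add: Y_compact compact_space_subtopology)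

lemma degen_gen:
  assumes "i \<le> n" "\<sigma> \<in> ordsurjs n" "y \<in> Y (Max (set \<sigma>))"
  shows "smap Y n (codegeneracy n i) (gen Y n (\<sigma>, y)) = gen Y (Suc n) (lcomp \<sigma> (codegeneracy n i), y)"
    and "(lcomp \<sigma> (codegeneracy n i), y) \<in> topspace (gens Y (Suc n))"
proof -
  note s = lcomp_ordsurjs[OF assms(2) codegeneracy_ordmaps[OF assms(1)] set_codegeneracy[OF assms(1)]]
  have "set \<sigma> = {..Max (set \<sigma>)}" using assms(2) unfolding ordsurjs_def by blast
  then show "smap Y n (codegeneracy n i) (gen Y n (\<sigma>, y)) = gen Y (Suc n) (lcomp \<sigma> (codegeneracy n i), y)"
    using smap_gen[OF assms(2,3) codegeneracy_ordmaps[OF assms(1)]] s(2) unfolding cell_def Let_def by simp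
  show "(lcomp \<sigma> (codegeneracy n i), y) \<in> topspace (gens Y (Suc n))"
    using s assms(3) by (simp add: topspace_gens)
qed

text \<open>
  The map that is the identity on the other generators and trivial on the copy \<open>\<sigma>'\<close>, which is clopen,
  extends to an endomorphism. A common element of the copies \<open>\<sigma>\<close> and \<open>\<sigma>'\<close> is both fixed and killed by
  it.
\<close>

lemma degenerate_meets_new:
  assumes e: "(\<sigma>, y) \<in> topspace (gens Y n)" "(\<sigma>', y') \<in> topspace (gens Y n)"
    and ne: "\<sigma> \<noteq> \<sigma>'" and eq: "gen Y n (\<sigma>, y) = gen Y n (\<sigma>', y')"
  shows "gen Y n (\<sigma>, y) = \<one>\<^bsub>X n\<^esub>"
proof -
  let ?f = "\<lambda>e. if fst e = \<sigma>' then \<one>\<^bsub>X n\<^esub> else gen Y n e"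
  have "continuous_map (gens Y n) (XT n) ?f"
    unfolding gens_def
  proof (rule continuous_map_from_sum_topology)
    fix \<rho> assume "\<rho> \<in> ordsurjs n"
    then show "continuous_map (subtopology nat_power (Y (Max (set \<rho>)))) (XT n) (\<lambda>y. ?f (\<rho>, y))"
      using gen_continuous[of \<rho> n] X_group[of n] by (cases "\<rho> = \<sigma>'") (simp_all add: group.is_monoid)
  qed
  note lg = lift_gen[OF X_pro_C this]
  show ?thesis using lg[OF e(1)] lg[OF e(2)] ne eq by simp
qed

lemma CW_basis_resolution: "CW_basis C resolution (\<lambda>n. gen Y n ` topspace (gens Y n))"
  unfolding CW_basis_def resolution_simps
proof (intro conjI allI impI)
  fix n
  show "free_pro_C_group C (X n) (XT n) (gen Y n ` topspace (gens Y n))"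
    by (rule free_on_imp_free_pro_C_group[OF C(1-3) X_free gens_compact])
  show "smap Y n (codegeneracy n i) ` gen Y n ` topspace (gens Y n) \<subseteq> gen Y (Suc n) ` topspace (gens Y (Suc n))"
    if "i \<le> n" for i
    using degen_gen[OF that] by (auto simp: topspace_gens)
  let ?D = "\<Union>i\<le>n. smap Y n (codegeneracy n i) ` gen Y n ` topspace (gens Y n)"
  let ?id = "[0..<Suc (Suc n)]"
  let ?N = "(\<lambda>y. gen Y (Suc n) (?id, y)) ` Y (Suc n)"
  have id: "?id \<in> ordsurjs (Suc n)" "Max (set ?id) = Suc n"
    using idlist_ordmaps[of "Suc n"] set_idlist[of "Suc n"] ordsurjs_iff
    by (simp_all del: upt_Suc set_upt)
  have idY: "(?id, y) \<in> topspace (gens Y (Suc n))" if "y \<in> Y (Suc n)" for y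
    using that id by (simp add: topspace_gens del: upt_Suc set_upt)
  have "compactin (XT (Suc n)) ?N"
  proof (rule image_compactin)
    show "continuous_map (subtopology nat_power (Y (Suc n))) (XT (Suc n)) (\<lambda>y. gen Y (Suc n) (?id, y))"
      using gen_continuous[OF id(1)] unfolding id(2) .
    show "compactin (subtopology nat_power (Y (Suc n))) (Y (Suc n))"
      using Y_compact[of "Suc n"] by (simp add: compactin_subtopology)
  qed
  then have "closedin (XT (Suc n)) ?N"
    using compactin_imp_closedin pro_C_groupD(3)[OF X_pro_C] by blast
  moreover have "gen Y (Suc n) ` topspace (gens Y (Suc n)) = ?D \<union> ?N"
  proof (intro equalityI subsetI)
    fix x assume "x \<in> gen Y (Suc n) ` topspace (gens Y (Suc n))"
    then obtain \<sigma> y where x: "x = gen Y (Suc n) (\<sigma>, y)" and \<sigma>: "\<sigma> \<in> ordsurjs (Suc n)" and y: "y \<in> Y (Max (set \<sigma>))"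
      by (auto simp: topspace_gens)
    show "x \<in> ?D \<union> ?N"
    proof (cases rule: ordsurjs_Suc_cases[OF \<sigma>])
      case 1
      then have "y \<in> Y (Suc n)" using y id(2) by simp
      then show ?thesis using x 1 by blast
    next
      case (2 i \<sigma>')
      have "Max (set \<sigma>') = Max (set \<sigma>)"
        using lcomp_ordsurjs(2)[OF 2(2) codegeneracy_ordmaps[OF 2(1)] set_codegeneracy[OF 2(1)]] 2(3) by simp
      then have y': "y \<in> Y (Max (set \<sigma>'))" using y by simp
      have "x = smap Y n (codegeneracy n i) (gen Y n (\<sigma>', y))"
        using degen_gen(1)[OF 2(1,2) y'] x 2(3) by simp
      moreover have "(\<sigma>', y) \<in> topspace (gens Y n)" using 2(2) y' by (simp add: topspace_gens)
      ultimately show ?thesis using 2(1) by blast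
    qed
  next
    fix x assume "x \<in> ?D \<union> ?N"
    then show "x \<in> gen Y (Suc n) ` topspace (gens Y (Suc n))"
      using degen_gen idY by (auto simp: topspace_gens)
  qed
  moreover have "?D \<inter> ?N \<subseteq> {\<one>\<^bsub>X (Suc n)\<^esub>}"
  proof
    fix x assume "x \<in> ?D \<inter> ?N"
    then obtain i \<sigma> y z where i: "i \<le> n" and \<sigma>: "\<sigma> \<in> ordsurjs n" "y \<in> Y (Max (set \<sigma>))"
      and x: "x = smap Y n (codegeneracy n i) (gen Y n (\<sigma>, y))" "x = gen Y (Suc n) (?id, z)" and z: "z \<in> Y (Suc n)"
      by (auto simp: topspace_gens)
    have "gen Y (Suc n) (lcomp \<sigma> (codegeneracy n i), y) = \<one>\<^bsub>X (Suc n)\<^esub>"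
      by (rule degenerate_meets_new[OF degen_gen(2)[OF i \<sigma>] idY[OF z] lcomp_codegeneracy_not_id[OF i]])
        (use degen_gen(1)[OF i \<sigma>] x in simp)
    then show "x \<in> {\<one>\<^bsub>X (Suc n)\<^esub>}" using degen_gen(1)[OF i \<sigma>] x by simp
  qed
  ultimately show "\<exists>N. closedin (XT (Suc n)) N \<and> gen Y (Suc n) ` topspace (gens Y (Suc n)) = ?D \<union> N \<and>
      ?D \<inter> N \<subseteq> {\<one>\<^bsub>X (Suc n)\<^esub>}" by blast
qed

theorem free_simplicial_resolution_resolution: "free_simplicial_resolution C resolution G T"
  unfolding free_simplicial_resolution_def
  using simplicial_resolution higher_homotopy_trivial pi_0 CW_basis_resolution by blast

end

theorem mainTheorem2:
  fixes C :: "nat monoid set" and G :: "'a monoid" and T :: "'a topology"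
  assumes "class_of_finite_groups C"
    and "subgroup_closed C" and "quotient_closed C"
    and "product_closed C" and "extension_closed C"
    and "pro_C_group C G T"
  shows "\<exists>X :: ('a set + nat \<Rightarrow> nat) simplicial_top_group. free_simplicial_resolution C X G T"
proof -
  have inf: "infinite (UNIV :: ('a set + nat) set)"
    using finite_imageD[of Inr "UNIV :: nat set"] by (meson finite_subset inj_Inr infinite_UNIV_nat subset_UNIV)
  have G: "group G" "topspace T = carrier G"
    using assms(6) by (auto simp: pro_C_group_def topological_group_on_def)
  have ne: "C \<noteq> {}" by (rule pro_C_group_class_nonempty[OF assms(6)])
  have "codes_clopens (Inl :: 'a set \<Rightarrow> 'a set + nat) T" by (simp add: codes_clopens_def)
  then obtain F \<iota> where F: "compactin nat_power (carrier (F :: ('a set + nat \<Rightarrow> nat) monoid))"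
      "free_on C T F (subtopology nat_power (carrier F)) \<iota>"
    using ex_free_on[OF assms(1-4) inf _ ne] by blast
  (* Extending the identity of G shows that the free group on the space of G maps onto G. *)
  obtain g where g: "g \<in> continuous_hom F (subtopology nat_power (carrier F)) G T"
      "\<And>x. x \<in> topspace T \<Longrightarrow> g (\<iota> x) = x"
    by (rule free_on_extend[OF assms(1-3) F(2) assms(6), of "\<lambda>x. x"]) auto
  have "\<iota> x \<in> carrier F" if "x \<in> carrier G" for x
    using F(2) that G(2) by (auto simp: free_on_def continuous_map_def)
  then have "carrier G \<subseteq> g ` carrier F" using g(2) G(2) by (metis image_eqI subsetI)
  moreover have "g ` carrier F \<subseteq> carrier G" using g(1) by (auto simp: continuous_hom_def hom_def)
  ultimately interpret resolution_construction C G T "carrier F" g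
    using assms inf F(1) g(1) by unfold_locales (auto simp: continuous_hom_def)
  show ?thesis using free_simplicial_resolution_resolution by blast
qed

end
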